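(* Let $\Omega\subset\mathbb R^2$ be a bounded convex open set with piecewise $C^\infty$ boundary and $0\in\Omega$, put $\dot\Omega=\Omega\setminus\{0\}$, assume that $\dot\Omega$ is invariant under $\sigma_1(x,y)=(-x,y)$ and $\sigma_2(x,y)=(x,-y)$, and write $\Omega\cap\{y=0\}=\,]-\frac a2,\frac a2[\times\{0\}$, $\Omega\cap\{x=0\}=\{0\}\times]-\frac b2,\frac b2[$. Let $\Omega^{uh}=\Omega\cap\{y>0\}$, $\Omega^{lh}=\Omega\cap\{y<0\}$, $\Omega^{leh}=\Omega\cap\{x<0\}$, $\Omega^{rih}=\Omega\cap\{x>0\}$. The following problems have the same eigenvalues: (1) the Dirichlet problem for the Aharonov-Bohm operator $-\Delta_{\mathbf A}$ on $\dot\Omega$; (2) the Dirichlet-Neumann problem for the Laplacian on $\Omega^{uh}$; (3) the Dirichlet-Neumann problem for the Laplacian on $\Omega^{leh}$; (4) the Dirichlet-Neumann problem for the Laplacian on $\Omega^{lh}$; (5) the Dirichlet-Neumann problem for the Laplacian on $\Omega^{rih}$.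
   Context: Aharonov-Bohm operator: for $\mathbf A(x,y)=(A_1,A_2)=\frac12\left(-\frac{y}{r^2},\frac{x}{r^2}\right)$, $r^2=x^2+y^2$, $-\Delta_{\mathbf A}$ is the Friedrichs extension in $L^2(\dot\Omega)=L^2(\dot\Omega;\mathbb C)$ of $(D_x-A_1)^2+(D_y-A_2)^2$ on $C_0^\infty(\dot\Omega)$, with $D_x=-i\partial_x$, $D_y=-i\partial_y$; this is its Dirichlet realization. Dirichlet-Neumann problems: eigenvalue problem for $-\Delta$ on the half-domain with Dirichlet condition on the whole boundary except on one half of the symmetry segment, where the Neumann condition is imposed. For $\Omega^{uh}$ and $\Omega^{lh}$ the Neumann part is $]0,\frac a2]\times\{0\}$; for $\Omega^{leh}$ and $\Omega^{rih}$ the Neumann part is $\{0\}\times]0,\frac b2]$. The corresponding operator is the self-adjoint operator associated with the form $\int|\nabla w|^2$ on $H^1$ functions of the half-domain vanishing on the boundary outside the Neumann part. *)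

theory Defs
  imports "HOL-Analysis.Analysis"
begin

type_synonym plane = "real \<times> real"
type_synonym cfun = "real \<times> real \<Rightarrow> complex"

fun Ck :: "nat \<Rightarrow> ('a::real_normed_vector \<Rightarrow> 'b::real_normed_vector) \<Rightarrow> bool" where
  "Ck 0 f \<longleftrightarrow> continuous_on UNIV f"
| "Ck (Suc k) f \<longleftrightarrow> (\<forall>x. f differentiable at x) \<and>
     (\<forall>v. Ck k (\<lambda>x. frechet_derivative f (at x) v))"

definition smooth :: "('a::real_normed_vector \<Rightarrow> 'b::real_normed_vector) \<Rightarrow> bool" where
  "smooth f \<longleftrightarrow> (\<forall>k. Ck k f)"

abbreviation dirderiv :: "'a::real_normed_vector \<Rightarrow> ('a \<Rightarrow> 'b::real_normed_vector) \<Rightarrow> 'a \<Rightarrow> 'b" where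
  "dirderiv e f z \<equiv> frechet_derivative f (at z) e"

text \<open>Elements of $C_0^\infty(U)$ are represented by their extension by zero.\<close>

definition test_functions :: "plane set \<Rightarrow> cfun set" where
  "test_functions U = {\<phi>. smooth \<phi> \<and> compact (closure {z. \<phi> z \<noteq> 0}) \<and> closure {z. \<phi> z \<noteq> 0} \<subseteq> U}"

text \<open>The frontier is a closed Jordan curve consisting of finitely many regular arcs, each smooth
  up to its endpoints (it is the restriction of a smooth map of the line).\<close>

definition piecewise_smooth_boundary :: "plane set \<Rightarrow> bool" where
  "piecewise_smooth_boundary U \<longleftrightarrow>
     (\<exists>\<gamma> n t. simple_path \<gamma> \<and> pathfinish \<gamma> = pathstart \<gamma> \<and> path_image \<gamma> = frontier U \<and>
        t 0 = 0 \<and> t n = 1 \<and>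
        (\<forall>i<n. t i < t (Suc i) \<and>
           (\<exists>g :: real \<Rightarrow> plane. smooth g \<and>
              (\<forall>s\<in>{t i..t (Suc i)}. g s = \<gamma> s \<and> vector_derivative g (at s) \<noteq> 0))))"

text \<open>Elements of \<open>L\<^sup>2(U)\<close> are functions whose values outside \<open>U\<close> are irrelevant; equality in
  \<open>L\<^sup>2(U)\<close> is equality almost everywhere on \<open>U\<close>.\<close>

definition L2 :: "plane set \<Rightarrow> cfun set" where
  "L2 U = {f. set_borel_measurable lborel U f \<and> set_integrable lborel U (\<lambda>z. (cmod (f z))\<^sup>2)}"

definition L2_inner :: "plane set \<Rightarrow> cfun \<Rightarrow> cfun \<Rightarrow> complex" where
  "L2_inner U f g = (LINT z:U|lborel. f z * cnj (g z))"

definition L2_norm :: "plane set \<Rightarrow> cfun \<Rightarrow> real" where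
  "L2_norm U f = sqrt (LINT z:U|lborel. (cmod (f z))\<^sup>2)"

text \<open>A possibly unbounded operator is given by its graph, a relation on representatives.\<close>

definition eigenvalues :: "plane set \<Rightarrow> (cfun \<times> cfun) set \<Rightarrow> complex set" where
  "eigenvalues U T =
     {\<mu>. \<exists>u. (u, \<lambda>z. \<mu> * u z) \<in> T \<and> \<not> (AE z in lborel. z \<in> U \<longrightarrow> u z = 0)}"

text \<open>Friedrichs extension of a densely defined symmetric nonnegative operator \<open>S\<close> with
  domain \<open>D\<close>: the restriction of the adjoint of \<open>S\<close> to the domain of the closure of the form
  \<open>\<langle>S \<phi>, \<phi>\<rangle>\<close>, that is, to the \<open>L\<^sup>2\<close>-limits of form-Cauchy sequences in \<open>D\<close>.\<close>

definition form_closure_domain :: "plane set \<Rightarrow> cfun set \<Rightarrow> (cfun \<Rightarrow> cfun) \<Rightarrow> cfun set" where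
  "form_closure_domain U D S =
     {u \<in> L2 U. \<exists>\<phi> :: nat \<Rightarrow> cfun. (\<forall>n. \<phi> n \<in> D) \<and>
        (\<lambda>n. L2_norm U (\<lambda>z. \<phi> n z - u z)) \<longlonglongrightarrow> 0 \<and>
        (\<forall>\<epsilon>>0. \<exists>N. \<forall>m\<ge>N. \<forall>n\<ge>N.
           Re (L2_inner U (S (\<lambda>z. \<phi> m z - \<phi> n z)) (\<lambda>z. \<phi> m z - \<phi> n z)) < \<epsilon>)}"

definition friedrichs_extension ::
  "plane set \<Rightarrow> cfun set \<Rightarrow> (cfun \<Rightarrow> cfun) \<Rightarrow> (cfun \<times> cfun) set" where
  "friedrichs_extension U D S =
     {(u, f). u \<in> form_closure_domain U D S \<and> f \<in> L2 U \<and>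
        (\<forall>\<psi>\<in>D. L2_inner U u (S \<psi>) = L2_inner U f \<psi>)}"

definition form_operator ::
  "plane set \<Rightarrow> cfun set \<Rightarrow> (cfun \<Rightarrow> cfun \<Rightarrow> complex) \<Rightarrow> (cfun \<times> cfun) set" where
  "form_operator U V q =
     {(u, f). u \<in> V \<and> f \<in> L2 U \<and> (\<forall>v\<in>V. q u v = L2_inner U f v)}"

text \<open>The value of the potential at the origin is irrelevant: test functions on a punctured domain
  vanish near it.\<close>

definition AB_A1 :: "plane \<Rightarrow> real" where
  "AB_A1 = (\<lambda>(x, y). 1/2 * (- y / (x\<^sup>2 + y\<^sup>2)))"

definition AB_A2 :: "plane \<Rightarrow> real" where
  "AB_A2 = (\<lambda>(x, y). 1/2 * (x / (x\<^sup>2 + y\<^sup>2)))"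

definition mag_D :: "plane \<Rightarrow> (plane \<Rightarrow> real) \<Rightarrow> cfun \<Rightarrow> cfun" where
  "mag_D e A u = (\<lambda>z. - \<i> * dirderiv e u z - of_real (A z) * u z)"

definition AB_expression :: "cfun \<Rightarrow> cfun" where
  "AB_expression u = (\<lambda>z.
     mag_D (1, 0) AB_A1 (mag_D (1, 0) AB_A1 u) z + mag_D (0, 1) AB_A2 (mag_D (0, 1) AB_A2 u) z)"

definition AB_Dirichlet :: "plane set \<Rightarrow> (cfun \<times> cfun) set" where
  "AB_Dirichlet U = friedrichs_extension U (test_functions U) AB_expression"

definition has_weak_deriv :: "plane set \<Rightarrow> plane \<Rightarrow> cfun \<Rightarrow> cfun \<Rightarrow> bool" where
  "has_weak_deriv U e w g \<longleftrightarrow> g \<in> L2 U \<and>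
     (\<forall>\<phi>\<in>test_functions U.
        (LINT z:U|lborel. w z * dirderiv e \<phi> z) = - (LINT z:U|lborel. g z * \<phi> z))"

definition weak_deriv :: "plane set \<Rightarrow> plane \<Rightarrow> cfun \<Rightarrow> cfun" where
  "weak_deriv U e w = (SOME g. has_weak_deriv U e w g)"

definition H1 :: "plane set \<Rightarrow> cfun set" where
  "H1 U = {w \<in> L2 U. \<forall>e\<in>Basis. \<exists>g. has_weak_deriv U e w g}"

text \<open>Functions in \<open>H\<^sup>1(U)\<close>, \<open>U\<close> bounded, vanishing on the boundary outside \<open>N\<close>. As for
  \<open>H\<^sup>1\<^sub>0\<close>, vanishing is understood as membership in the \<open>H\<^sup>1\<close>-closure of the
  functions smooth up to the boundary that vanish there pointwise.\<close>

definition H1_vanishing_outside :: "plane set \<Rightarrow> plane set \<Rightarrow> cfun set" where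
  "H1_vanishing_outside U N =
     {w \<in> H1 U. \<exists>\<phi> :: nat \<Rightarrow> cfun.
        (\<forall>n. smooth (\<phi> n) \<and> (\<forall>z\<in>frontier U - N. \<phi> n z = 0)) \<and>
        (\<lambda>n. L2_norm U (\<lambda>z. \<phi> n z - w z)) \<longlonglongrightarrow> 0 \<and>
        (\<forall>e\<in>Basis. (\<lambda>n. L2_norm U (\<lambda>z. dirderiv e (\<phi> n) z - weak_deriv U e w z)) \<longlonglongrightarrow> 0)}"

definition gradient_form :: "plane set \<Rightarrow> cfun \<Rightarrow> cfun \<Rightarrow> complex" where
  "gradient_form U w v = (\<Sum>e\<in>Basis. L2_inner U (weak_deriv U e w) (weak_deriv U e v))"

definition DN_Laplacian :: "plane set \<Rightarrow> plane set \<Rightarrow> (cfun \<times> cfun) set" where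
  "DN_Laplacian U N = form_operator U (H1_vanishing_outside U N) (gradient_form U)"

end

theory Submission
  imports Defs
begin

text \<open>On the plane slit along a half axis the gauge factor \<open>q = exp (\<i>\<theta>/2)\<close> satisfies
  \<open>\<partial>\<^sub>j q = \<i> A\<^sub>j q\<close>, hence \<open>D\<^sub>j (q v) = - \<i> q \<partial>\<^sub>j v\<close>, and \<open>v\<close> changes sign across the slit.
  Reflection in the axis splits such \<open>v\<close> into even ones, which vanish on the slit and satisfy the Neumann
  condition on the opposite half axis, and odd ones, for which the roles are exchanged. Thus the even part of
  \<open>q\<^sup>-\<^sup>1 u\<close> solves the Dirichlet-Neumann problem. If it vanishes, it is replaced by the even part belonging to
  \<open>exp (\<i>\<theta>) u(-x, y)\<close>, since \<open>u \<mapsto> exp (\<i>\<theta>) u(-x, y)\<close> is a symmetry of the Aharonov-Bohm operator.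

  Both operators are described by the closure in \<open>L\<^sup>2\<close> of the graph of \<open>\<phi> \<mapsto> (d\<^sub>1 \<phi>, d\<^sub>2 \<phi>)\<close> on a core of smooth
  functions, and the weak eigenvalue equation is transported by pairs of adjoint maps that respect these
  closures. The analytic step is to approximate the even extension of a smooth \<open>\<phi>\<close> vanishing on the
  Dirichlet part by test functions of the punctured domain: \<open>\<phi>\<close> is truncated near its zero set and then
  composed with \<open>(x, y) \<mapsto> (x, sqrt (y\<^sup>2 + \<eta>\<^sup>2))\<close>, a smooth substitute for \<open>(x, \<bar>y\<bar>)\<close>.\<close>


section \<open>Smooth functions\<close>

text \<open>The transport works on cores and needs two facts: the extension of a core function of
  the mixed problem lies in the closure of the test functions, and the symmetrization of a test
  function lies in the closure of the mixed core. Both meet a lack of smoothness. Functions of the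
  mixed core are smooth on the whole plane, while \<open>half_phase\<close> jumps across the
  negative half axis, which bounds the upper half; there another branch of the same square root is
  used, with its cut on the negative y-axis, where a cutoff removes it. For the extension,
  \<open>upfold\<close> has a crease, and a core function vanishes on the Dirichlet part only
  pointwise, whereas a test function must vanish near it. Smoothing the crease alone would move the
  zeros off the boundary and off the slit. Truncation provides a margin beforehand: for fixed n the
  truncated and lifted function vanishes within a positive distance of the Dirichlet part, uniformly
  for small \<eta>. Hence \<eta> tends to 0 for fixed n before n tends to infinity. The origin
  belongs to the Dirichlet part, since the Neumann segment is open there, so the same margin takes
  care of the puncture.\<close>

fun Ck_on :: "nat \<Rightarrow> 'a::real_normed_vector set \<Rightarrow> ('a \<Rightarrow> 'b::real_normed_vector) \<Rightarrow> bool" where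
  "Ck_on 0 S f \<longleftrightarrow> continuous_on S f"
| "Ck_on (Suc k) S f \<longleftrightarrow> (\<forall>x\<in>S. f differentiable at x) \<and>
     (\<forall>v. Ck_on k S (\<lambda>x. frechet_derivative f (at x) v))"

text \<open>The phase factors are smooth only off a slit or off the origin, hence a local notion.
  The derivatives are taken with full neighbourhoods, so it is used on open sets; globally smooth
  functions are obtained by gluing over an open cover of the plane.\<close>

definition smooth_on :: "'a::real_normed_vector set \<Rightarrow> ('a \<Rightarrow> 'b::real_normed_vector) \<Rightarrow> bool" where
  "smooth_on S f \<longleftrightarrow> (\<forall>k. Ck_on k S f)"

lemma Ck_on_UNIV: "Ck_on k UNIV f = Ck k f"
  by (induction k arbitrary: f) auto

lemma smooth_on_UNIV: "smooth_on UNIV f = smooth f"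
  by (simp add: smooth_on_def smooth_def Ck_on_UNIV)

lemma Ck_on_cong:
  assumes "open S" "\<And>x. x \<in> S \<Longrightarrow> f x = g x" "Ck_on k S f"
  shows "Ck_on k S g"
  using assms(2,3)
proof (induction k arbitrary: f g)
  case 0
  then show ?case by (auto cong: continuous_on_cong)
next
  case (Suc k)
  have d: "g differentiable at x" if "x \<in> S" for x
    using Suc.prems that assms(1) has_derivative_transform_within_open[of f _ x UNIV S g]
    by (fastforce simp: differentiable_def)
  have "Ck_on k S (\<lambda>x. frechet_derivative g (at x) v)" for v
  proof (rule Suc.IH)
    show "Ck_on k S (\<lambda>x. frechet_derivative f (at x) v)" using Suc.prems by auto
    show "frechet_derivative f (at x) v = frechet_derivative g (at x) v" if "x \<in> S" for x
      using frechet_derivative_transform_within_open[of f x S g] Suc.prems that assms(1) by auto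
  qed
  with d show ?case by auto
qed

text \<open>The recursion refers to the derivative selected by \<open>frechet_derivative\<close>;
  uniqueness of derivatives allows any explicit formula in its place.\<close>

lemma Ck_on_SucI:
  assumes "open S" "\<And>x. x \<in> S \<Longrightarrow> (f has_derivative f' x) (at x)"
    and "\<And>v. Ck_on k S (\<lambda>x. f' x v)"
  shows "Ck_on (Suc k) S f"
proof -
  have "Ck_on k S (\<lambda>x. frechet_derivative f (at x) v)" for v
    by (rule Ck_on_cong[OF assms(1) _ assms(3)[of v]])
       (metis assms(2) frechet_derivative_at)
  then show ?thesis using assms(2) by (auto simp: differentiable_def)
qed

lemma Ck_on_SucD: "Ck_on (Suc k) S f \<Longrightarrow> Ck_on k S f"
proof (induction k arbitrary: f)
  case 0
  then show ?case
    by (auto intro!: continuous_at_imp_continuous_on differentiable_imp_continuous_within)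
next
  case (Suc k)
  then show ?case by (metis Ck_on.simps(2))
qed

lemma Ck_on_subset: "Ck_on k S f \<Longrightarrow> T \<subseteq> S \<Longrightarrow> Ck_on k T f"
  by (induction k arbitrary: f) (auto intro: continuous_on_subset)

lemma Ck_on_Un:
  assumes "open S" "open T"
  shows "Ck_on k S f \<Longrightarrow> Ck_on k T f \<Longrightarrow> Ck_on k (S \<union> T) f"
  by (induction k arbitrary: f) (auto intro: continuous_on_open_Un assms)

lemma Ck_on_const: "Ck_on k S (\<lambda>x. c)"
  by (induction k arbitrary: c) auto

lemma Ck_on_bounded_linear:
  assumes "open S" "bounded_linear L"
  shows "Ck_on k S L"
proof (cases k)
  case 0
  then show ?thesis by (simp add: assms linear_continuous_on)
next
  case (Suc n)
  show ?thesis unfolding Suc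
    by (rule Ck_on_SucI[where f'="\<lambda>_. L"])
       (auto simp: assms Ck_on_const bounded_linear_imp_has_derivative)
qed

lemma Ck_on_add:
  assumes "open S"
  shows "Ck_on k S f \<Longrightarrow> Ck_on k S g \<Longrightarrow> Ck_on k S (\<lambda>x. f x + g x)"
proof (induction k arbitrary: f g)
  case 0 then show ?case by (auto intro: continuous_on_add)
next
  case (Suc k)
  show ?case
    by (rule Ck_on_SucI[OF assms, where
          f'="\<lambda>x v. frechet_derivative f (at x) v + frechet_derivative g (at x) v"])
       (use Suc in \<open>auto intro!: has_derivative_add simp: frechet_derivative_works\<close>)
qed

lemma Ck_on_bilinear:
  assumes p: "bounded_bilinear p" and o: "open S"
  shows "Ck_on k S f \<Longrightarrow> Ck_on k S g \<Longrightarrow> Ck_on k S (\<lambda>x. p (f x) (g x))"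
proof (induction k arbitrary: f g)
  case 0 then show ?case by (auto intro: bounded_bilinear.continuous_on[OF p])
next
  case (Suc k)
  show ?case
  proof (rule Ck_on_SucI[OF o, where
        f'="\<lambda>x v. p (f x) (frechet_derivative g (at x) v) + p (frechet_derivative f (at x) v) (g x)"])
    show "((\<lambda>x. p (f x) (g x)) has_derivative
            (\<lambda>v. p (f x) (frechet_derivative g (at x) v) + p (frechet_derivative f (at x) v) (g x))) (at x)"
      if "x \<in> S" for x
      using Suc.prems that by (auto intro!: bounded_bilinear.FDERIV[OF p] simp: frechet_derivative_works)
    show "Ck_on k S (\<lambda>x. p (f x) (frechet_derivative g (at x) v) + p (frechet_derivative f (at x) v) (g x))" for v
      using Suc.prems by (intro Ck_on_add o Suc.IH) (auto intro: Ck_on_SucD)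
  qed
qed

lemma Ck_on_sum:
  assumes "open S" "\<And>i. i \<in> I \<Longrightarrow> Ck_on k S (f i)"
  shows "Ck_on k S (\<lambda>x. \<Sum>i\<in>I. f i x)"
  using assms(2)
  by (induction I rule: infinite_finite_induct) (auto intro!: Ck_on_add Ck_on_const assms(1))

lemma Ck_on_compose:
  fixes f :: "'b::euclidean_space \<Rightarrow> 'c::real_normed_vector" and g :: "'a::real_normed_vector \<Rightarrow> 'b"
  assumes "open S" "open T" "g ` S \<subseteq> T"
  shows "Ck_on k T f \<Longrightarrow> Ck_on k S g \<Longrightarrow> Ck_on k S (\<lambda>x. f (g x))"
proof (induction k arbitrary: f)
  case 0 then show ?case using assms by (auto intro: continuous_on_compose2)
next
  case (Suc k)
  \<comment> \<open>The direction \<open>frechet_derivative g (at x) v\<close> varies with x, while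
    the induction hypothesis speaks of fixed directions. Expanding it in the basis leaves only the
    fixed directions b.\<close>
  let ?D = "\<lambda>x v. \<Sum>b\<in>Basis. (frechet_derivative g (at x) v \<bullet> b) *\<^sub>R frechet_derivative f (at (g x)) b"
  show ?case
  proof (rule Ck_on_SucI[OF assms(1), where f'="?D"])
    fix x assume x: "x \<in> S"
    have g: "(g has_derivative frechet_derivative g (at x)) (at x)"
      using Suc.prems x by (auto simp: frechet_derivative_works)
    have f: "(f has_derivative frechet_derivative f (at (g x))) (at (g x))"
      using Suc.prems x assms by (auto simp: frechet_derivative_works)
    interpret f': bounded_linear "frechet_derivative f (at (g x))"
      using f by (rule has_derivative_bounded_linear)
    have "((\<lambda>x. f (g x)) has_derivative (\<lambda>v. frechet_derivative f (at (g x)) (frechet_derivative g (at x) v))) (at x)"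
      using has_derivative_compose[OF g f] .
    also have "(\<lambda>v. frechet_derivative f (at (g x)) (frechet_derivative g (at x) v)) = ?D x"
    proof
      fix v
      have "frechet_derivative f (at (g x)) (frechet_derivative g (at x) v) =
         frechet_derivative f (at (g x)) (\<Sum>b\<in>Basis. (frechet_derivative g (at x) v \<bullet> b) *\<^sub>R b)"
        by (simp add: euclidean_representation)
      also have "\<dots> = ?D x v" by (simp only: f'.sum f'.scaleR)
      finally show "frechet_derivative f (at (g x)) (frechet_derivative g (at x) v) = ?D x v" .
    qed
    finally show "((\<lambda>x. f (g x)) has_derivative ?D x) (at x)" .
  next
    fix v
    have g: "Ck_on k S g" using Suc.prems(2) by (rule Ck_on_SucD)
    have "Ck_on k S (\<lambda>x. frechet_derivative g (at x) v)" using Suc.prems by auto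
    then have 1: "Ck_on k S (\<lambda>x. frechet_derivative g (at x) v \<bullet> b)" for b
      by (intro Ck_on_bilinear[OF bounded_bilinear_inner assms(1)] Ck_on_const)
    have 2: "Ck_on k S (\<lambda>x. frechet_derivative f (at (g x)) b)" for b
      using Suc.IH[of "\<lambda>y. frechet_derivative f (at y) b"] Suc.prems(1) g by auto
    show "Ck_on k S (\<lambda>x. ?D x v)"
      by (intro Ck_on_sum assms(1) Ck_on_bilinear[OF bounded_bilinear_scaleR assms(1)] 1 2)
  qed
qed

lemma smooth_on_cong:
  "open S \<Longrightarrow> smooth_on S f \<Longrightarrow> (\<And>x. x \<in> S \<Longrightarrow> f x = g x) \<Longrightarrow> smooth_on S g"
  unfolding smooth_on_def using Ck_on_cong by blast

lemma smooth_on_differentiable: "smooth_on S f \<Longrightarrow> x \<in> S \<Longrightarrow> f differentiable at x"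
  unfolding smooth_on_def by (metis Ck_on.simps(2))

lemma smooth_on_dirderiv: "smooth_on S f \<Longrightarrow> smooth_on S (dirderiv v f)"
  unfolding smooth_on_def by (metis Ck_on.simps(2))

lemma smooth_on_subset: "smooth_on S f \<Longrightarrow> T \<subseteq> S \<Longrightarrow> smooth_on T f"
  unfolding smooth_on_def using Ck_on_subset by blast

lemma smooth_on_Un: "open S \<Longrightarrow> open T \<Longrightarrow> smooth_on S f \<Longrightarrow> smooth_on T f \<Longrightarrow> smooth_on (S \<union> T) f"
  unfolding smooth_on_def using Ck_on_Un by blast

lemma smooth_on_const: "smooth_on S (\<lambda>x. c)"
  unfolding smooth_on_def using Ck_on_const by blast

lemma smooth_on_bounded_linear: "open S \<Longrightarrow> bounded_linear L \<Longrightarrow> smooth_on S L"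
  unfolding smooth_on_def using Ck_on_bounded_linear by blast

lemma smooth_on_add: "open S \<Longrightarrow> smooth_on S f \<Longrightarrow> smooth_on S g \<Longrightarrow> smooth_on S (\<lambda>x. f x + g x)"
  unfolding smooth_on_def using Ck_on_add by blast

lemma smooth_on_bilinear:
  "bounded_bilinear p \<Longrightarrow> open S \<Longrightarrow> smooth_on S f \<Longrightarrow> smooth_on S g \<Longrightarrow> smooth_on S (\<lambda>x. p (f x) (g x))"
  unfolding smooth_on_def using Ck_on_bilinear by blast

lemmas smooth_on_mult = smooth_on_bilinear[OF bounded_bilinear_mult]
lemmas smooth_on_scaleR = smooth_on_bilinear[OF bounded_bilinear_scaleR]

lemma smooth_on_compose:
  fixes f :: "'b::euclidean_space \<Rightarrow> 'c::real_normed_vector"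
  shows "open S \<Longrightarrow> open T \<Longrightarrow> g ` S \<subseteq> T \<Longrightarrow> smooth_on T f \<Longrightarrow> smooth_on S g \<Longrightarrow> smooth_on S (\<lambda>x. f (g x))"
  unfolding smooth_on_def using Ck_on_compose by blast

lemma smooth_on_linear_compose:
  fixes L :: "'b::euclidean_space \<Rightarrow> 'c::real_normed_vector"
  shows "open S \<Longrightarrow> bounded_linear L \<Longrightarrow> smooth_on S g \<Longrightarrow> smooth_on S (\<lambda>x. L (g x))"
  by (rule smooth_on_compose[where T=UNIV]) (auto intro: smooth_on_bounded_linear)

lemma smooth_on_minus:
  fixes f :: "'a::real_normed_vector \<Rightarrow> 'b::euclidean_space"
  shows "open S \<Longrightarrow> smooth_on S f \<Longrightarrow> smooth_on S (\<lambda>x. - f x)"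
  by (rule smooth_on_linear_compose[OF _ bounded_linear_minus[OF bounded_linear_ident]])

lemma smooth_on_diff:
  fixes f :: "'a::real_normed_vector \<Rightarrow> 'b::euclidean_space"
  shows "open S \<Longrightarrow> smooth_on S f \<Longrightarrow> smooth_on S g \<Longrightarrow> smooth_on S (\<lambda>x. f x - g x)"
  using smooth_on_add[OF _ _ smooth_on_minus[of S g], of f] by simp

section \<open>Smoothness of the reciprocal and of the square root\<close>

lemma Ck_on_real_SucI:
  fixes f :: "real \<Rightarrow> real"
  assumes "open S" "\<And>x. x \<in> S \<Longrightarrow> (f has_real_derivative f' x) (at x)" "Ck_on k S f'"
  shows "Ck_on (Suc k) S f"
proof (rule Ck_on_SucI[OF assms(1), where f'="\<lambda>x v. f' x * v"])
  show "Ck_on k S (\<lambda>x. f' x * v)" for v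
    by (intro Ck_on_bilinear[OF bounded_bilinear_mult] assms Ck_on_const)
qed (use assms(2) in \<open>auto simp: has_field_derivative_def\<close>)

lemma smooth_on_inverse_real: "smooth_on {x::real. x \<noteq> 0} inverse"
proof -
  have o: "open {x::real. x \<noteq> 0}" by (simp add: open_Collect_neq)
  have "Ck_on k {x::real. x \<noteq> 0} inverse" for k
  proof (induction k)
    case (Suc k)
    show ?case
    proof (rule Ck_on_real_SucI[OF o, where f'="\<lambda>x. - 1 * (inverse x * inverse x)"])
      show "Ck_on k {x. x \<noteq> (0::real)} (\<lambda>x. - 1 * (inverse x * inverse x))"
        by (intro Ck_on_bilinear[OF bounded_bilinear_mult o] Suc.IH Ck_on_const)
    qed (auto intro!: derivative_eq_intros simp: power2_eq_square)
  qed (auto intro!: continuous_intros)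
  then show ?thesis by (simp add: smooth_on_def)
qed

lemma smooth_on_inverse:
  fixes f :: "'a::real_normed_vector \<Rightarrow> real"
  assumes "open S" "smooth_on S f" "\<And>x. x \<in> S \<Longrightarrow> f x \<noteq> 0"
  shows "smooth_on S (\<lambda>x. inverse (f x))"
  by (rule smooth_on_compose[OF assms(1) _ _ smooth_on_inverse_real assms(2)])
     (use assms(3) in \<open>auto intro: open_Collect_neq continuous_intros\<close>)

lemma smooth_on_sqrt_real: "smooth_on {0<..} sqrt"
proof -
  have "Ck_on k {0<..} sqrt" for k
  proof (induction k)
    case (Suc k)
    show ?case
    proof (rule Ck_on_real_SucI[where f'="\<lambda>x. inverse (sqrt x) * (1/2)"])
      have "Ck_on k {0<..} (\<lambda>x. inverse (sqrt x))"
        by (rule Ck_on_compose[where T="{x. x \<noteq> 0}", OF _ _ _ _ Suc.IH])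
           (use smooth_on_inverse_real in \<open>auto simp: smooth_on_def open_Collect_neq\<close>)
      then show "Ck_on k {0<..} (\<lambda>x. inverse (sqrt x) * (1/2))"
        by (intro Ck_on_bilinear[OF bounded_bilinear_mult] Ck_on_const) auto
    qed (auto intro!: derivative_eq_intros)
  qed (auto intro!: continuous_intros)
  then show ?thesis by (simp add: smooth_on_def)
qed

lemma smooth_on_sqrt:
  fixes f :: "'a::real_normed_vector \<Rightarrow> real"
  assumes "open S" "smooth_on S f" "\<And>x. x \<in> S \<Longrightarrow> f x > 0"
  shows "smooth_on S (\<lambda>x. sqrt (f x))"
  using smooth_on_compose[OF assms(1) _ _ smooth_on_sqrt_real assms(2)] assms(3) by auto

section \<open>A smooth step function built from flat functions\<close>

definition flat :: "nat \<Rightarrow> real \<Rightarrow> real" where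
  "flat n x = (if x > 0 then inverse x ^ n * exp (- inverse x) else 0)"

lemma flat_tendsto_0: "(flat n \<longlongrightarrow> 0) (at 0)"
proof -
  have "((\<lambda>x. inverse x ^ n / exp (inverse x)) \<longlongrightarrow> 0) (at_right (0::real))"
    by (rule filterlim_compose[OF tendsto_power_div_exp_0 filterlim_inverse_at_top_right])
  then have r: "(flat n \<longlongrightarrow> 0) (at_right 0)"
    by (rule Lim_transform_eventually)
       (auto simp: eventually_at_filter flat_def exp_minus field_simps)
  have l: "(flat n \<longlongrightarrow> 0) (at_left 0)"
    by (rule Lim_transform_eventually[OF tendsto_const])
       (auto simp: eventually_at_filter flat_def)
  show ?thesis using l r by (simp add: filterlim_split_at)
qed

text \<open>The power of 1/x is kept as an index because the family is then closed under
  differentiation, and smoothness of all members follows by one induction on the order.\<close>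

lemma flat_has_derivative:
  "(flat n has_real_derivative (- real n * flat (Suc n) x + flat (Suc (Suc n)) x)) (at x)"
proof -
  consider "x > 0" | "x < 0" | "x = 0" by linarith
  then show ?thesis
  proof cases
    case 1
    have i: "(inverse has_real_derivative - (inverse x * inverse x)) (at x)"
      using 1 DERIV_inverse[of x] by (simp add: power2_eq_square)
    have p: "((\<lambda>x. inverse x ^ n) has_real_derivative - real n * inverse x ^ Suc n) (at x)"
      using DERIV_power[OF i, of n] by (cases n) (simp_all del: inverse_eq_divide add: algebra_simps)
    have e: "((\<lambda>x. exp (- inverse x)) has_real_derivative exp (- inverse x) * (inverse x * inverse x)) (at x)"
      using DERIV_fun_exp[OF DERIV_minus[OF i]] by simp
    have "((\<lambda>x. inverse x ^ n * exp (- inverse x)) has_real_derivative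
        (- real n * flat (Suc n) x + flat (Suc (Suc n)) x)) (at x)"
      using DERIV_mult[OF p e] 1 by (simp add: flat_def ac_simps del: inverse_eq_divide)
    then show ?thesis
      by (rule DERIV_cong_ev[THEN iffD1, rotated 3])
         (use 1 in \<open>auto simp: flat_def eventually_nhds intro!: exI[of _ "{0<..}"]\<close>)
  next
    case 2
    have "((\<lambda>x. 0) has_real_derivative (- real n * flat (Suc n) x + flat (Suc (Suc n)) x)) (at x)"
      using 2 by (auto simp: flat_def)
    then show ?thesis
      by (rule DERIV_cong_ev[THEN iffD1, rotated 3])
         (use 2 in \<open>auto simp: flat_def eventually_nhds intro!: exI[of _ "{..<0}"]\<close>)
  next
    case 3
    \<comment> \<open>At 0 the difference quotient of one member is the next member, which tends to
      0.\<close>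
    have "(\<lambda>h. (flat n (0 + h) - flat n 0) / h) = flat (Suc n)"
      by (auto simp: flat_def fun_eq_iff field_simps)
    then show ?thesis using flat_tendsto_0[of "Suc n"] 3 by (simp add: DERIV_def) (simp add: flat_def)
  qed
qed

lemma smooth_flat: "smooth (flat n)"
proof -
  have "Ck_on k UNIV (flat n)" for k
  proof (induction k arbitrary: n)
    case 0
    show ?case unfolding Ck_on.simps
      by (rule continuous_at_imp_continuous_on) (use DERIV_isCont[OF flat_has_derivative] in blast)
  next
    case (Suc k)
    show ?case
      by (rule Ck_on_real_SucI[OF _ flat_has_derivative])
         (intro Ck_on_add Ck_on_bilinear[OF bounded_bilinear_mult] Ck_on_const Suc.IH open_UNIV)+
  qed
  then show ?thesis by (simp add: smooth_def Ck_on_UNIV)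
qed

text \<open>The transition takes place between 1 and 2, so that \<open>step\<close> vanishes on a
  whole neighbourhood of 0. This is what makes a truncated function vanish near the zeros of the
  original one.\<close>

definition step :: "real \<Rightarrow> real" where
  "step s = flat 0 (s - 1) * inverse (flat 0 (s - 1) + flat 0 (2 - s))"

lemma step_denom_pos: "flat 0 (s - 1) + flat 0 (2 - s) > 0"
  by (cases "s > 1") (auto simp: flat_def intro: add_pos_nonneg)

lemma step_le: "s \<le> 1 \<Longrightarrow> step s = 0" and step_ge: "s \<ge> 2 \<Longrightarrow> step s = 1"
  by (auto simp: step_def flat_def)

lemma step_nonneg: "0 \<le> step s" and step_le_1: "step s \<le> 1"
proof -
  show "0 \<le> step s" using step_denom_pos[of s] by (auto simp: step_def flat_def)
  have "0 \<le> flat 0 (2 - s)" by (simp add: flat_def)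
  then show "step s \<le> 1" using step_denom_pos[of s]
    by (simp add: step_def divide_inverse[symmetric] del: inverse_eq_divide)
qed

lemma smooth_step: "smooth step"
proof -
  have "smooth_on UNIV (flat 0)" by (simp add: smooth_on_UNIV smooth_flat)
  then have f: "smooth_on UNIV (\<lambda>x::real. flat 0 (L x))" if "smooth_on UNIV L" for L
    using smooth_on_compose[OF _ _ _ _ that, of UNIV "flat 0"] by auto
  have i: "smooth_on UNIV (\<lambda>x::real. x)" by (simp add: smooth_on_bounded_linear)
  note a = f[OF smooth_on_diff[OF open_UNIV i smooth_on_const[where c=1]]]
  note b = f[OF smooth_on_diff[OF open_UNIV smooth_on_const[where c=2] i]]
  have "smooth_on UNIV step" unfolding step_def[abs_def]
    by (intro smooth_on_mult smooth_on_inverse smooth_on_add a b open_UNIV)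
       (use step_denom_pos less_irrefl in metis)
  then show ?thesis by (simp add: smooth_on_UNIV)
qed

section \<open>Square integrable functions\<close>

abbreviation lborel_on :: "plane set \<Rightarrow> plane measure" where
  "lborel_on U \<equiv> restrict_space lborel U"

lemma borel_measurable_cnj [measurable (raw)]:
  assumes "f \<in> borel_measurable M"
  shows "(\<lambda>z. cnj (f z)) \<in> borel_measurable M"
  using borel_measurable_continuous_on[OF _ assms, of cnj] by (simp add: continuous_intros)

lemma L2_iff:
  assumes "U \<in> sets borel"
  shows "f \<in> L2 U \<longleftrightarrow> f \<in> borel_measurable (lborel_on U) \<and> integrable (lborel_on U) (\<lambda>z. (cmod (f z))\<^sup>2)"
  using assms
  by (simp add: L2_def set_borel_measurable_def set_integrable_def borel_measurable_restrict_space_iff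
      integrable_restrict_space)

lemma L2_inner_eq:
  assumes "U \<in> sets borel"
  shows "L2_inner U f g = (\<integral>z. f z * cnj (g z) \<partial>lborel_on U)"
  using assms by (simp add: L2_inner_def set_lebesgue_integral_def integral_restrict_space)

lemma L2_norm_eq:
  assumes "U \<in> sets borel"
  shows "L2_norm U f = sqrt (\<integral>z. (cmod (f z))\<^sup>2 \<partial>lborel_on U)"
  using assms by (simp add: L2_norm_def set_lebesgue_integral_def integral_restrict_space)

lemma space_lborel_on [simp]: "space (lborel_on U) = U"
  by (simp add: space_restrict_space)

lemma AE_lborel_on:
  "U \<in> sets borel \<Longrightarrow> (AE z in lborel_on U. P z) \<longleftrightarrow> (AE z in lborel. z \<in> U \<longrightarrow> P z)"
  by (simp add: AE_restrict_space_iff)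

lemma L2_integrable_mult:
  assumes U: "U \<in> sets borel" and f: "f \<in> L2 U" and g: "g \<in> L2 U"
  shows "integrable (lborel_on U) (\<lambda>z. f z * cnj (g z))"
proof (rule Bochner_Integration.integrable_bound[where f="\<lambda>z. (cmod (f z))\<^sup>2 + (cmod (g z))\<^sup>2"])
  show "integrable (lborel_on U) (\<lambda>z. (cmod (f z))\<^sup>2 + (cmod (g z))\<^sup>2)"
    using f g by (simp add: L2_iff[OF U])
  have [measurable]: "f \<in> borel_measurable (lborel_on U)" "g \<in> borel_measurable (lborel_on U)"
    using f g by (auto simp: L2_iff[OF U])
  show "(\<lambda>z. f z * cnj (g z)) \<in> borel_measurable (lborel_on U)" by measurable
  have "2 * (a * b) \<le> a\<^sup>2 + b\<^sup>2" for a b :: real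
    using sum_squares_bound[of a b] by simp
  then have "a * b \<le> a\<^sup>2 + b\<^sup>2" if "a \<ge> 0" "b \<ge> 0" for a b :: real
    using that by (smt (verit) mult_nonneg_nonneg)
  then show "AE z in lborel_on U. cmod (f z * cnj (g z)) \<le> norm ((cmod (f z))\<^sup>2 + (cmod (g z))\<^sup>2)"
    by (intro AE_I2) (simp add: norm_mult)
qed

lemma L2_cmult:
  assumes U: "U \<in> sets borel" and f: "f \<in> L2 U"
  shows "(\<lambda>z. c * f z) \<in> L2 U"
  using f by (auto simp: L2_iff[OF U] norm_mult power_mult_distrib)

lemma L2_add:
  assumes U: "U \<in> sets borel" and f: "f \<in> L2 U" and g: "g \<in> L2 U"
  shows "(\<lambda>z. f z + g z) \<in> L2 U"
proof -
  have [measurable]: "f \<in> borel_measurable (lborel_on U)" "g \<in> borel_measurable (lborel_on U)"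
    using f g by (auto simp: L2_iff[OF U])
  have "integrable (lborel_on U) (\<lambda>z. (cmod (f z + g z))\<^sup>2)"
  proof (rule Bochner_Integration.integrable_bound[where f="\<lambda>z. 2 * (cmod (f z))\<^sup>2 + 2 * (cmod (g z))\<^sup>2"])
    show "integrable (lborel_on U) (\<lambda>z. 2 * (cmod (f z))\<^sup>2 + 2 * (cmod (g z))\<^sup>2)"
      using f g by (simp add: L2_iff[OF U])
    have "(cmod (a + b))\<^sup>2 \<le> 2 * (cmod a)\<^sup>2 + 2 * (cmod b)\<^sup>2" for a b
    proof -
      have "(cmod (a + b))\<^sup>2 \<le> (cmod a + cmod b)\<^sup>2" by (intro power_mono norm_triangle_ineq) auto
      also have "\<dots> \<le> 2 * (cmod a)\<^sup>2 + 2 * (cmod b)\<^sup>2"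
        using sum_squares_bound[of "cmod a" "cmod b"] by (simp add: power2_sum)
      finally show ?thesis .
    qed
    then show "AE z in lborel_on U. norm ((cmod (f z + g z))\<^sup>2) \<le> norm (2 * (cmod (f z))\<^sup>2 + 2 * (cmod (g z))\<^sup>2)"
      by (intro AE_I2) simp
  qed measurable
  then show ?thesis by (simp add: L2_iff[OF U])
qed

lemma L2_diff:
  assumes U: "U \<in> sets borel" and f: "f \<in> L2 U" and g: "g \<in> L2 U"
  shows "(\<lambda>z. f z - g z) \<in> L2 U"
  using L2_add[OF U f L2_cmult[OF U g, of "-1"]] by simp

lemma L2_cnj:
  assumes U: "U \<in> sets borel" and f: "f \<in> L2 U"
  shows "(\<lambda>z. cnj (f z)) \<in> L2 U"
proof -
  have [measurable]: "f \<in> borel_measurable (lborel_on U)" using f by (simp add: L2_iff[OF U])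
  have "(\<lambda>z. cnj (f z)) \<in> borel_measurable (lborel_on U)" by measurable
  then show ?thesis using f by (simp add: L2_iff[OF U])
qed

lemma L2_inner_add_left:
  assumes U: "U \<in> sets borel" and "f \<in> L2 U" "g \<in> L2 U" "h \<in> L2 U"
  shows "L2_inner U (\<lambda>z. f z + g z) h = L2_inner U f h + L2_inner U g h"
  using assms by (simp add: L2_inner_eq L2_integrable_mult algebra_simps)

lemma L2_inner_diff_left:
  assumes U: "U \<in> sets borel" and "f \<in> L2 U" "g \<in> L2 U" "h \<in> L2 U"
  shows "L2_inner U (\<lambda>z. f z - g z) h = L2_inner U f h - L2_inner U g h"
  using assms by (simp add: L2_inner_eq L2_integrable_mult algebra_simps)

lemma L2_inner_cmult_left:
  assumes U: "U \<in> sets borel"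
  shows "L2_inner U (\<lambda>z. c * f z) h = c * L2_inner U f h"
  using assms by (simp add: L2_inner_eq mult.assoc)

lemma L2_inner_commute:
  assumes U: "U \<in> sets borel"
  shows "L2_inner U g f = cnj (L2_inner U f g)"
  unfolding L2_inner_eq[OF U] by (subst Bochner_Integration.integral_cnj[symmetric]) (simp add: mult.commute)

lemma L2_inner_add_right:
  assumes U: "U \<in> sets borel" and "f \<in> L2 U" "g \<in> L2 U" "h \<in> L2 U"
  shows "L2_inner U h (\<lambda>z. f z + g z) = L2_inner U h f + L2_inner U h g"
  using L2_inner_add_left[OF assms] L2_inner_commute[OF U] by (metis complex_cnj_add)

lemma L2_norm_nonneg [simp]: "0 \<le> L2_norm U f"
  by (simp add: L2_norm_def set_lebesgue_integral_def)

lemma L2_norm_minus_commute: "L2_norm U (\<lambda>z. f z - g z) = L2_norm U (\<lambda>z. g z - f z)"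
  by (simp add: L2_norm_def norm_minus_commute)

lemma L2_norm_power2:
  assumes U: "U \<in> sets borel"
  shows "(L2_norm U f)\<^sup>2 = (\<integral>z. (cmod (f z))\<^sup>2 \<partial>lborel_on U)"
  by (simp add: L2_norm_eq[OF U])

lemma L2_inner_self:
  assumes U: "U \<in> sets borel"
  shows "L2_inner U f f = of_real ((L2_norm U f)\<^sup>2)"
  unfolding L2_norm_power2[OF U] L2_inner_eq[OF U] complex_norm_square[symmetric]
  by (simp add: integral_complex_of_real flip: of_real_power)

lemma L2_nn_integral:
  assumes U: "U \<in> sets borel" and f: "f \<in> L2 U"
  shows "(\<integral>\<^sup>+z. ennreal ((cmod (f z))\<^sup>2) \<partial>lborel_on U) = ennreal ((L2_norm U f)\<^sup>2)"
  using f unfolding L2_norm_power2[OF U]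
  by (intro nn_integral_eq_integral) (auto simp: L2_iff[OF U])

text \<open>The absolute values stand inside the integral because the completeness proof uses the
  estimate with g = 1 to bound an L1 norm.\<close>

lemma L2_inner_abs_le:
  assumes U: "U \<in> sets borel" and f: "f \<in> L2 U" and g: "g \<in> L2 U"
  shows "(\<integral>z. cmod (f z) * cmod (g z) \<partial>lborel_on U) \<le> L2_norm U f * L2_norm U g"
proof -
  have [measurable]: "f \<in> borel_measurable (lborel_on U)" "g \<in> borel_measurable (lborel_on U)"
    using f g by (auto simp: L2_iff[OF U])
  have i: "integrable (lborel_on U) (\<lambda>z. cmod (f z) * cmod (g z))"
    using integrable_norm[OF L2_integrable_mult[OF U f g]] by (simp add: norm_mult)
  let ?I = "\<integral>z. cmod (f z) * cmod (g z) \<partial>lborel_on U"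
  have I0: "?I \<ge> 0" by simp
  have "ennreal (?I\<^sup>2) = (ennreal ?I)\<^sup>2" using I0 by (simp add: ennreal_power)
  also have "ennreal ?I = (\<integral>\<^sup>+z. ennreal (cmod (f z) * cmod (g z)) \<partial>lborel_on U)"
    using i by (intro nn_integral_eq_integral[symmetric]) auto
  also have "\<dots> = (\<integral>\<^sup>+z. ennreal (cmod (f z)) * ennreal (cmod (g z)) \<partial>lborel_on U)"
    by (simp add: ennreal_mult)
  also have "\<dots>\<^sup>2 \<le> (\<integral>\<^sup>+z. (ennreal (cmod (f z)))\<^sup>2 \<partial>lborel_on U) * (\<integral>\<^sup>+z. (ennreal (cmod (g z)))\<^sup>2 \<partial>lborel_on U)"
    by (rule Cauchy_Schwarz_nn_integral) measurable
  also have "\<dots> = ennreal ((L2_norm U f)\<^sup>2) * ennreal ((L2_norm U g)\<^sup>2)"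
    by (simp add: ennreal_power L2_nn_integral[OF U] f g)
  also have "\<dots> = ennreal ((L2_norm U f * L2_norm U g)\<^sup>2)"
    by (simp add: ennreal_mult power_mult_distrib)
  finally have "?I\<^sup>2 \<le> (L2_norm U f * L2_norm U g)\<^sup>2" by simp
  then show ?thesis by (rule power2_le_imp_le) simp
qed

lemma L2_Cauchy_Schwarz:
  assumes U: "U \<in> sets borel" and f: "f \<in> L2 U" and g: "g \<in> L2 U"
  shows "cmod (L2_inner U f g) \<le> L2_norm U f * L2_norm U g"
proof -
  have "cmod (L2_inner U f g) \<le> (\<integral>z. cmod (f z * cnj (g z)) \<partial>lborel_on U)"
    unfolding L2_inner_eq[OF U] by (rule integral_norm_bound)
  also have "\<dots> = (\<integral>z. cmod (f z) * cmod (g z) \<partial>lborel_on U)" by (simp add: norm_mult)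
  also have "\<dots> \<le> L2_norm U f * L2_norm U g" by (rule L2_inner_abs_le[OF assms])
  finally show ?thesis .
qed

lemma L2_norm_triangle:
  assumes U: "U \<in> sets borel" and f: "f \<in> L2 U" and g: "g \<in> L2 U"
  shows "L2_norm U (\<lambda>z. f z + g z) \<le> L2_norm U f + L2_norm U g"
proof (rule power2_le_imp_le)
  let ?h = "\<lambda>z. f z + g z"
  have h: "?h \<in> L2 U" by (rule L2_add[OF assms])
  have "(L2_norm U ?h)\<^sup>2 = Re (L2_inner U ?h ?h)" by (simp add: L2_inner_self[OF U])
  also have "L2_inner U ?h ?h = L2_inner U f f + L2_inner U f g + (cnj (L2_inner U f g) + L2_inner U g g)"
    by (simp add: L2_inner_add_left[OF U f g h] L2_inner_add_right[OF U f g f]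
        L2_inner_add_right[OF U f g g] L2_inner_commute[OF U, of g f])
  also have "Re \<dots> = (L2_norm U f)\<^sup>2 + 2 * Re (L2_inner U f g) + (L2_norm U g)\<^sup>2"
    by (simp add: L2_inner_self[OF U])
  also have "\<dots> \<le> (L2_norm U f + L2_norm U g)\<^sup>2"
    using L2_Cauchy_Schwarz[OF assms] complex_Re_le_cmod[of "L2_inner U f g"]
    by (simp add: power2_sum)
  finally show "(L2_norm U ?h)\<^sup>2 \<le> (L2_norm U f + L2_norm U g)\<^sup>2" .
qed simp

lemma L2_norm_triangle_diff:
  assumes U: "U \<in> sets borel" and "f \<in> L2 U" "g \<in> L2 U" "h \<in> L2 U"
  shows "L2_norm U (\<lambda>z. f z - h z) \<le> L2_norm U (\<lambda>z. f z - g z) + L2_norm U (\<lambda>z. g z - h z)"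
  using L2_norm_triangle[OF U L2_diff[OF U assms(2,3)] L2_diff[OF U assms(3,4)]] by simp

lemma L2_norm_mono:
  assumes U: "U \<in> sets borel" and f: "f \<in> L2 U" and g: "g \<in> L2 U"
    and "\<And>z. z \<in> U \<Longrightarrow> cmod (f z) \<le> cmod (g z)"
  shows "L2_norm U f \<le> L2_norm U g"
  unfolding L2_norm_eq[OF U] using f g assms(4)
  by (intro real_sqrt_le_mono integral_mono_AE AE_I2) (auto simp: L2_iff[OF U])

lemma L2_cong: "(\<And>z. z \<in> U \<Longrightarrow> f z = g z) \<Longrightarrow> f \<in> L2 U \<longleftrightarrow> g \<in> L2 U"
proof -
  assume "\<And>z. z \<in> U \<Longrightarrow> f z = g z"
  then have "indicator U z *\<^sub>R f z = indicator U z *\<^sub>R g z"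
    "indicat_real U z *\<^sub>R (cmod (f z))\<^sup>2 = indicator U z *\<^sub>R (cmod (g z))\<^sup>2" for z
    by (cases "z \<in> U"; simp)+
  then show ?thesis unfolding L2_def set_borel_measurable_def set_integrable_def by (simp only: mem_Collect_eq)
qed

lemma L2_inner_cong:
  assumes U: "U \<in> sets borel" and m: "f \<in> L2 U" "f' \<in> L2 U" "g \<in> L2 U" "g' \<in> L2 U"
    and "AE z in lborel. z \<in> U \<longrightarrow> f z = f' z" "AE z in lborel. z \<in> U \<longrightarrow> g z = g' z"
  shows "L2_inner U f g = L2_inner U f' g'"
  unfolding L2_inner_eq[OF U]
proof (rule integral_cong_AE)
  show "AE z in lborel_on U. f z * cnj (g z) = f' z * cnj (g' z)"
    unfolding AE_lborel_on[OF U] using assms(6,7) by eventually_elim auto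
qed (auto intro!: borel_measurable_integrable L2_integrable_mult U m)

lemma L2_norm_cong': "(\<And>z. z \<in> U \<Longrightarrow> f z = f' z) \<Longrightarrow> L2_norm U f = L2_norm U f'"
  unfolding L2_norm_def set_lebesgue_integral_def
  by (intro arg_cong[where f=sqrt] Bochner_Integration.integral_cong) (auto simp: indicator_def)

lemma L2_norm_cong:
  assumes U: "U \<in> sets borel" and m: "f \<in> L2 U" "f' \<in> L2 U"
    and "AE z in lborel. z \<in> U \<longrightarrow> f z = f' z"
  shows "L2_norm U f = L2_norm U f'"
proof -
  have "complex_of_real ((L2_norm U f)\<^sup>2) = of_real ((L2_norm U f')\<^sup>2)"
    using L2_inner_cong[OF U m m assms(4,4)] by (simp add: L2_inner_self[OF U])
  then show ?thesis by (simp only: of_real_eq_iff power2_eq_iff_nonneg L2_norm_nonneg)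
qed

lemma L2_inner_tendsto:
  assumes U: "U \<in> sets borel" and f: "\<And>n. f n \<in> L2 U" "F \<in> L2 U" and g: "g \<in> L2 U"
    and lim: "(\<lambda>n. L2_norm U (\<lambda>z. f n z - F z)) \<longlonglongrightarrow> 0"
  shows "(\<lambda>n. L2_inner U (f n) g) \<longlonglongrightarrow> L2_inner U F g"
proof -
  have "(\<lambda>n. L2_inner U (f n) g - L2_inner U F g) \<longlonglongrightarrow> 0"
  proof (rule Lim_null_comparison)
    show "\<forall>\<^sub>F n in sequentially. norm (L2_inner U (f n) g - L2_inner U F g) \<le>
        L2_norm U (\<lambda>z. f n z - F z) * L2_norm U g"
      using L2_Cauchy_Schwarz[OF U L2_diff[OF U f] g]
      by (intro always_eventually) (simp add: L2_inner_diff_left[OF U f g])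
    show "(\<lambda>n. L2_norm U (\<lambda>z. f n z - F z) * L2_norm U g) \<longlonglongrightarrow> 0"
      using tendsto_mult_right[OF lim, of "L2_norm U g"] by simp
  qed
  then show ?thesis by (rule LIM_zero_cancel)
qed

section \<open>Bounded domains: dominated convergence and completeness\<close>

lemma finite_measure_lborel_on:
  assumes U: "U \<in> sets borel" and "bounded U"
  shows "finite_measure (lborel_on U)"
proof
  have "emeasure lborel U < \<infinity>" using emeasure_bounded_finite[OF assms(2)] by simp
  then show "emeasure (lborel_on U) (space (lborel_on U)) \<noteq> \<infinity>"
    using U by (simp add: emeasure_restrict_space)
qed

lemma bounded_imp_L2:
  assumes U: "U \<in> sets borel" "bounded U" and "f \<in> borel_measurable (lborel_on U)"
    and "\<And>z. z \<in> U \<Longrightarrow> cmod (f z) \<le> B"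
  shows "f \<in> L2 U"
proof -
  interpret finite_measure "lborel_on U" by (rule finite_measure_lborel_on[OF U])
  have "integrable (lborel_on U) (\<lambda>z. (cmod (f z))\<^sup>2)"
    by (rule integrable_const_bound[where B="B\<^sup>2"]) (use assms(3,4) in \<open>auto intro!: AE_I2 power_mono\<close>)
  then show ?thesis using assms by (simp add: L2_iff)
qed

lemma continuous_imp_L2:
  assumes U: "U \<in> sets borel" "bounded U" and f: "continuous_on UNIV f"
  shows "f \<in> L2 U"
proof -
  have "compact (f ` closure U)"
    using U(2) f by (intro compact_continuous_image) (auto intro: continuous_on_subset simp: compact_closure)
  then obtain B where "\<forall>x\<in>f ` closure U. cmod x \<le> B"
    using compact_imp_bounded bounded_iff by metis
  then have "\<And>z. z \<in> U \<Longrightarrow> cmod (f z) \<le> B" using closure_subset by blast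
  moreover have "f \<in> borel_measurable (lborel_on U)"
    by (rule measurable_restrict_space1) (use f borel_measurable_continuous_onI in auto)
  ultimately show ?thesis by (rule bounded_imp_L2[OF U, rotated])
qed

lemma smooth_continuous: "smooth f \<Longrightarrow> continuous_on A f"
  unfolding smooth_def by (metis Ck.simps(1) continuous_on_subset subset_UNIV)

lemma smooth_imp_L2: "U \<in> sets borel \<Longrightarrow> bounded U \<Longrightarrow> smooth f \<Longrightarrow> f \<in> L2 U"
  by (rule continuous_imp_L2) (auto intro: smooth_continuous)

text \<open>On a bounded domain a constant is an integrable majorant, so a uniform bound on the
  \<open>f n\<close> is enough; F inherits the bound almost everywhere.\<close>

lemma L2_dominated_convergence:
  assumes U: "U \<in> sets borel" "bounded U"
    and f: "\<And>n. f n \<in> L2 U" "F \<in> L2 U"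
    and lim: "AE z in lborel. z \<in> U \<longrightarrow> (\<lambda>n. f n z) \<longlonglongrightarrow> F z"
    and bd: "\<And>n z. z \<in> U \<Longrightarrow> cmod (f n z) \<le> B"
  shows "(\<lambda>n. L2_norm U (\<lambda>z. f n z - F z)) \<longlonglongrightarrow> 0"
proof -
  interpret finite_measure "lborel_on U" by (rule finite_measure_lborel_on[OF U])
  have m: "(\<lambda>z. (cmod (f n z - F z))\<^sup>2) \<in> borel_measurable (lborel_on U)" for n
    using L2_diff[OF U(1) f] unfolding L2_iff[OF U(1)] by blast
  have "(\<lambda>n. \<integral>z. (cmod (f n z - F z))\<^sup>2 \<partial>lborel_on U) \<longlonglongrightarrow> (\<integral>z. 0 \<partial>lborel_on U)"
  proof (rule integral_dominated_convergence[where w="\<lambda>_. (2 * B)\<^sup>2"])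
    show "AE z in lborel_on U. (\<lambda>n. (cmod (f n z - F z))\<^sup>2) \<longlonglongrightarrow> 0"
      unfolding AE_lborel_on[OF U(1)] using lim
    proof eventually_elim
      case (elim z)
      show ?case
      proof
        assume "z \<in> U"
        with elim have "(\<lambda>n. f n z - F z) \<longlonglongrightarrow> 0" by (simp add: LIM_zero)
        from tendsto_power[OF tendsto_norm_zero[OF this], of 2]
        show "(\<lambda>n. (cmod (f n z - F z))\<^sup>2) \<longlonglongrightarrow> 0" by simp
      qed
    qed
    show "AE z in lborel_on U. norm ((cmod (f n z - F z))\<^sup>2) \<le> (2 * B)\<^sup>2" for n
      unfolding AE_lborel_on[OF U(1)] using lim
    proof eventually_elim
      case (elim z)
      show ?case
      proof
        assume z: "z \<in> U"
        with elim have "cmod (F z) \<le> B"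
          by (intro tendsto_upperbound[OF tendsto_norm]) (auto simp: bd intro!: always_eventually)
        then have "cmod (f n z - F z) \<le> 2 * B"
          using norm_triangle_ineq4[of "f n z" "F z"] bd[OF z, of n] by linarith
        then show "norm ((cmod (f n z - F z))\<^sup>2) \<le> (2 * B)\<^sup>2" using power_mono[of "cmod (f n z - F z)" "2 * B" 2] by simp
      qed
    qed
  qed (use m in auto)
  then have "(\<lambda>n. sqrt (\<integral>z. (cmod (f n z - F z))\<^sup>2 \<partial>lborel_on U)) \<longlonglongrightarrow> sqrt 0"
    by (intro tendsto_real_sqrt) simp
  then show ?thesis by (simp add: L2_norm_eq[OF U(1)])
qed

lemma L2_imp_integrable:
  assumes U: "U \<in> sets borel" "bounded U" and f: "f \<in> L2 U"
  shows "integrable (lborel_on U) f"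
  using L2_integrable_mult[OF U(1) f continuous_imp_L2[OF U, of "\<lambda>_. 1"]] by simp

text \<open>The Riesz-Fischer argument. It produces the magnetic derivatives of an element of the
  Friedrichs form domain, which is given only by a Cauchy sequence.\<close>

lemma L2_complete:
  assumes U: "U \<in> sets borel" "bounded U" and f: "\<And>n. f n \<in> L2 U"
    and cauchy: "\<And>\<epsilon>. \<epsilon> > 0 \<Longrightarrow> \<exists>N. \<forall>m\<ge>N. \<forall>n\<ge>N. L2_norm U (\<lambda>z. f m z - f n z) < \<epsilon>"
  obtains F where "F \<in> L2 U" "(\<lambda>n. L2_norm U (\<lambda>z. f n z - F z)) \<longlonglongrightarrow> 0"
proof -
  let ?M = "lborel_on U"
  interpret finite_measure ?M by (rule finite_measure_lborel_on[OF U])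
  have [measurable]: "f n \<in> borel_measurable ?M" for n using f by (simp add: L2_iff[OF U(1)])
  have "\<exists>N. \<forall>m\<ge>N. \<forall>n\<ge>N. L2_norm U (\<lambda>z. f m z - f n z) < (1/2)^k" for k
    by (rule cauchy) simp
  then obtain N where N: "\<And>k m n. m \<ge> N k \<Longrightarrow> n \<ge> N k \<Longrightarrow> L2_norm U (\<lambda>z. f m z - f n z) < (1/2)^k"
    by metis
  \<comment> \<open>Summing all \<open>N i\<close> up to k makes r increasing even if N is not, and
    the summand k makes it unbounded.\<close>
  define r where "r k = k + (\<Sum>i\<le>k. N i)" for k
  have rN: "r k \<ge> N k" for k unfolding r_def using member_le_sum[of k "{..k}" N] by simp
  have rmono: "r k \<le> r (Suc k)" for k by (simp add: r_def)
  have rk: "r k \<ge> k" for k by (simp add: r_def)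
  define d where "d k z = f (r (Suc k)) z - f (r k) z" for k z
  have dm[measurable]: "d k \<in> borel_measurable ?M" for k unfolding d_def[abs_def] by measurable
  define C where "C = L2_norm U (\<lambda>_. 1)"
  have one: "(\<lambda>_. 1) \<in> L2 U" by (rule continuous_imp_L2[OF U]) simp
  have dL: "d k \<in> L2 U" for k unfolding d_def by (rule L2_diff[OF U(1) f f])
  \<comment> \<open>On a bounded domain the L1 norm is at most C times the L2 norm, so the
    increments are summable in L1 and the subsequence converges almost everywhere.\<close>
  have dint: "(\<integral>\<^sup>+z. ennreal (cmod (d k z)) \<partial>?M) \<le> ennreal ((1/2)^k * C)" for k
  proof -
    have "(\<integral>\<^sup>+z. ennreal (cmod (d k z)) \<partial>?M) = ennreal (\<integral>z. cmod (d k z) \<partial>?M)"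
      using L2_imp_integrable[OF U dL] by (intro nn_integral_eq_integral) auto
    also have "(\<integral>z. cmod (d k z) \<partial>?M) \<le> L2_norm U (d k) * C"
      using L2_inner_abs_le[OF U(1) dL one] by (simp add: C_def)
    also have "\<dots> \<le> (1/2)^k * C"
      using N[of k "r (Suc k)" "r k"] rN[of k] rmono[of k] unfolding d_def
      by (intro mult_right_mono) (auto simp: C_def)
    finally show ?thesis by (simp add: ennreal_leI)
  qed
  have "(\<integral>\<^sup>+z. (\<Sum>k. ennreal (cmod (d k z))) \<partial>?M) = (\<Sum>k. \<integral>\<^sup>+z. ennreal (cmod (d k z)) \<partial>?M)"
    by (rule nn_integral_suminf) measurable
  also have "\<dots> \<le> (\<Sum>k. ennreal ((1/2)^k * C))"
    by (rule suminf_le) (use dint in auto)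
  also have "\<dots> = ennreal (\<Sum>k. (1/2)^k * C)"
    by (rule suminf_ennreal2) (auto simp: C_def intro!: summable_mult2 summable_geometric)
  also have "\<dots> < \<infinity>" by simp
  finally have "AE z in ?M. (\<Sum>k. ennreal (cmod (d k z))) \<noteq> \<infinity>"
    by (intro nn_integral_PInf_AE) auto
  then have conv: "AE z in ?M. convergent (\<lambda>k. f (r k) z)"
  proof eventually_elim
    case (elim z)
    then have "summable (\<lambda>k. cmod (d k z))"
      by (intro summable_suminf_not_top) auto
    then have "summable (\<lambda>k. d k z)" by (rule summable_norm_cancel)
    then have "convergent (\<lambda>n. \<Sum>k<n. d k z)" by (simp add: summable_iff_convergent)
    moreover have "(\<Sum>k<n. d k z) = f (r n) z - f (r 0) z" for n
      unfolding d_def by (rule sum_lessThan_telescope)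
    ultimately have "convergent (\<lambda>n. f (r n) z - f (r 0) z)" by simp
    then have "convergent (\<lambda>n. (f (r n) z - f (r 0) z) + f (r 0) z)"
      by (intro convergent_add convergent_const)
    then show ?case by simp
  qed
  define F where "F z = lim (\<lambda>k. f (r k) z)" for z
  have [measurable]: "F \<in> borel_measurable ?M" unfolding F_def[abs_def] by measurable
  \<comment> \<open>Fatou's lemma along the subsequence. The nonnegative integral is used because
    \<open>f n - F\<close> is not yet known to be square integrable.\<close>
  have key: "(\<integral>\<^sup>+z. ennreal ((cmod (f n z - F z))\<^sup>2) \<partial>?M) \<le> ennreal (\<epsilon>\<^sup>2)"
    if "\<epsilon> > 0" and n: "n \<ge> M" and M: "\<forall>m\<ge>M. \<forall>n\<ge>M. L2_norm U (\<lambda>z. f m z - f n z) < \<epsilon>" for \<epsilon> n M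
  proof -
    have "(\<integral>\<^sup>+z. ennreal ((cmod (f n z - F z))\<^sup>2) \<partial>?M) =
      (\<integral>\<^sup>+z. liminf (\<lambda>k. ennreal ((cmod (f n z - f (r k) z))\<^sup>2)) \<partial>?M)"
    proof (rule nn_integral_cong_AE)
      show "AE z in ?M. ennreal ((cmod (f n z - F z))\<^sup>2) = liminf (\<lambda>k. ennreal ((cmod (f n z - f (r k) z))\<^sup>2))"
        using conv
      proof eventually_elim
        case (elim z)
        then have "(\<lambda>k. f (r k) z) \<longlonglongrightarrow> F z" by (simp add: F_def convergent_LIMSEQ_iff)
        then have "(\<lambda>k. ennreal ((cmod (f n z - f (r k) z))\<^sup>2)) \<longlonglongrightarrow> ennreal ((cmod (f n z - F z))\<^sup>2)"
          by (intro tendsto_ennrealI tendsto_intros)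
        from lim_imp_Liminf[OF _ this] show ?case by simp
      qed
    qed
    also have "\<dots> \<le> liminf (\<lambda>k. \<integral>\<^sup>+z. ennreal ((cmod (f n z - f (r k) z))\<^sup>2) \<partial>?M)"
      by (rule nn_integral_liminf) measurable
    also have "\<dots> \<le> liminf (\<lambda>k. ennreal (\<epsilon>\<^sup>2))"
    proof (rule Liminf_mono)
      show "\<forall>\<^sub>F k in sequentially. (\<integral>\<^sup>+z. ennreal ((cmod (f n z - f (r k) z))\<^sup>2) \<partial>?M) \<le> ennreal (\<epsilon>\<^sup>2)"
        using eventually_ge_at_top[of M]
      proof eventually_elim
        case (elim k)
        then have "r k \<ge> M" using rk[of k] by simp
        then have "L2_norm U (\<lambda>z. f n z - f (r k) z) \<le> \<epsilon>" using M n by (auto intro: less_imp_le)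
        then show ?case
          unfolding L2_nn_integral[OF U(1) L2_diff[OF U(1) f f]] by (intro ennreal_leI power_mono) auto
      qed
    qed
    finally show ?thesis by (simp add: Liminf_const)
  qed
  have L: "(\<lambda>z. f n z - F z) \<in> L2 U \<and> L2_norm U (\<lambda>z. f n z - F z) \<le> \<epsilon>"
    if "\<epsilon> > 0" "n \<ge> M" "\<forall>m\<ge>M. \<forall>n\<ge>M. L2_norm U (\<lambda>z. f m z - f n z) < \<epsilon>" for \<epsilon> n M
  proof -
    have k: "(\<integral>\<^sup>+z. ennreal ((cmod (f n z - F z))\<^sup>2) \<partial>?M) \<le> ennreal (\<epsilon>\<^sup>2)" by (rule key[OF that])
    have i: "integrable ?M (\<lambda>z. (cmod (f n z - F z))\<^sup>2)"
      using le_less_trans[OF k] by (intro integrableI_bounded) auto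
    then have m: "(\<lambda>z. f n z - F z) \<in> L2 U" by (simp add: L2_iff[OF U(1)])
    have "(L2_norm U (\<lambda>z. f n z - F z))\<^sup>2 \<le> \<epsilon>\<^sup>2"
      using k unfolding L2_nn_integral[OF U(1) m] by simp
    with m that(1) show ?thesis by (auto intro: power2_le_imp_le)
  qed
  obtain M where "\<forall>m\<ge>M. \<forall>n\<ge>M. L2_norm U (\<lambda>z. f m z - f n z) < 1" using cauchy[of 1] by auto
  from L[OF _ order_refl this] have "(\<lambda>z. f M z - F z) \<in> L2 U" by simp
  from L2_diff[OF U(1) f this, of M] have "F \<in> L2 U" by simp
  moreover have "(\<lambda>n. L2_norm U (\<lambda>z. f n z - F z)) \<longlonglongrightarrow> 0"
  proof (rule LIMSEQ_I)
    fix e :: real assume "e > 0"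
    then have e: "e/2 > 0" by simp
    from cauchy[OF this] obtain M where "\<forall>m\<ge>M. \<forall>n\<ge>M. L2_norm U (\<lambda>z. f m z - f n z) < e/2" by auto
    from L[OF e _ this] have "\<forall>n\<ge>M. L2_norm U (\<lambda>z. f n z - F z) \<le> e/2" by blast
    then show "\<exists>no. \<forall>n\<ge>no. norm (L2_norm U (\<lambda>z. f n z - F z) - 0) < e"
      using \<open>e > 0\<close> by (intro exI[of _ M]) fastforce
  qed
  ultimately show thesis by (rule that)
qed

section \<open>Closed forms given by closures of graphs\<close>

definition L2_graph :: "plane set \<Rightarrow> cfun set \<Rightarrow> (cfun \<Rightarrow> cfun) \<Rightarrow> (cfun \<Rightarrow> cfun) \<Rightarrow> bool" where
  "L2_graph U C d1 d2 \<longleftrightarrow> U \<in> sets borel \<and> (\<forall>\<phi>\<in>C. \<phi> \<in> L2 U \<and> d1 \<phi> \<in> L2 U \<and> d2 \<phi> \<in> L2 U)"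

text \<open>The closure of the graph of (d1, d2) in three copies of L2. With g1 and g2 as components
  of their own both operators are treated alike: they are weak derivatives in one case and limits of
  magnetic derivatives in the other.\<close>

definition graph_closure ::
  "plane set \<Rightarrow> cfun set \<Rightarrow> (cfun \<Rightarrow> cfun) \<Rightarrow> (cfun \<Rightarrow> cfun) \<Rightarrow> (cfun \<times> cfun \<times> cfun) set" where
  "graph_closure U C d1 d2 = {(w, g1, g2). w \<in> L2 U \<and> g1 \<in> L2 U \<and> g2 \<in> L2 U \<and>
     (\<forall>\<epsilon>>0. \<exists>\<phi>\<in>C. L2_norm U (\<lambda>z. \<phi> z - w z) < \<epsilon> \<and> L2_norm U (\<lambda>z. d1 \<phi> z - g1 z) < \<epsilon> \<and>
        L2_norm U (\<lambda>z. d2 \<phi> z - g2 z) < \<epsilon>)}"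

text \<open>The equation is required on the core only, where it can be checked;
  \<open>weak_solution_closure\<close> extends it to the form domain by continuity.\<close>

definition weak_solution ::
  "plane set \<Rightarrow> cfun set \<Rightarrow> (cfun \<Rightarrow> cfun) \<Rightarrow> (cfun \<Rightarrow> cfun) \<Rightarrow> complex \<Rightarrow> cfun \<Rightarrow> cfun \<Rightarrow> cfun \<Rightarrow> bool" where
  "weak_solution U C d1 d2 \<mu> w g1 g2 \<longleftrightarrow> (w, g1, g2) \<in> graph_closure U C d1 d2 \<and>
     (\<forall>\<phi>\<in>C. L2_inner U g1 (d1 \<phi>) + L2_inner U g2 (d2 \<phi>) = \<mu> * L2_inner U w \<phi>)"

definition weak_eigenvalues ::
  "plane set \<Rightarrow> cfun set \<Rightarrow> (cfun \<Rightarrow> cfun) \<Rightarrow> (cfun \<Rightarrow> cfun) \<Rightarrow> complex set" where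
  "weak_eigenvalues U C d1 d2 = {\<mu>. \<exists>w g1 g2. weak_solution U C d1 d2 \<mu> w g1 g2 \<and>
     \<not> (AE z in lborel. z \<in> U \<longrightarrow> w z = 0)}"

lemma graph_closure_L2:
  "(w, g1, g2) \<in> graph_closure U C d1 d2 \<Longrightarrow> w \<in> L2 U \<and> g1 \<in> L2 U \<and> g2 \<in> L2 U"
  by (simp add: graph_closure_def)

lemma graph_closure_iff_sequence:
  "(w, g1, g2) \<in> graph_closure U C d1 d2 \<longleftrightarrow> w \<in> L2 U \<and> g1 \<in> L2 U \<and> g2 \<in> L2 U \<and>
     (\<exists>\<phi> :: nat \<Rightarrow> cfun. (\<forall>n. \<phi> n \<in> C) \<and> (\<lambda>n. L2_norm U (\<lambda>z. \<phi> n z - w z)) \<longlonglongrightarrow> 0 \<and>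
        (\<lambda>n. L2_norm U (\<lambda>z. d1 (\<phi> n) z - g1 z)) \<longlonglongrightarrow> 0 \<and>
        (\<lambda>n. L2_norm U (\<lambda>z. d2 (\<phi> n) z - g2 z)) \<longlonglongrightarrow> 0)"
  (is "?L \<longleftrightarrow> ?R")
proof
  assume L: ?L
  let ?P = "\<lambda>n \<phi>. \<phi> \<in> C \<and> L2_norm U (\<lambda>z. \<phi> z - w z) < inverse (real (Suc n)) \<and>
      L2_norm U (\<lambda>z. d1 \<phi> z - g1 z) < inverse (real (Suc n)) \<and>
      L2_norm U (\<lambda>z. d2 \<phi> z - g2 z) < inverse (real (Suc n))"
  have "\<forall>n. \<exists>\<phi>. ?P n \<phi>"
    using L unfolding graph_closure_def by (simp add: Bex_def del: of_nat_Suc)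
  then have "\<exists>\<phi>. \<forall>n. ?P n (\<phi> n)" by (rule choice)
  then obtain \<phi> where "\<forall>n. ?P n (\<phi> n)" ..
  then have \<phi>: "\<And>n. \<phi> n \<in> C"
      "\<And>n. L2_norm U (\<lambda>z. \<phi> n z - w z) < inverse (real (Suc n))"
      "\<And>n. L2_norm U (\<lambda>z. d1 (\<phi> n) z - g1 z) < inverse (real (Suc n))"
      "\<And>n. L2_norm U (\<lambda>z. d2 (\<phi> n) z - g2 z) < inverse (real (Suc n))"
    by simp_all
  have null: "a \<longlonglongrightarrow> 0" if "\<And>n. 0 \<le> a n" "\<And>n. a n < inverse (real (Suc n))" for a :: "nat \<Rightarrow> real"
    by (rule tendsto_sandwich[OF _ _ tendsto_const LIMSEQ_inverse_real_of_nat])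
       (use that in \<open>auto intro!: always_eventually less_imp_le simp del: of_nat_Suc\<close>)
  have "\<exists>\<phi> :: nat \<Rightarrow> cfun. (\<forall>n. \<phi> n \<in> C) \<and> (\<lambda>n. L2_norm U (\<lambda>z. \<phi> n z - w z)) \<longlonglongrightarrow> 0 \<and>
        (\<lambda>n. L2_norm U (\<lambda>z. d1 (\<phi> n) z - g1 z)) \<longlonglongrightarrow> 0 \<and>
        (\<lambda>n. L2_norm U (\<lambda>z. d2 (\<phi> n) z - g2 z)) \<longlonglongrightarrow> 0"
  proof (intro exI[of _ \<phi>] conjI allI)
    show "(\<lambda>n. L2_norm U (\<lambda>z. \<phi> n z - w z)) \<longlonglongrightarrow> 0"
      by (rule null) (simp_all only: L2_norm_nonneg \<phi>)
    show "(\<lambda>n. L2_norm U (\<lambda>z. d1 (\<phi> n) z - g1 z)) \<longlonglongrightarrow> 0"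
      by (rule null) (simp_all only: L2_norm_nonneg \<phi>)
    show "(\<lambda>n. L2_norm U (\<lambda>z. d2 (\<phi> n) z - g2 z)) \<longlonglongrightarrow> 0"
      by (rule null) (simp_all only: L2_norm_nonneg \<phi>)
  qed (rule \<phi>(1))
  with graph_closure_L2[OF L] show ?R by blast
next
  assume R: ?R
  then obtain \<phi> :: "nat \<Rightarrow> cfun" where \<phi>: "\<And>n. \<phi> n \<in> C" "(\<lambda>n. L2_norm U (\<lambda>z. \<phi> n z - w z)) \<longlonglongrightarrow> 0"
      "(\<lambda>n. L2_norm U (\<lambda>z. d1 (\<phi> n) z - g1 z)) \<longlonglongrightarrow> 0"
      "(\<lambda>n. L2_norm U (\<lambda>z. d2 (\<phi> n) z - g2 z)) \<longlonglongrightarrow> 0" by blast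
  have "\<exists>\<phi>\<in>C. L2_norm U (\<lambda>z. \<phi> z - w z) < \<epsilon> \<and> L2_norm U (\<lambda>z. d1 \<phi> z - g1 z) < \<epsilon> \<and>
        L2_norm U (\<lambda>z. d2 \<phi> z - g2 z) < \<epsilon>" if e: "\<epsilon> > 0" for \<epsilon>
  proof -
    have "\<forall>\<^sub>F n in sequentially. L2_norm U (\<lambda>z. \<phi> n z - w z) < \<epsilon> \<and>
        L2_norm U (\<lambda>z. d1 (\<phi> n) z - g1 z) < \<epsilon> \<and> L2_norm U (\<lambda>z. d2 (\<phi> n) z - g2 z) < \<epsilon>"
      using \<phi>(2-4)[THEN order_tendstoD(2), OF e] by (intro eventually_conj)
    then show ?thesis using \<phi>(1) by (auto simp: eventually_sequentially)
  qed
  with R show ?L unfolding graph_closure_def by blast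
qed

lemma graph_closure_base:
  assumes "L2_graph U C d1 d2" "\<phi> \<in> C"
  shows "(\<phi>, d1 \<phi>, d2 \<phi>) \<in> graph_closure U C d1 d2"
  using assms unfolding graph_closure_def L2_graph_def
  by (auto intro!: bexI[of _ \<phi>] simp: L2_norm_def set_lebesgue_integral_def)

text \<open>Approximating the approximants costs another half of \<epsilon>. This allows limits to
  be taken one after the other.\<close>

lemma graph_closure_closed:
  assumes G: "L2_graph U C d1 d2" and L: "w \<in> L2 U" "g1 \<in> L2 U" "g2 \<in> L2 U"
    and ex: "\<And>\<epsilon>. \<epsilon> > 0 \<Longrightarrow> \<exists>v h1 h2. (v, h1, h2) \<in> graph_closure U C d1 d2 \<and>
      L2_norm U (\<lambda>z. v z - w z) < \<epsilon> \<and> L2_norm U (\<lambda>z. h1 z - g1 z) < \<epsilon> \<and>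
      L2_norm U (\<lambda>z. h2 z - g2 z) < \<epsilon>"
  shows "(w, g1, g2) \<in> graph_closure U C d1 d2"
proof -
  have U: "U \<in> sets borel" using G by (simp add: L2_graph_def)
  have "\<exists>\<phi>\<in>C. L2_norm U (\<lambda>z. \<phi> z - w z) < \<epsilon> \<and> L2_norm U (\<lambda>z. d1 \<phi> z - g1 z) < \<epsilon> \<and>
        L2_norm U (\<lambda>z. d2 \<phi> z - g2 z) < \<epsilon>" if e: "\<epsilon> > 0" for \<epsilon>
  proof -
    from e have e2: "\<epsilon> / 2 > 0" by simp
    from ex[OF e2] obtain v h1 h2 where v: "(v, h1, h2) \<in> graph_closure U C d1 d2"
      "L2_norm U (\<lambda>z. v z - w z) < \<epsilon> / 2" "L2_norm U (\<lambda>z. h1 z - g1 z) < \<epsilon> / 2"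
      "L2_norm U (\<lambda>z. h2 z - g2 z) < \<epsilon> / 2" by blast
    from v(1) e2 obtain \<phi> where p: "\<phi> \<in> C" "L2_norm U (\<lambda>z. \<phi> z - v z) < \<epsilon> / 2"
      "L2_norm U (\<lambda>z. d1 \<phi> z - h1 z) < \<epsilon> / 2" "L2_norm U (\<lambda>z. d2 \<phi> z - h2 z) < \<epsilon> / 2"
      unfolding graph_closure_def by blast
    have m: "\<phi> \<in> L2 U" "d1 \<phi> \<in> L2 U" "d2 \<phi> \<in> L2 U" "v \<in> L2 U" "h1 \<in> L2 U" "h2 \<in> L2 U"
      using G p(1) graph_closure_L2[OF v(1)] by (auto simp: L2_graph_def)
    show ?thesis
      using p v L2_norm_triangle_diff[OF U m(1) m(4) L(1)] L2_norm_triangle_diff[OF U m(2) m(5) L(2)]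
        L2_norm_triangle_diff[OF U m(3) m(6) L(3)] by (intro bexI[of _ \<phi>] conjI) linarith+
  qed
  with L show ?thesis unfolding graph_closure_def by blast
qed

lemma graph_closure_cong:
  assumes "(w, g1, g2) \<in> graph_closure U C d1 d2"
    and "\<And>z. z \<in> U \<Longrightarrow> w z = w' z" "\<And>z. z \<in> U \<Longrightarrow> g1 z = g1' z" "\<And>z. z \<in> U \<Longrightarrow> g2 z = g2' z"
  shows "(w', g1', g2') \<in> graph_closure U C d1 d2"
proof -
  have m: "w' \<in> L2 U" "g1' \<in> L2 U" "g2' \<in> L2 U"
    using graph_closure_L2[OF assms(1)] L2_cong[of U w w'] L2_cong[of U g1 g1'] L2_cong[of U g2 g2'] assms(2-4)
    by blast+
  have "L2_norm U (\<lambda>z. f z - w z) = L2_norm U (\<lambda>z. f z - w' z)"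
    "L2_norm U (\<lambda>z. f z - g1 z) = L2_norm U (\<lambda>z. f z - g1' z)"
    "L2_norm U (\<lambda>z. f z - g2 z) = L2_norm U (\<lambda>z. f z - g2' z)" for f
    using assms(2-4) by (auto intro!: L2_norm_cong')
  with m assms(1) show ?thesis unfolding graph_closure_def by simp
qed

lemma weak_solution_closure:
  assumes G: "L2_graph U C d1 d2" and w: "weak_solution U C d1 d2 \<mu> w g1 g2"
    and v: "(v, h1, h2) \<in> graph_closure U C d1 d2"
  shows "L2_inner U g1 h1 + L2_inner U g2 h2 = \<mu> * L2_inner U w v"
proof -
  have U: "U \<in> sets borel" using G by (simp add: L2_graph_def)
  have "(w, g1, g2) \<in> graph_closure U C d1 d2" using w by (simp add: weak_solution_def)
  from graph_closure_L2[OF this] have m: "w \<in> L2 U" "g1 \<in> L2 U" "g2 \<in> L2 U" by auto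
  from v obtain \<phi> :: "nat \<Rightarrow> cfun" where L: "v \<in> L2 U" "h1 \<in> L2 U" "h2 \<in> L2 U"
    and \<phi>: "\<And>n. \<phi> n \<in> C" "(\<lambda>n. L2_norm U (\<lambda>z. \<phi> n z - v z)) \<longlonglongrightarrow> 0"
      "(\<lambda>n. L2_norm U (\<lambda>z. d1 (\<phi> n) z - h1 z)) \<longlonglongrightarrow> 0"
      "(\<lambda>n. L2_norm U (\<lambda>z. d2 (\<phi> n) z - h2 z)) \<longlonglongrightarrow> 0"
    unfolding graph_closure_iff_sequence by blast
  have n: "\<phi> n \<in> L2 U" "d1 (\<phi> n) \<in> L2 U" "d2 (\<phi> n) \<in> L2 U" for n
    using G \<phi>(1)[of n] unfolding L2_graph_def by blast+
  have right: "(\<lambda>n. L2_inner U h (f n)) \<longlonglongrightarrow> L2_inner U h F"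
    if "h \<in> L2 U" "\<And>n. f n \<in> L2 U" "F \<in> L2 U" "(\<lambda>n. L2_norm U (\<lambda>z. f n z - F z)) \<longlonglongrightarrow> 0" for f F h
  proof -
    have "(\<lambda>n. cnj (L2_inner U (f n) h)) \<longlonglongrightarrow> cnj (L2_inner U F h)"
      by (rule tendsto_cnj) (rule L2_inner_tendsto[OF U that(2,3,1,4)])
    then show ?thesis by (simp only: L2_inner_commute[OF U, symmetric])
  qed
  have 1: "(\<lambda>n. L2_inner U g1 (d1 (\<phi> n)) + L2_inner U g2 (d2 (\<phi> n))) \<longlonglongrightarrow> L2_inner U g1 h1 + L2_inner U g2 h2"
    by (rule tendsto_add[OF right[OF m(2) n(2) L(2) \<phi>(3)] right[OF m(3) n(3) L(3) \<phi>(4)]])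
  have 2: "(\<lambda>n. \<mu> * L2_inner U w (\<phi> n)) \<longlonglongrightarrow> \<mu> * L2_inner U w v"
    by (rule tendsto_mult[OF tendsto_const right[OF m(1) n(1) L(1) \<phi>(2)]])
  have "L2_inner U g1 (d1 (\<phi> n)) + L2_inner U g2 (d2 (\<phi> n)) = \<mu> * L2_inner U w (\<phi> n)" for n
    using w \<phi>(1) by (simp add: weak_solution_def)
  with 1 have "(\<lambda>n. \<mu> * L2_inner U w (\<phi> n)) \<longlonglongrightarrow> L2_inner U g1 h1 + L2_inner U g2 h2" by simp
  from LIMSEQ_unique[OF this 2] show ?thesis .
qed

section \<open>Transport of weak solutions along pairs of adjoint maps\<close>

definition L2_adjoint :: "plane set \<Rightarrow> plane set \<Rightarrow> (cfun \<Rightarrow> cfun) \<Rightarrow> (cfun \<Rightarrow> cfun) \<Rightarrow> bool" where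
  "L2_adjoint U V J K \<longleftrightarrow> U \<in> sets borel \<and> V \<in> sets borel \<and>
     (\<forall>f\<in>L2 U. J f \<in> L2 V) \<and> (\<forall>g\<in>L2 V. K g \<in> L2 U) \<and>
     (\<forall>f\<in>L2 U. \<forall>g\<in>L2 V. L2_inner V (J f) g = L2_inner U f (K g)) \<and>
     (\<forall>f g. J (\<lambda>z. f z - g z) = (\<lambda>z. J f z - J g z)) \<and>
     (\<forall>f g. K (\<lambda>z. f z - g z) = (\<lambda>z. K f z - K g z)) \<and>
     (\<exists>c. \<forall>f\<in>L2 U. L2_norm V (J f) \<le> c * L2_norm U f) \<and>
     (\<exists>c. \<forall>g\<in>L2 V. L2_norm U (K g) \<le> c * L2_norm V g)"

lemma L2_adjoint_sym:
  assumes "L2_adjoint U V J K"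
  shows "L2_adjoint V U K J"
proof -
  have "L2_inner U (K g) f = L2_inner V g (J f)" if "f \<in> L2 U" "g \<in> L2 V" for f g
  proof -
    have "L2_inner U (K g) f = cnj (L2_inner U f (K g))"
      using assms by (intro L2_inner_commute) (simp add: L2_adjoint_def)
    also have "\<dots> = cnj (L2_inner V (J f) g)" using assms that by (simp add: L2_adjoint_def)
    also have "\<dots> = L2_inner V g (J f)"
      using assms by (intro L2_inner_commute[symmetric]) (simp add: L2_adjoint_def)
    finally show ?thesis .
  qed
  with assms show ?thesis unfolding L2_adjoint_def by simp
qed

text \<open>The maps are bounded and respect differences, hence it is enough to know where they send
  the core.\<close>

lemma graph_closure_map:
  assumes G: "L2_graph U C d1 d2" and G': "L2_graph V C' d1' d2'"
    and J: "L2_adjoint U V J0 K0" "L2_adjoint U V J1 K1" "L2_adjoint U V J2 K2"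
    and C: "\<And>\<phi>. \<phi> \<in> C \<Longrightarrow> (J0 \<phi>, J1 (d1 \<phi>), J2 (d2 \<phi>)) \<in> graph_closure V C' d1' d2'"
    and w: "(w, g1, g2) \<in> graph_closure U C d1 d2"
  shows "(J0 w, J1 g1, J2 g2) \<in> graph_closure V C' d1' d2'"
proof (rule graph_closure_closed[OF G'])
  have m: "w \<in> L2 U" "g1 \<in> L2 U" "g2 \<in> L2 U" using graph_closure_L2[OF w] by auto
  then show "J0 w \<in> L2 V" "J1 g1 \<in> L2 V" "J2 g2 \<in> L2 V" using J by (auto simp: L2_adjoint_def)
  have U: "U \<in> sets borel" using G by (simp add: L2_graph_def)
  \<comment> \<open>The constant is enlarged to be positive, since \<delta> below divides \<epsilon>
    by it.\<close>
  have bound: "\<exists>c>0. \<forall>f\<in>L2 U. L2_norm V (J f) \<le> c * L2_norm U f" if "L2_adjoint U V J K" for J K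
  proof -
    from that obtain c where c: "\<forall>f\<in>L2 U. L2_norm V (J f) \<le> c * L2_norm U f" by (auto simp: L2_adjoint_def)
    have "c * L2_norm U f \<le> max c 1 * L2_norm U f" for f by (intro mult_right_mono) auto
    with c show ?thesis by (intro exI[of _ "max c 1"]) (fastforce intro: order_trans)
  qed
  obtain c0 c1 c2 where c: "c0 > 0" "c1 > 0" "c2 > 0"
    "\<forall>f\<in>L2 U. L2_norm V (J0 f) \<le> c0 * L2_norm U f" "\<forall>f\<in>L2 U. L2_norm V (J1 f) \<le> c1 * L2_norm U f"
    "\<forall>f\<in>L2 U. L2_norm V (J2 f) \<le> c2 * L2_norm U f"
    using bound[OF J(1)] bound[OF J(2)] bound[OF J(3)] by blast
  fix \<epsilon> :: real assume e: "\<epsilon> > 0"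
  define \<delta> where "\<delta> = min (\<epsilon> / c0) (min (\<epsilon> / c1) (\<epsilon> / c2))"
  have "\<delta> > 0" using e c by (simp add: \<delta>_def)
  with w obtain \<phi> where p: "\<phi> \<in> C" "L2_norm U (\<lambda>z. \<phi> z - w z) < \<delta>"
      "L2_norm U (\<lambda>z. d1 \<phi> z - g1 z) < \<delta>" "L2_norm U (\<lambda>z. d2 \<phi> z - g2 z) < \<delta>"
    unfolding graph_closure_def by blast
  have n: "\<phi> \<in> L2 U" "d1 \<phi> \<in> L2 U" "d2 \<phi> \<in> L2 U" using G p(1) by (auto simp: L2_graph_def)
  have est: "L2_norm V (\<lambda>z. J f z - J g z) < \<epsilon>"
    if "L2_adjoint U V J K" "f \<in> L2 U" "g \<in> L2 U" "L2_norm U (\<lambda>z. f z - g z) < \<delta>" "\<delta> \<le> \<epsilon> / c" "c > 0"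
      "\<forall>f\<in>L2 U. L2_norm V (J f) \<le> c * L2_norm U f" for J K f g c
  proof -
    have "L2_norm V (\<lambda>z. J f z - J g z) = L2_norm V (J (\<lambda>z. f z - g z))"
      using that(1) by (simp add: L2_adjoint_def)
    also have "\<dots> \<le> c * L2_norm U (\<lambda>z. f z - g z)" using that L2_diff[OF U] by blast
    also have "\<dots> < c * (\<epsilon> / c)" using that by (intro mult_strict_left_mono) auto
    finally show ?thesis using that(6) by simp
  qed
  have "\<delta> \<le> \<epsilon> / c0" "\<delta> \<le> \<epsilon> / c1" "\<delta> \<le> \<epsilon> / c2" by (auto simp: \<delta>_def)
  with C[OF p(1)] est[OF J(1) n(1) m(1) p(2) _ c(1) c(4)] est[OF J(2) n(2) m(2) p(3) _ c(2) c(5)]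
    est[OF J(3) n(3) m(3) p(4) _ c(3) c(6)]
  show "\<exists>v h1 h2. (v, h1, h2) \<in> graph_closure V C' d1' d2' \<and>
      L2_norm V (\<lambda>z. v z - J0 w z) < \<epsilon> \<and> L2_norm V (\<lambda>z. h1 z - J1 g1 z) < \<epsilon> \<and>
      L2_norm V (\<lambda>z. h2 z - J2 g2 z) < \<epsilon>" by blast
qed

text \<open>By adjointness, testing the image against \<psi> amounts to testing the original
  solution against \<open>(K0 \<psi>, K1 (d1' \<psi>), K2 (d2' \<psi>))\<close>. This triple lies in
  the closure of the first graph, where the equation for w holds, so the same \<mu> appears.\<close>

lemma weak_solution_map:
  assumes G: "L2_graph U C d1 d2" and G': "L2_graph V C' d1' d2'"
    and J: "L2_adjoint U V J0 K0" "L2_adjoint U V J1 K1" "L2_adjoint U V J2 K2"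
    and C: "\<And>\<phi>. \<phi> \<in> C \<Longrightarrow> (J0 \<phi>, J1 (d1 \<phi>), J2 (d2 \<phi>)) \<in> graph_closure V C' d1' d2'"
    and C': "\<And>\<psi>. \<psi> \<in> C' \<Longrightarrow> (K0 \<psi>, K1 (d1' \<psi>), K2 (d2' \<psi>)) \<in> graph_closure U C d1 d2"
    and w: "weak_solution U C d1 d2 \<mu> w g1 g2"
  shows "weak_solution V C' d1' d2' \<mu> (J0 w) (J1 g1) (J2 g2)"
  unfolding weak_solution_def
proof (intro conjI ballI)
  have cl: "(w, g1, g2) \<in> graph_closure U C d1 d2" using w by (simp add: weak_solution_def)
  show "(J0 w, J1 g1, J2 g2) \<in> graph_closure V C' d1' d2'"
    by (rule graph_closure_map[OF G G' J _ cl]) (rule C)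
  fix \<psi> assume p: "\<psi> \<in> C'"
  then have "\<psi> \<in> L2 V" "d1' \<psi> \<in> L2 V" "d2' \<psi> \<in> L2 V" using G' by (auto simp: L2_graph_def)
  moreover note graph_closure_L2[OF cl] weak_solution_closure[OF G w C'[OF p]]
  ultimately show "L2_inner V (J1 g1) (d1' \<psi>) + L2_inner V (J2 g2) (d2' \<psi>) = \<mu> * L2_inner V (J0 w) \<psi>"
    using J by (simp add: L2_adjoint_def)
qed

lemma weak_eigenvalues_swap: "weak_eigenvalues U C d2 d1 = weak_eigenvalues U C d1 d2"
proof -
  have "weak_solution U C d2 d1 \<mu> w g2 g1 \<longleftrightarrow> weak_solution U C d1 d2 \<mu> w g1 g2" for \<mu> w g1 g2
    by (auto simp: weak_solution_def graph_closure_def add.commute)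
  then show ?thesis unfolding weak_eigenvalues_def by blast
qed

lemma L2_graph_swap: "L2_graph U C d2 d1 = L2_graph U C d1 d2"
  by (auto simp: L2_graph_def)

section \<open>Pullback and folding on \<open>L\<^sup>2\<close>\<close>

text \<open>The inverse is a parameter because it enters the adjoint of a pullback.\<close>

definition lborel_iso :: "(plane \<Rightarrow> plane) \<Rightarrow> (plane \<Rightarrow> plane) \<Rightarrow> bool" where
  "lborel_iso \<rho> \<rho>' \<longleftrightarrow> continuous_on UNIV \<rho> \<and> continuous_on UNIV \<rho>' \<and> (\<forall>z. \<rho> (\<rho>' z) = z) \<and>
     (\<forall>z. \<rho>' (\<rho> z) = z) \<and> distr lborel borel \<rho> = lborel"

lemma lborel_iso_measurable:
  assumes "lborel_iso \<rho> \<rho>'"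
  shows "\<rho> \<in> borel_measurable borel" "\<rho>' \<in> borel_measurable borel"
  using assms by (auto simp: lborel_iso_def borel_measurable_continuous_onI)

lemma lborel_iso_inverse:
  assumes "lborel_iso \<rho> \<rho>'"
  shows "\<rho> (\<rho>' z) = z" "\<rho>' (\<rho> z) = z"
  using assms unfolding lborel_iso_def by blast+

lemma lborel_iso_sym:
  assumes "lborel_iso \<rho> \<rho>'"
  shows "lborel_iso \<rho>' \<rho>"
proof -
  note [measurable] = lborel_iso_measurable[OF assms]
  have "distr lborel borel \<rho>' = distr (distr lborel borel \<rho>) borel \<rho>'"
    using assms by (simp add: lborel_iso_def)
  also have "\<dots> = distr lborel borel (\<rho>' \<circ> \<rho>)" by (rule distr_distr) auto
  also have "\<rho>' \<circ> \<rho> = (\<lambda>z. z)" using lborel_iso_inverse[OF assms] by auto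
  also have "distr lborel borel (\<lambda>z. z) = (lborel :: plane measure)"
    by (rule distr_id2) simp
  finally show ?thesis using assms by (simp add: lborel_iso_def)
qed

lemma lborel_iso_integrable:
  fixes f :: "plane \<Rightarrow> 'a::{banach, second_countable_topology}"
  assumes "lborel_iso \<rho> \<rho>'" "integrable lborel f"
  shows "integrable lborel (\<lambda>z. f (\<rho> z))"
proof -
  note [measurable] = lborel_iso_measurable[OF assms(1)]
  have "integrable (distr lborel borel \<rho>) f" using assms by (simp add: lborel_iso_def)
  then show ?thesis by (rule integrable_distr[rotated]) simp
qed

lemma lborel_iso_integral:
  fixes f :: "plane \<Rightarrow> 'a::{banach, second_countable_topology}"
  assumes "lborel_iso \<rho> \<rho>'" "f \<in> borel_measurable borel"
  shows "(\<integral>z. f (\<rho> z) \<partial>lborel) = (\<integral>z. f z \<partial>lborel)"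
proof -
  note [measurable] = lborel_iso_measurable[OF assms(1)]
  have "(\<integral>z. f z \<partial>lborel) = (\<integral>z. f z \<partial>distr lborel borel \<rho>)" using assms by (simp add: lborel_iso_def)
  also have "\<dots> = (\<integral>z. f (\<rho> z) \<partial>lborel)" by (rule integral_distr) (use assms in auto)
  finally show ?thesis ..
qed

text \<open>Extension by zero moves every statement to the whole plane, where the invariance of
  Lebesgue measure applies directly.\<close>

lemma L2_extend_zero:
  assumes "U \<in> sets borel"
  shows "f \<in> L2 U \<longleftrightarrow> (\<lambda>z. indicator U z *\<^sub>R f z) \<in> borel_measurable borel \<and>
    integrable lborel (\<lambda>z. (cmod (indicator U z *\<^sub>R f z))\<^sup>2)"
proof -
  have "(\<lambda>z. indicat_real U z *\<^sub>R (cmod (f z))\<^sup>2) = (\<lambda>z. (cmod (indicator U z *\<^sub>R f z))\<^sup>2)"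
    by (auto simp: indicator_def)
  then show ?thesis
    unfolding L2_def set_borel_measurable_def set_integrable_def by (simp only: mem_Collect_eq) simp
qed

lemma L2_inner_extend_zero:
  "L2_inner U f g = (\<integral>z. (indicator U z *\<^sub>R f z) * cnj (indicator U z *\<^sub>R g z) \<partial>lborel)"
  unfolding L2_inner_def set_lebesgue_integral_def
  by (rule Bochner_Integration.integral_cong) (auto simp: indicator_def)

lemma L2_pullback:
  assumes \<rho>: "lborel_iso \<rho> \<rho>'" and UV: "U \<in> sets borel" "V \<in> sets borel" "\<And>z. z \<in> V \<longleftrightarrow> \<rho> z \<in> U"
    and f: "f \<in> L2 U"
  shows "(\<lambda>z. f (\<rho> z)) \<in> L2 V"
proof -
  note [measurable] = lborel_iso_measurable[OF \<rho>]
  let ?F = "\<lambda>z. indicator U z *\<^sub>R f z"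
  have eq: "indicator V z *\<^sub>R f (\<rho> z) = ?F (\<rho> z)" for z by (simp add: indicator_def UV(3))
  have [measurable]: "?F \<in> borel_measurable borel" and i: "integrable lborel (\<lambda>z. (cmod (?F z))\<^sup>2)"
    using f by (auto simp: L2_extend_zero[OF UV(1)])
  have "(\<lambda>z. ?F (\<rho> z)) \<in> borel_measurable borel"
    using measurable_compose[OF lborel_iso_measurable(1)[OF \<rho>] \<open>?F \<in> borel_measurable borel\<close>] .
  then show ?thesis
    unfolding L2_extend_zero[OF UV(2)] eq using lborel_iso_integrable[OF \<rho> i] by simp
qed

lemma L2_inner_pullback:
  assumes \<rho>: "lborel_iso \<rho> \<rho>'" and UV: "U \<in> sets borel" "V \<in> sets borel" "\<And>z. z \<in> V \<longleftrightarrow> \<rho> z \<in> U"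
    and f: "f \<in> L2 U" "g \<in> L2 U"
  shows "L2_inner V (\<lambda>z. f (\<rho> z)) (\<lambda>z. g (\<rho> z)) = L2_inner U f g"
proof -
  let ?E = "\<lambda>f z. indicator U z *\<^sub>R f z"
  have eq: "indicator V z *\<^sub>R f (\<rho> z) = ?E f (\<rho> z)" for z and f :: cfun by (simp add: indicator_def UV(3))
  have [measurable]: "?E f \<in> borel_measurable borel" "?E g \<in> borel_measurable borel"
    using f by (auto simp: L2_extend_zero[OF UV(1)])
  show ?thesis
    unfolding L2_inner_extend_zero eq
    by (rule lborel_iso_integral[OF \<rho>, where f="\<lambda>z. ?E f z * cnj (?E g z)"]) measurable
qed

lemma L2_norm_pullback:
  assumes \<rho>: "lborel_iso \<rho> \<rho>'" and UV: "U \<in> sets borel" "V \<in> sets borel" "\<And>z. z \<in> V \<longleftrightarrow> \<rho> z \<in> U"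
    and f: "f \<in> L2 U"
  shows "L2_norm V (\<lambda>z. f (\<rho> z)) = L2_norm U f"
proof -
  have "complex_of_real ((L2_norm V (\<lambda>z. f (\<rho> z)))\<^sup>2) = of_real ((L2_norm U f)\<^sup>2)"
    using L2_inner_pullback[OF assms f] by (simp add: L2_inner_self UV)
  then show ?thesis by (simp only: of_real_eq_iff power2_eq_iff_nonneg L2_norm_nonneg)
qed

lemma L2_mult_bounded:
  assumes U: "U \<in> sets borel" and c: "c \<in> borel_measurable borel" "\<And>z. cmod (c z) \<le> 1" and f: "f \<in> L2 U"
  shows "(\<lambda>z. c z * f z) \<in> L2 U" and "L2_norm U (\<lambda>z. c z * f z) \<le> L2_norm U f"
proof -
  have [measurable]: "f \<in> borel_measurable (lborel_on U)" using f by (simp add: L2_iff[OF U])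
  have [measurable]: "c \<in> borel_measurable (lborel_on U)"
    by (rule measurable_restrict_space1) (use c in simp)
  have le: "cmod (c z * f z) \<le> cmod (f z)" for z
    using mult_right_mono[OF c(2)[of z], of "cmod (f z)"] by (simp add: norm_mult)
  have "integrable (lborel_on U) (\<lambda>z. (cmod (c z * f z))\<^sup>2)"
  proof (rule Bochner_Integration.integrable_bound[where f="\<lambda>z. (cmod (f z))\<^sup>2"])
    show "AE z in lborel_on U. norm ((cmod (c z * f z))\<^sup>2) \<le> norm ((cmod (f z))\<^sup>2)"
      using power_mono[OF le norm_ge_zero, of _ 2] by simp
  qed (use f in \<open>auto simp: L2_iff[OF U]\<close>)
  then show m: "(\<lambda>z. c z * f z) \<in> L2 U" by (simp add: L2_iff[OF U])
  show "L2_norm U (\<lambda>z. c z * f z) \<le> L2_norm U f"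
    by (rule L2_norm_mono[OF U m f]) (rule le)
qed

lemma L2_subset:
  assumes U: "U \<in> sets borel" "V \<in> sets borel" "U \<subseteq> V" and f: "f \<in> L2 V"
  shows "f \<in> L2 U" and "L2_norm U f \<le> L2_norm V f"
proof -
  have eq: "indicator U z *\<^sub>R f z = indicator U z *\<^sub>R (indicator V z *\<^sub>R f z)" for z
    using U(3) by (auto simp: indicator_def)
  have [measurable]: "(\<lambda>z. indicator V z *\<^sub>R f z) \<in> borel_measurable borel"
    and i: "integrable lborel (\<lambda>z. (cmod (indicator V z *\<^sub>R f z))\<^sup>2)"
    using f by (auto simp: L2_extend_zero[OF U(2)])
  have m: "(\<lambda>z. indicator U z *\<^sub>R f z) \<in> borel_measurable borel" unfolding eq using U(1) by measurable
  have le: "(cmod (indicator U z *\<^sub>R f z))\<^sup>2 \<le> (cmod (indicator V z *\<^sub>R f z))\<^sup>2" for z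
    using U(3) by (auto simp: indicator_def)
  have "(\<lambda>z. (cmod (indicator U z *\<^sub>R f z))\<^sup>2) \<in> borel_measurable lborel" using m by measurable
  then have j: "integrable lborel (\<lambda>z. (cmod (indicator U z *\<^sub>R f z))\<^sup>2)"
    by (rule Bochner_Integration.integrable_bound[OF i]) (use le in auto)
  with m show "f \<in> L2 U" by (simp add: L2_extend_zero[OF U(1)])
  have n: "L2_norm W f = sqrt (\<integral>z. (cmod (indicator W z *\<^sub>R f z))\<^sup>2 \<partial>lborel)" for W
    unfolding L2_norm_def set_lebesgue_integral_def
    by (intro arg_cong[where f=sqrt] Bochner_Integration.integral_cong) (auto simp: indicator_def)
  show "L2_norm U f \<le> L2_norm V f"
    unfolding n by (intro real_sqrt_le_mono integral_mono j i le)
qed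

text \<open>The substitution by \<rho> turns the pullback of one factor into the pullback of the
  other factor by the inverse; the weight c is carried along and conjugated.\<close>

lemma L2_adjoint_pullback:
  assumes \<rho>: "lborel_iso \<rho> \<rho>'" and UV: "U \<in> sets borel" "V \<in> sets borel" "\<And>z. z \<in> V \<longleftrightarrow> \<rho> z \<in> U"
    and c: "c \<in> borel_measurable borel" "\<And>z. cmod (c z) \<le> 1"
  shows "L2_adjoint U V (\<lambda>f z. c z * f (\<rho> z)) (\<lambda>g z. cnj (c (\<rho>' z)) * g (\<rho>' z))"
proof -
  note \<rho>' = lborel_iso_sym[OF \<rho>]
  have VU: "z \<in> U \<longleftrightarrow> \<rho>' z \<in> V" for z using UV(3) lborel_iso_inverse[OF \<rho>] by simp
  note inv = lborel_iso_inverse[OF \<rho>]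
  let ?c = "\<lambda>z. cnj (c (\<rho>' z))"
  have c': "?c \<in> borel_measurable borel" "\<And>z. cmod (?c z) \<le> 1"
    using measurable_compose[OF lborel_iso_measurable(2)[OF \<rho>] c(1)] c(2) by auto
  have J: "(\<lambda>z. c z * f (\<rho> z)) \<in> L2 V \<and> L2_norm V (\<lambda>z. c z * f (\<rho> z)) \<le> L2_norm U f" if "f \<in> L2 U" for f
    using L2_mult_bounded[OF UV(2) c L2_pullback[OF \<rho> UV that]] L2_norm_pullback[OF \<rho> UV that] by simp
  have K: "(\<lambda>z. ?c z * g (\<rho>' z)) \<in> L2 U \<and> L2_norm U (\<lambda>z. ?c z * g (\<rho>' z)) \<le> L2_norm V g" if "g \<in> L2 V" for g
    using L2_mult_bounded[OF UV(1) c' L2_pullback[OF \<rho>' UV(2,1) VU that]]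
      L2_norm_pullback[OF \<rho>' UV(2,1) VU that] by simp
  have "L2_inner V (\<lambda>z. c z * f (\<rho> z)) g = L2_inner U f (\<lambda>z. ?c z * g (\<rho>' z))"
    if f: "f \<in> L2 U" and g: "g \<in> L2 V" for f g
  proof -
    have "L2_inner U f (\<lambda>z. ?c z * g (\<rho>' z)) = L2_inner V (\<lambda>z. f (\<rho> z)) (\<lambda>z. ?c (\<rho> z) * g (\<rho>' (\<rho> z)))"
      using K[OF g] by (intro L2_inner_pullback[OF \<rho> UV f, symmetric]) simp
    also have "\<dots> = L2_inner V (\<lambda>z. c z * f (\<rho> z)) g"
      by (simp add: inv L2_inner_def mult_ac)
    finally show ?thesis ..
  qed
  with J K show ?thesis
    unfolding L2_adjoint_def
    by (intro conjI ballI allI exI[of _ 1]) (use UV in \<open>auto simp: right_diff_distrib\<close>)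
qed

text \<open>V consists of U, its mirror image and a remainder on which c vanishes. Every point of U
  is reached by \<kappa> from itself and from its mirror point, so the adjoint collects two terms.
  On the remainder the factor 0 secures measurability, since f is arbitrary outside U.\<close>

lemma L2_adjoint_fold:
  assumes \<sigma>: "lborel_iso \<sigma> \<sigma>" and F: "\<kappa> \<in> borel_measurable borel"
    and V: "V \<in> sets borel" "\<And>z. z \<in> V \<longleftrightarrow> \<sigma> z \<in> V"
    and U: "U \<in> sets borel" "U \<subseteq> V"
    and c: "c \<in> borel_measurable borel" "\<And>z. cmod (c z) \<le> 1"
    and up: "\<And>z. z \<in> U \<Longrightarrow> \<kappa> z = z \<and> \<sigma> z \<notin> U"
    and low: "\<And>z. \<sigma> z \<in> U \<Longrightarrow> \<kappa> z = \<sigma> z"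
    and rest: "\<And>z. z \<in> V \<Longrightarrow> z \<notin> U \<Longrightarrow> \<sigma> z \<notin> U \<Longrightarrow> c z = 0"
  shows "L2_adjoint U V (\<lambda>f z. c z * f (\<kappa> z)) (\<lambda>g z. cnj (c z) * g z + cnj (c (\<sigma> z)) * g (\<sigma> z))"
proof -
  note [measurable] = lborel_iso_measurable(1)[OF \<sigma>] F V(1) U(1) c(1)
  note inv = lborel_iso_inverse(1)[OF \<sigma>]
  let ?E = "\<lambda>W f z. indicator W z *\<^sub>R f z"
  \<comment> \<open>In this form \<kappa> no longer occurs: after extension by zero the two summands
    have disjoint supports, and the second is a pullback by a measure preserving map.\<close>
  have eJ: "?E V (\<lambda>z. c z * f (\<kappa> z)) z = c z * (?E U f z + ?E U f (\<sigma> z))" for f z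
  proof -
    consider "z \<in> U" | "\<sigma> z \<in> U" | "z \<in> V" "z \<notin> U" "\<sigma> z \<notin> U" | "z \<notin> V" by blast
    then show ?thesis
    proof cases
      case 1 then show ?thesis using up[of z] U(2) by auto
    next
      case 2
      moreover from this have "z \<notin> U" using up[of "\<sigma> z"] inv by auto
      moreover have "z \<in> V" using 2 U(2) V(2)[of z] by blast
      ultimately show ?thesis using low[of z] by auto
    next
      case 3 then show ?thesis using rest by auto
    next
      case 4 then have "z \<notin> U" "\<sigma> z \<notin> U" using U(2) V(2)[of z] by blast+
      with 4 show ?thesis by auto
    qed
  qed
  let ?W = "\<sigma> -` U"
  have W: "?W \<in> sets borel" using measurable_sets[OF lborel_iso_measurable(1)[OF \<sigma>] U(1)] by simp
  have eS: "?E U f (\<sigma> z) = ?E ?W (\<lambda>z. f (\<sigma> z)) z" for f z by (auto simp: indicator_def)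
  have JL: "(\<lambda>z. c z * f (\<kappa> z)) \<in> L2 V \<and> L2_norm V (\<lambda>z. c z * f (\<kappa> z)) \<le> 2 * L2_norm U f"
    if f: "f \<in> L2 U" for f
  proof -
    let ?G = "\<lambda>z. ?E U f z + ?E U f (\<sigma> z)"
    have E1: "?E U f \<in> L2 UNIV"
      using f by (simp add: L2_extend_zero U(1))
    have E2: "(\<lambda>z. ?E U f (\<sigma> z)) \<in> L2 UNIV" by (rule L2_pullback[OF \<sigma> _ _ _ E1]) auto
    have UN: "UNIV \<in> sets (borel :: plane measure)" by simp
    have n: "L2_norm UNIV (?E W f) = L2_norm W f" for W and f :: cfun
      unfolding L2_norm_def set_lebesgue_integral_def
      by (intro arg_cong[where f=sqrt] Bochner_Integration.integral_cong) (auto simp: indicator_def)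
    have G: "?G \<in> L2 UNIV" by (rule L2_add[OF UN E1 E2])
    have cG: "(\<lambda>z. c z * ?G z) \<in> L2 UNIV" by (rule L2_mult_bounded(1)[OF UN c G])
    then have 1: "(\<lambda>z. c z * f (\<kappa> z)) \<in> L2 V"
      unfolding eJ[symmetric] by (simp add: L2_extend_zero V(1))
    have "L2_norm V (\<lambda>z. c z * f (\<kappa> z)) = L2_norm UNIV (\<lambda>z. c z * ?G z)"
      unfolding eJ[symmetric] n ..
    also have "\<dots> \<le> L2_norm UNIV ?G" by (rule L2_mult_bounded(2)[OF UN c G])
    also have "\<dots> \<le> L2_norm UNIV (?E U f) + L2_norm UNIV (\<lambda>z. ?E U f (\<sigma> z))"
      by (rule L2_norm_triangle[OF UN E1 E2])
    also have "L2_norm UNIV (\<lambda>z. ?E U f (\<sigma> z)) = L2_norm UNIV (?E U f)"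
      by (rule L2_norm_pullback[OF \<sigma> _ _ _ E1]) auto
    finally have "L2_norm V (\<lambda>z. c z * f (\<kappa> z)) \<le> 2 * L2_norm U f" by (simp add: n)
    with 1 show ?thesis by simp
  qed
  have c1: "(\<lambda>z. cnj (c z)) \<in> borel_measurable borel" "\<And>z. cmod (cnj (c z)) \<le> 1" using c(2) by auto
  have c2: "(\<lambda>z. cnj (c (\<sigma> z))) \<in> borel_measurable borel" "\<And>z. cmod (cnj (c (\<sigma> z))) \<le> 1"
    using c(2) by auto
  have parts: "(\<lambda>z. cnj (c z) * g z) \<in> L2 U" "L2_norm U (\<lambda>z. cnj (c z) * g z) \<le> L2_norm V g"
    "(\<lambda>z. cnj (c (\<sigma> z)) * g (\<sigma> z)) \<in> L2 U" "L2_norm U (\<lambda>z. cnj (c (\<sigma> z)) * g (\<sigma> z)) \<le> L2_norm V g"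
    if g: "g \<in> L2 V" for g
  proof -
    have gs: "(\<lambda>z. g (\<sigma> z)) \<in> L2 V" "L2_norm V (\<lambda>z. g (\<sigma> z)) = L2_norm V g"
      using L2_pullback[OF \<sigma> V(1) V(1) V(2) g] L2_norm_pullback[OF \<sigma> V(1) V(1) V(2) g] by auto
    note s1 = L2_subset[OF U(1) V(1) U(2) g] and s2 = L2_subset[OF U(1) V(1) U(2) gs(1)]
    show "(\<lambda>z. cnj (c z) * g z) \<in> L2 U" by (rule L2_mult_bounded(1)[OF U(1) c1 s1(1)])
    show "(\<lambda>z. cnj (c (\<sigma> z)) * g (\<sigma> z)) \<in> L2 U" by (rule L2_mult_bounded(1)[OF U(1) c2 s2(1)])
    show "L2_norm U (\<lambda>z. cnj (c z) * g z) \<le> L2_norm V g"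
      using L2_mult_bounded(2)[OF U(1) c1 s1(1)] s1(2) by linarith
    show "L2_norm U (\<lambda>z. cnj (c (\<sigma> z)) * g (\<sigma> z)) \<le> L2_norm V g"
      using L2_mult_bounded(2)[OF U(1) c2 s2(1)] s2(2) gs(2) by linarith
  qed
  have K: "(\<lambda>z. cnj (c z) * g z + cnj (c (\<sigma> z)) * g (\<sigma> z)) \<in> L2 U \<and>
    L2_norm U (\<lambda>z. cnj (c z) * g z + cnj (c (\<sigma> z)) * g (\<sigma> z)) \<le> 2 * L2_norm V g" if g: "g \<in> L2 V" for g
    using L2_add[OF U(1) parts(1,3)[OF g]] L2_norm_triangle[OF U(1) parts(1,3)[OF g]] parts(2,4)[OF g] by simp
  have inner: "L2_inner V (\<lambda>z. c z * f (\<kappa> z)) g =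
      L2_inner U f (\<lambda>z. cnj (c z) * g z + cnj (c (\<sigma> z)) * g (\<sigma> z))"
    if f: "f \<in> L2 U" and g: "g \<in> L2 V" for f g
  proof -
    have [measurable]: "?E U f \<in> borel_measurable borel" "?E V g \<in> borel_measurable borel"
      using f g by (auto simp: L2_extend_zero U(1) V(1))
    let ?A = "\<lambda>z. c z * ?E U f z * cnj (?E V g z)" and ?B = "\<lambda>z. c z * ?E U f (\<sigma> z) * cnj (?E V g z)"
    let ?B' = "\<lambda>z. c (\<sigma> z) * ?E U f z * cnj (?E V g (\<sigma> z))"
    have eA: "?A z = ?E U f z * cnj (?E U (\<lambda>z. cnj (c z) * g z) z)" for z
      using U(2) by (auto simp: indicator_def)
    have eB: "?B' z = ?E U f z * cnj (?E U (\<lambda>z. cnj (c (\<sigma> z)) * g (\<sigma> z)) z)" for z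
      using U(2) V(2)[of z] by (auto simp: indicator_def)
    have ii: "integrable lborel (\<lambda>z. ?E U f z * cnj (?E U h z))" if "h \<in> L2 U" for h
    proof -
      have "integrable lborel (\<lambda>z. indicator U z *\<^sub>R (f z * cnj (h z)))"
        using L2_integrable_mult[OF U(1) f that] U(1) by (simp add: integrable_restrict_space)
      moreover have "indicator U z *\<^sub>R (f z * cnj (h z)) = ?E U f z * cnj (?E U h z)" for z
        by (simp add: indicator_def)
      ultimately show ?thesis by (simp only:)
    qed
    have iA: "integrable lborel ?A" unfolding eA by (rule ii[OF parts(1)[OF g]])
    have iB': "integrable lborel ?B'" unfolding eB by (rule ii[OF parts(3)[OF g]])
    \<comment> \<open>The substitution by \<sigma> brings the integral over the mirror image of U
      back to U.\<close>
    have BB: "?B z = ?B' (\<sigma> z)" for z by (simp add: inv)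
    have iB: "integrable lborel ?B" unfolding BB by (rule lborel_iso_integrable[OF \<sigma> iB'])
    have "L2_inner V (\<lambda>z. c z * f (\<kappa> z)) g = (\<integral>z. ?A z + ?B z \<partial>lborel)"
      unfolding L2_inner_extend_zero eJ by (simp add: algebra_simps)
    also have "\<dots> = (\<integral>z. ?A z \<partial>lborel) + (\<integral>z. ?B z \<partial>lborel)" by (rule Bochner_Integration.integral_add[OF iA iB])
    also have "(\<integral>z. ?B z \<partial>lborel) = (\<integral>z. ?B' z \<partial>lborel)"
      unfolding BB using iB' by (intro lborel_iso_integral[OF \<sigma>]) (auto dest: borel_measurable_integrable)
    also have "(\<integral>z. ?A z \<partial>lborel) = L2_inner U f (\<lambda>z. cnj (c z) * g z)"
      unfolding eA L2_inner_extend_zero ..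
    also have "(\<integral>z. ?B' z \<partial>lborel) = L2_inner U f (\<lambda>z. cnj (c (\<sigma> z)) * g (\<sigma> z))"
      unfolding eB L2_inner_extend_zero ..
    finally show ?thesis using L2_inner_add_right[OF U(1) parts(1,3)[OF g] f] by simp
  qed
  show ?thesis
    unfolding L2_adjoint_def
    by (intro conjI ballI allI exI[of _ 2]) (use U(1) V(1) JL K inner in \<open>auto simp: algebra_simps\<close>)
qed

section \<open>Reflections and the exchange of coordinates preserve Lebesgue measure\<close>

lemma lborel_iso_linear_scale:
  assumes "a \<in> {-1, 1}" "b \<in> {-1, 1}"
  shows "lborel_iso (\<lambda>(x, y). (a * x, b * y)) (\<lambda>(x, y). (a * x, b * y))"
proof -
  define c where "c j = (if j = (1, 0) then a else b)" for j :: plane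
  have B: "(Basis :: plane set) = {(1, 0), (0, 1)}" by (auto simp: Basis_prod_def)
  have T: "(\<lambda>z::plane. (\<Sum>j\<in>Basis. (c j * (z \<bullet> j)) *\<^sub>R j)) = (\<lambda>(x, y). (a * x, b * y))"
    by (auto simp: B c_def zero_prod_def)
  have p: "(\<Prod>j\<in>Basis. \<bar>c j\<bar>) = 1" using assms by (auto simp: B c_def)
  have "(lborel :: plane measure) = density (distr lborel borel (\<lambda>z. 0 + (\<Sum>j\<in>Basis. (c j * (z \<bullet> j)) *\<^sub>R j)))
      (\<lambda>_. ennreal (\<Prod>j\<in>Basis. \<bar>c j\<bar>))"
    by (rule lborel_affine_euclidean) (use assms in \<open>auto simp: c_def\<close>)
  then have "distr lborel borel (\<lambda>(x, y). (a * x, b * y)) = (lborel :: plane measure)"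
    by (simp add: T p density_1)
  then show ?thesis using assms
    by (auto simp: lborel_iso_def split_beta intro!: continuous_intros)
qed

lemma lborel_iso_swap: "lborel_iso (\<lambda>(x, y). (y, x)) (\<lambda>(x, y). (y, x))"
proof -
  have "distr lborel borel (\<lambda>(x, y). (y, x)) = distr lborel lborel (\<lambda>(x, y). (y, x) :: plane)"
    by (rule distr_cong) auto
  then have "distr lborel borel (\<lambda>(x, y). (y, x)) = (lborel :: plane measure)"
    using lborel_pair.distr_pair_swap[where ?'a=real and ?'b=real] 
    by (simp add: lborel_prod)
  then show ?thesis by (auto simp: lborel_iso_def split_beta intro!: continuous_intros)
qed

lemma lborel_iso_compose:
  assumes a: "lborel_iso \<rho> \<rho>'" and b: "lborel_iso \<tau> \<tau>'"
  shows "lborel_iso (\<lambda>z. \<rho> (\<tau> z)) (\<lambda>z. \<tau>' (\<rho>' z))"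
proof -
  note [measurable] = lborel_iso_measurable[OF a] lborel_iso_measurable[OF b]
  have "distr (distr lborel borel \<tau>) borel \<rho> = distr lborel borel (\<rho> \<circ> \<tau>)"
    by (rule distr_distr) auto
  moreover have "\<rho> \<circ> \<tau> = (\<lambda>z. \<rho> (\<tau> z))" by auto
  moreover have "continuous_on UNIV (\<lambda>z. \<rho> (\<tau> z))" "continuous_on UNIV (\<lambda>z. \<tau>' (\<rho>' z))"
    using a b unfolding lborel_iso_def by (blast intro: continuous_on_compose2)+
  ultimately show ?thesis using a b lborel_iso_inverse[OF a] lborel_iso_inverse[OF b]
    unfolding lborel_iso_def by (simp del: split_paired_All)
qed

section \<open>Test functions\<close>

lemma dirderiv_eqI: "(f has_derivative f') (at z) \<Longrightarrow> dirderiv e f z = f' e"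
  by (metis frechet_derivative_at)

lemma smooth_has_derivative:
  "smooth f \<Longrightarrow> (f has_derivative (\<lambda>e. dirderiv e f z)) (at z)"
  using smooth_on_differentiable[of UNIV f z] by (simp add: smooth_on_UNIV frechet_derivative_works)

lemma smooth_differentiable: "smooth f \<Longrightarrow> f differentiable at z"
  using smooth_on_differentiable[of UNIV f z] by (simp add: smooth_on_UNIV)

lemma smooth_dirderiv: "smooth f \<Longrightarrow> smooth (dirderiv e f)"
  using smooth_on_dirderiv[of UNIV f e] by (simp add: smooth_on_UNIV)

lemma dirderiv_mult:
  fixes f g :: "'a::real_normed_vector \<Rightarrow> complex"
  assumes "f differentiable at z" "g differentiable at z"
  shows "dirderiv e (\<lambda>z. f z * g z) z = f z * dirderiv e g z + dirderiv e f z * g z"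
  using assms by (intro dirderiv_eqI has_derivative_mult) (auto simp: frechet_derivative_works)

lemma dirderiv_diff:
  assumes "f differentiable at z" "g differentiable at z"
  shows "dirderiv e (\<lambda>z. f z - g z) z = dirderiv e f z - dirderiv e g z"
  using assms by (intro dirderiv_eqI has_derivative_diff) (auto simp: frechet_derivative_works)

lemma dirderiv_add:
  assumes "f differentiable at z" "g differentiable at z"
  shows "dirderiv e (\<lambda>z. f z + g z) z = dirderiv e f z + dirderiv e g z"
  using assms by (intro dirderiv_eqI has_derivative_add) (auto simp: frechet_derivative_works)

lemma dirderiv_cmult:
  fixes f :: "'a::real_normed_vector \<Rightarrow> complex"
  assumes "f differentiable at z"
  shows "dirderiv e (\<lambda>z. c * f z) z = c * dirderiv e f z"
  using assms by (intro dirderiv_eqI has_derivative_mult_right) (auto simp: frechet_derivative_works)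

lemma dirderiv_cnj:
  assumes "f differentiable at z"
  shows "dirderiv e (\<lambda>z. cnj (f z)) z = cnj (dirderiv e f z)"
  using assms by (intro dirderiv_eqI has_derivative_cnj) (auto simp: frechet_derivative_works)

lemma dirderiv_cong:
  assumes "open W" "z \<in> W" "\<And>x. x \<in> W \<Longrightarrow> f x = g x" "f differentiable at z"
  shows "dirderiv e f z = dirderiv e g z"
  using frechet_derivative_transform_within_open[OF assms(4,1,2,3)] by simp

lemma smooth_mult: "smooth f \<Longrightarrow> smooth g \<Longrightarrow> smooth (\<lambda>z. f z * g z :: complex)"
  using smooth_on_mult[of UNIV f g] by (simp add: smooth_on_UNIV)

lemma smooth_diff: "smooth f \<Longrightarrow> smooth g \<Longrightarrow> smooth (\<lambda>z. f z - g z :: complex)"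
  using smooth_on_diff[of UNIV f g] by (simp add: smooth_on_UNIV)

lemma smooth_cnj: "smooth f \<Longrightarrow> smooth (\<lambda>z. cnj (f z))"
  using smooth_on_linear_compose[OF _ bounded_linear_cnj, of UNIV f] by (simp add: smooth_on_UNIV)

lemma smooth_const: "smooth (\<lambda>z. c)"
  using smooth_on_const[of UNIV c] by (simp add: smooth_on_UNIV)

text \<open>Any compact set outside which \<phi> vanishes will do, so the supports of products,
  differences and derivatives need not be determined exactly.\<close>

lemma test_functions_iff:
  "\<phi> \<in> test_functions U \<longleftrightarrow> smooth \<phi> \<and> (\<exists>S. compact S \<and> S \<subseteq> U \<and> (\<forall>z. z \<notin> S \<longrightarrow> \<phi> z = 0))"
proof
  assume "\<phi> \<in> test_functions U"
  then have "smooth \<phi>" "compact (closure {z. \<phi> z \<noteq> 0})" "closure {z. \<phi> z \<noteq> 0} \<subseteq> U"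
    by (auto simp: test_functions_def)
  moreover have "z \<notin> closure {z. \<phi> z \<noteq> 0} \<Longrightarrow> \<phi> z = 0" for z
    using closure_subset[of "{z. \<phi> z \<noteq> 0}"] by blast
  ultimately show "smooth \<phi> \<and> (\<exists>S. compact S \<and> S \<subseteq> U \<and> (\<forall>z. z \<notin> S \<longrightarrow> \<phi> z = 0))" by blast
next
  assume "smooth \<phi> \<and> (\<exists>S. compact S \<and> S \<subseteq> U \<and> (\<forall>z. z \<notin> S \<longrightarrow> \<phi> z = 0))"
  then obtain S where S: "smooth \<phi>" "compact S" "S \<subseteq> U" "\<forall>z. z \<notin> S \<longrightarrow> \<phi> z = 0" by blast
  have "closure {z. \<phi> z \<noteq> 0} \<subseteq> S"
    using S(2,4) by (intro closure_minimal compact_imp_closed) auto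
  moreover from this have "compact (closure {z. \<phi> z \<noteq> 0})"
    using compact_Int_closed[OF S(2) closed_closure] by (metis inf.absorb2)
  ultimately show "\<phi> \<in> test_functions U"
    using S(1,3) unfolding test_functions_def by blast
qed

lemma test_functionsE:
  assumes "\<phi> \<in> test_functions U"
  obtains S where "smooth \<phi>" "compact S" "S \<subseteq> U" "\<And>z. z \<notin> S \<Longrightarrow> \<phi> z = 0"
  using assms unfolding test_functions_iff by blast

lemma test_functions_smooth: "\<phi> \<in> test_functions U \<Longrightarrow> smooth \<phi>"
  by (simp add: test_functions_def)

lemma test_functions_outside: "\<phi> \<in> test_functions U \<Longrightarrow> z \<notin> U \<Longrightarrow> \<phi> z = 0"
  unfolding test_functions_iff by blast

lemma test_functionsI:
  "smooth \<phi> \<Longrightarrow> compact S \<Longrightarrow> S \<subseteq> U \<Longrightarrow> (\<And>z. z \<notin> S \<Longrightarrow> \<phi> z = 0) \<Longrightarrow> \<phi> \<in> test_functions U"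
  unfolding test_functions_iff by blast

lemma test_functions_mult:
  assumes "\<phi> \<in> test_functions U" "smooth f"
  shows "(\<lambda>z. f z * \<phi> z) \<in> test_functions U"
proof -
  obtain S where S: "smooth \<phi>" "compact S" "S \<subseteq> U" "\<And>z. z \<notin> S \<Longrightarrow> \<phi> z = 0"
    using test_functionsE[OF assms(1)] by blast
  show ?thesis by (rule test_functionsI[OF smooth_mult[OF assms(2) S(1)] S(2,3)]) (simp add: S(4))
qed

lemma test_functions_diff:
  assumes "\<phi> \<in> test_functions U" "\<psi> \<in> test_functions U"
  shows "(\<lambda>z. \<phi> z - \<psi> z) \<in> test_functions U"
proof -
  obtain S where S: "smooth \<phi>" "compact S" "S \<subseteq> U" "\<And>z. z \<notin> S \<Longrightarrow> \<phi> z = 0"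
    using test_functionsE[OF assms(1)] by blast
  obtain T where T: "smooth \<psi>" "compact T" "T \<subseteq> U" "\<And>z. z \<notin> T \<Longrightarrow> \<psi> z = 0"
    using test_functionsE[OF assms(2)] by blast
  show ?thesis by (rule test_functionsI[OF smooth_diff[OF S(1) T(1)] compact_Un[OF S(2) T(2)]]) (use S T in auto)
qed

lemma test_functions_cnj:
  assumes "\<phi> \<in> test_functions U"
  shows "(\<lambda>z. cnj (\<phi> z)) \<in> test_functions U"
proof -
  obtain S where S: "smooth \<phi>" "compact S" "S \<subseteq> U" "\<And>z. z \<notin> S \<Longrightarrow> \<phi> z = 0"
    using test_functionsE[OF assms(1)] by blast
  show ?thesis by (rule test_functionsI[OF smooth_cnj[OF S(1)] S(2,3)]) (simp add: S(4))
qed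

lemma dirderiv_eq_0:
  fixes f :: "'a::real_normed_vector \<Rightarrow> 'b::real_normed_vector"
  assumes "closed S" "\<And>z. z \<notin> S \<Longrightarrow> f z = 0" "z \<notin> S"
  shows "dirderiv e f z = 0"
proof -
  have "dirderiv e (\<lambda>z. 0 :: 'b) z = dirderiv e f z"
    by (rule dirderiv_cong[of "- S"]) (use assms in auto)
  then show ?thesis by simp
qed

lemma test_functions_dirderiv:
  assumes "\<phi> \<in> test_functions U"
  shows "dirderiv e \<phi> \<in> test_functions U"
proof -
  obtain S where S: "smooth \<phi>" "compact S" "S \<subseteq> U" "\<And>z. z \<notin> S \<Longrightarrow> \<phi> z = 0"
    using test_functionsE[OF assms(1)] by blast
  show ?thesis
    by (rule test_functionsI[OF smooth_dirderiv[OF S(1)] S(2,3)])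
       (rule dirderiv_eq_0[OF compact_imp_closed[OF S(2)] S(4)])
qed

lemma test_functions_L2: "U \<in> sets borel \<Longrightarrow> bounded U \<Longrightarrow> \<phi> \<in> test_functions V \<Longrightarrow> \<phi> \<in> L2 U"
  by (rule smooth_imp_L2) (auto dest: test_functions_smooth)

lemma test_functions_integrable:
  assumes "\<phi> \<in> test_functions U"
  shows "integrable lborel \<phi>"
proof -
  obtain S where S: "smooth \<phi>" "compact S" "S \<subseteq> U" "\<And>z. z \<notin> S \<Longrightarrow> \<phi> z = 0"
    using test_functionsE[OF assms(1)] by blast
  have "integrable lborel (\<lambda>z. indicator S z *\<^sub>R \<phi> z)"
    by (rule borel_integrable_compact[OF S(2) smooth_continuous[OF S(1)]])
  also have "(\<lambda>z. indicator S z *\<^sub>R \<phi> z) = \<phi>" using S(4) by (auto simp: indicator_def)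
  finally show ?thesis .
qed

section \<open>Integrals of derivatives of test functions\<close>

lemma line_integral_derivative_eq_0:
  fixes f :: "real \<Rightarrow> complex"
  assumes d: "\<And>t. (f has_vector_derivative f' t) (at t)" and c: "continuous_on UNIV f'"
    and z: "\<And>t. \<bar>t\<bar> \<ge> M \<Longrightarrow> f t = 0 \<and> f' t = 0" and M: "M > 0"
  shows "(\<integral>t. f' t \<partial>lborel) = 0"
proof -
  have "f' t = indicator {-M..M} t *\<^sub>R f' t" for t
    using z[of t] by (cases "\<bar>t\<bar> \<ge> M") (auto simp: indicator_def)
  then have "(\<integral>t. f' t \<partial>lborel) = (\<integral>t. indicator {-M..M} t *\<^sub>R f' t \<partial>lborel)" by simp
  also have "\<dots> = f M - f (-M)"
    by (rule integral_FTC_atLeastAtMost)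
       (use d c M in \<open>auto intro: has_vector_derivative_at_within continuous_on_subset\<close>)
  also have "\<dots> = 0" using z[of M] z[of "-M"] M by simp
  finally show ?thesis .
qed

lemma smooth_has_vector_derivative_line:
  assumes "smooth f" "(p has_derivative (\<lambda>h. h *\<^sub>R e)) (at t)"
  shows "((\<lambda>t::real. f (p t)) has_vector_derivative dirderiv e f (p t)) (at t)"
proof -
  have b: "bounded_linear (\<lambda>e. dirderiv e f (p t))"
    using smooth_has_derivative[OF assms(1)] by (rule has_derivative_bounded_linear)
  have "((\<lambda>t. f (p t)) has_derivative (\<lambda>h. dirderiv (h *\<^sub>R e) f (p t))) (at t)"
    by (rule has_derivative_compose[OF assms(2) smooth_has_derivative[OF assms(1)]])
  then show ?thesis unfolding has_vector_derivative_def linear_simps(5)[OF b] .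
qed

text \<open>By Fubini the integral is computed along lines in direction e, and on each of them the
  derivative of a compactly supported function integrates to 0.\<close>

lemma test_functions_integral_dirderiv:
  assumes \<phi>: "\<phi> \<in> test_functions U" and e: "e \<in> {(1, 0), (0, 1)}"
  shows "(\<integral>z. dirderiv e \<phi> z \<partial>lborel) = 0"
proof -
  obtain S where S: "smooth \<phi>" "compact S" "S \<subseteq> U" "\<And>z. z \<notin> S \<Longrightarrow> \<phi> z = 0"
    using test_functionsE[OF \<phi>] by blast
  obtain B where B: "\<And>z. z \<in> S \<Longrightarrow> norm z \<le> B" using compact_imp_bounded[OF S(2)] by (auto simp: bounded_iff)
  \<comment> \<open>M exceeds all norms in S strictly, so the boundary values at M and -M vanish
    too.\<close>
  define M where "M = max B 0 + 1"
  have M: "M > 0" by (simp add: M_def)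
  have out: "(x, y) \<notin> S" if "\<bar>x\<bar> \<ge> M \<or> \<bar>y\<bar> \<ge> M" for x y
  proof
    assume "(x, y) \<in> S"
    from B[OF this] that norm_fst_le[of x y] norm_snd_le[of y x] show False by (auto simp: M_def)
  qed
  have d0: "dirderiv e \<phi> z = 0" if "z \<notin> S" for z by (rule dirderiv_eq_0[OF compact_imp_closed[OF S(2)] S(4) that])
  have i: "integrable (lborel \<Otimes>\<^sub>M lborel) (\<lambda>(x, y). dirderiv e \<phi> (x, y))"
    using test_functions_integrable[OF test_functions_dirderiv[OF \<phi>]] by (simp add: lborel_prod case_prod_unfold)
  have cont: "continuous_on UNIV (dirderiv e \<phi>)" by (rule smooth_continuous[OF smooth_dirderiv[OF S(1)]])
  note der = smooth_has_vector_derivative_line[OF S(1)]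
  have split: "(\<integral>z. dirderiv e \<phi> z \<partial>lborel) = (\<integral>z. (\<lambda>(x, y). dirderiv e \<phi> (x, y)) z \<partial>(lborel \<Otimes>\<^sub>M lborel))"
    by (simp add: lborel_prod case_prod_unfold)
  show ?thesis
  proof (cases "e = (1, 0)")
    case True
    have "(\<integral>x. dirderiv e \<phi> (x, y) \<partial>lborel) = 0" for y
    proof (rule line_integral_derivative_eq_0[where f="\<lambda>t. \<phi> (t, y)", OF _ _ _ M])
      show "((\<lambda>t. \<phi> (t, y)) has_vector_derivative dirderiv e \<phi> (t, y)) (at t)" for t
        by (rule der) (auto intro!: derivative_eq_intros simp: True)
      show "continuous_on UNIV (\<lambda>x. dirderiv e \<phi> (x, y))"
        by (rule continuous_on_compose2[OF cont]) (auto intro!: continuous_intros)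
      show "\<phi> (t, y) = 0 \<and> dirderiv e \<phi> (t, y) = 0" if "M \<le> \<bar>t\<bar>" for t
        using out[of t y] that S(4) d0 by blast
    qed
    then show ?thesis unfolding split lborel_pair.integral_snd[OF i, symmetric] by simp
  next
    case False
    then have e01: "e = (0, 1)" using e by auto
    have "(\<integral>y. dirderiv e \<phi> (x, y) \<partial>lborel) = 0" for x
    proof (rule line_integral_derivative_eq_0[where f="\<lambda>t. \<phi> (x, t)", OF _ _ _ M])
      show "((\<lambda>t. \<phi> (x, t)) has_vector_derivative dirderiv e \<phi> (x, t)) (at t)" for t
        by (rule der) (auto intro!: derivative_eq_intros simp: e01)
      show "continuous_on UNIV (\<lambda>y. dirderiv e \<phi> (x, y))"
        by (rule continuous_on_compose2[OF cont]) (auto intro!: continuous_intros)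
      show "\<phi> (x, t) = 0 \<and> dirderiv e \<phi> (x, t) = 0" if "M \<le> \<bar>t\<bar>" for t
        using out[of x t] that S(4) d0 by blast
    qed
    then show ?thesis unfolding split lborel_pair.integral_fst[OF i, symmetric] by simp
  qed
qed

lemma set_integral_test_function:
  assumes "\<phi> \<in> test_functions U"
  shows "(LINT z:U|lborel. \<phi> z) = (\<integral>z. \<phi> z \<partial>lborel)"
  unfolding set_lebesgue_integral_def
  using test_functions_outside[OF assms]
  by (intro Bochner_Integration.integral_cong) (auto simp: indicator_def)

section \<open>The fundamental lemma of the calculus of variations\<close>

lemma step_ramp_tendsto: "(\<lambda>n. step (1 + real n * t)) \<longlonglongrightarrow> indicator {0<..} t"
proof (cases "t > 0")
  case True
  obtain N :: nat where N: "1 / t < real N" using reals_Archimedean2 by blast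
  have "step (1 + real n * t) = 1" if "n \<ge> N" for n
  proof (rule step_ge)
    have "1 / t \<le> real n" using N that by linarith
    then show "2 \<le> 1 + real n * t" using True by (simp add: field_simps)
  qed
  then show ?thesis using True
    by (intro tendsto_eventually) (auto simp: eventually_sequentially)
next
  case False
  \<comment> \<open>The offset 1 is the last point where \<open>step\<close> is still 0; with it the
    limit is exactly the indicator of the open half line, also at t = 0.\<close>
  then have "step (1 + real n * t) = 0" for n by (intro step_le) (auto simp: mult_nonneg_nonpos)
  with False show ?thesis by simp
qed

lemma smooth_on_step_compose:
  "open S \<Longrightarrow> smooth_on S g \<Longrightarrow> smooth_on S (\<lambda>x. step (g x))"
  by (rule smooth_on_compose[where f=step and T=UNIV]) (auto simp: smooth_step smooth_on_UNIV)

lemma smooth_step_affine: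
  assumes "bounded_linear L"
  shows "smooth (\<lambda>z::plane. step (c + r * (L z - d)))"
proof -
  have "smooth_on UNIV (\<lambda>z. c + r * (L z - d))"
    by (intro smooth_on_add smooth_on_mult smooth_on_diff smooth_on_const open_UNIV
        smooth_on_bounded_linear assms)
  then have "smooth_on UNIV (\<lambda>z. step (c + r * (L z - d)))"
    by (rule smooth_on_step_compose[OF open_UNIV])
  then show ?thesis by (simp add: smooth_on_UNIV)
qed

lemma integral_smooth_eq_0_imp_AE:
  fixes F :: cfun
  assumes F: "integrable lborel F" and z: "\<And>\<psi> :: plane \<Rightarrow> real. smooth \<psi> \<Longrightarrow> (\<integral>z. \<psi> z *\<^sub>R F z \<partial>lborel) = 0"
  shows "AE z in lborel. F z = 0"
proof -
  note [measurable] = borel_measurable_integrable[OF F]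
  have box: "(\<integral>z. indicator (box (a1, a2) (b1, b2)) z *\<^sub>R F z \<partial>lborel) = 0" for a1 a2 b1 b2
  proof -
    \<comment> \<open>One ramp for each side of the box; the negated coordinates express the upper
      bounds as lower ones.\<close>
    define \<psi> :: "nat \<Rightarrow> plane \<Rightarrow> real" where "\<psi> n z = step (1 + real n * (fst z - a1)) * step (1 + real n * (snd z - a2)) *
       (step (1 + real n * ((- fst z) - (- b1))) * step (1 + real n * ((- snd z) - (- b2))))" for n z
    have sm: "smooth (\<psi> n)" for n
      unfolding \<psi>_def[abs_def]
      using smooth_step_affine[OF bounded_linear_fst] smooth_step_affine[OF bounded_linear_snd]
        smooth_step_affine[OF bounded_linear_minus[OF bounded_linear_fst]]
        smooth_step_affine[OF bounded_linear_minus[OF bounded_linear_snd]]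
      unfolding smooth_on_UNIV[symmetric]
      by (intro smooth_on_mult open_UNIV)
    from sm have 0: "(\<integral>z. \<psi> n z *\<^sub>R F z \<partial>lborel) = 0" for n by (rule z)
    have cont: "continuous_on UNIV (\<psi> n)" for n by (rule smooth_continuous[OF sm])
    then have [measurable]: "\<psi> n \<in> borel_measurable borel" for n by (rule borel_measurable_continuous_onI)
    have ab: "\<bar>\<psi> n z\<bar> \<le> 1" for n z
      unfolding \<psi>_def by (auto simp: abs_mult step_nonneg intro!: mult_le_one step_le_1 mult_nonneg_nonneg)
    have lim: "(\<lambda>n. \<psi> n z) \<longlonglongrightarrow> indicator (box (a1, a2) (b1, b2)) z" for z
    proof -
      have "(\<lambda>n. \<psi> n z) \<longlonglongrightarrow> indicator {0<..} (fst z - a1) * indicator {0<..} (snd z - a2) *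
        (indicator {0<..} ((- fst z) - (- b1)) * indicator {0<..} ((- snd z) - (- b2)))"
        unfolding \<psi>_def by (intro tendsto_mult step_ramp_tendsto)
      moreover have "indicator {0<..} (fst z - a1) * indicator {0<..} (snd z - a2) *
        (indicator {0<..} ((- fst z) - (- b1)) * indicator {0<..} ((- snd z) - (- b2))) =
        (indicator (box (a1, a2) (b1, b2)) z :: real)"
        by (cases z) (auto simp: indicator_def box_def Basis_prod_def)
      ultimately show ?thesis by simp
    qed
    have "(\<lambda>n. \<integral>z. \<psi> n z *\<^sub>R F z \<partial>lborel) \<longlonglongrightarrow> (\<integral>z. indicator (box (a1, a2) (b1, b2)) z *\<^sub>R F z \<partial>lborel)"
    proof (rule integral_dominated_convergence[where w="\<lambda>z. norm (F z)"])
      show "AE z in lborel. (\<lambda>n. \<psi> n z *\<^sub>R F z) \<longlonglongrightarrow> indicator (box (a1, a2) (b1, b2)) z *\<^sub>R F z"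
        by (intro AE_I2 tendsto_scaleR lim tendsto_const)
      show "AE z in lborel. norm (\<psi> n z *\<^sub>R F z) \<le> norm (F z)" for n
        using mult_right_mono[OF ab norm_ge_zero] by (intro AE_I2) simp
    qed (use F in auto)
    then show ?thesis by (simp add: 0 LIMSEQ_const_iff)
  qed
  have int: "integrable lborel (\<lambda>z. indicator A z *\<^sub>R F z)" if "A \<in> sets borel" for A
    using integrable_mult_indicator[OF _ F, of A] that by simp
  have sets: "(\<integral>z. indicator A z *\<^sub>R F z \<partial>lborel) = 0" if A: "A \<in> sets borel" for A
  proof -
    have "Int_stable (range (\<lambda>(a, b). box a b :: plane set))" by (auto simp: Int_stable_def box_Int_box)
    moreover have "range (\<lambda>(a, b). box a b :: plane set) \<subseteq> Pow UNIV" by auto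
    moreover have "A \<in> sigma_sets UNIV (range (\<lambda>(a, b). box a b))" using A unfolding borel_eq_box by simp
    ultimately show ?thesis
    proof (induction rule: sigma_sets_induct_disjoint)
      case (basic A)
      then show ?case using box by auto
    next
      case empty
      then show ?case by simp
    next
      case (compl A)
      then have A: "A \<in> sets borel" by (simp add: borel_eq_box)
      have "(\<integral>z. indicator (UNIV - A) z *\<^sub>R F z \<partial>lborel) = (\<integral>z. F z - indicator A z *\<^sub>R F z \<partial>lborel)"
        by (intro Bochner_Integration.integral_cong) (auto simp: indicator_def)
      also have "\<dots> = (\<integral>z. F z \<partial>lborel) - (\<integral>z. indicator A z *\<^sub>R F z \<partial>lborel)"
        by (rule Bochner_Integration.integral_diff[OF F int[OF A]])
      also have "\<dots> = 0" using compl z[OF smooth_const, of 1] by simp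
      finally show ?case .
    next
      case (union G)
      then have G: "G i \<in> sets borel" for i by (auto simp: borel_eq_box)
      have "set_lebesgue_integral lborel (\<Union>(range G)) F = (\<Sum>i. set_lebesgue_integral lborel (G i) F)"
      proof (rule lebesgue_integral_countable_add)
        show "set_integrable lborel (\<Union>(range G)) F" unfolding set_integrable_def by (rule int) (use G in auto)
      qed (use union(1) G in \<open>auto simp: disjoint_family_on_def\<close>)
      then show ?case using union by (simp add: set_lebesgue_integral_def)
    qed
  qed
  show ?thesis
    by (rule sigma_finite_measure.density_unique_banach[OF sigma_finite_lborel F, of "\<lambda>_. 0", simplified])
       (auto simp: set_lebesgue_integral_def sets)
qed

lemma exists_bump:
  assumes "open U" "p \<in> U"
  obtains \<eta> :: "plane \<Rightarrow> complex" where "\<eta> \<in> test_functions U" "\<eta> p \<noteq> 0"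
proof -
  obtain r where r: "r > 0" "cball p r \<subseteq> U" using assms open_contains_cball by blast
  define Q where "Q z = ((z - p) \<bullet> (z - p))" for z :: plane
  have s: "smooth_on UNIV (\<lambda>z::plane. z - p)"
    by (intro smooth_on_diff smooth_on_const smooth_on_bounded_linear open_UNIV bounded_linear_ident)
  \<comment> \<open>The argument of \<open>step\<close> is 3 at p and at most 1 at distance r or
    more from p, which gives the values 1 and 0.\<close>
  have "smooth_on UNIV (\<lambda>z. 3 + (- 2 / r\<^sup>2) * Q z)"
    unfolding Q_def
    by (intro smooth_on_add smooth_on_mult smooth_on_const open_UNIV smooth_on_bilinear[OF bounded_bilinear_inner] s)
  then have "smooth_on UNIV (\<lambda>z. step (3 + (- 2 / r\<^sup>2) * Q z))"
    by (rule smooth_on_step_compose[OF open_UNIV])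
  then have "smooth_on UNIV (\<lambda>z. complex_of_real (step (3 + (- 2 / r\<^sup>2) * Q z)))"
    by (rule smooth_on_linear_compose[OF open_UNIV bounded_linear_of_real])
  then have sm: "smooth (\<lambda>z. complex_of_real (step (3 + (- 2 / r\<^sup>2) * Q z)))" by (simp add: smooth_on_UNIV)
  show thesis
  proof (rule that[OF test_functionsI[OF sm compact_cball r(2)]])
    fix z assume "z \<notin> cball p r"
    then have "r < norm (z - p)" by (simp add: dist_norm norm_minus_commute)
    then have "r\<^sup>2 \<le> Q z" using r(1) by (simp add: Q_def dot_square_norm power_mono)
    then have "3 + (- 2 / r\<^sup>2) * Q z \<le> 1" using r(1) by (simp add: field_simps)
    then show "complex_of_real (step (3 + (- 2 / r\<^sup>2) * Q z)) = 0" by (simp add: step_le)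
  next
    show "complex_of_real (step (3 + (- 2 / r\<^sup>2) * Q p)) \<noteq> 0" by (simp add: Q_def step_ge)
  qed
qed

text \<open>For a fixed test function \<eta> the product of g and \<eta> is integrable and
  orthogonal to every smooth \<psi>, since the product of \<psi> and \<eta> is again a test
  function. So g vanishes almost everywhere where \<eta> is nonzero.\<close>

lemma test_functions_orthogonal_imp_AE:
  assumes U: "open U" "bounded U" and g: "g \<in> L2 U"
    and z: "\<And>\<phi>. \<phi> \<in> test_functions U \<Longrightarrow> (LINT z:U|lborel. g z * \<phi> z) = 0"
  shows "AE z in lborel. z \<in> U \<longrightarrow> g z = 0"
proof -
  have Ub: "U \<in> sets borel" using U by simp
  have one: "AE z in lborel. z \<in> U \<longrightarrow> g z * \<eta> z = 0" if \<eta>: "\<eta> \<in> test_functions U" for \<eta>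
  proof -
    let ?F = "\<lambda>z. indicator U z *\<^sub>R (g z * \<eta> z)"
    have "AE z in lborel. ?F z = 0"
    proof (rule integral_smooth_eq_0_imp_AE)
      show "integrable lborel ?F"
        using L2_integrable_mult[OF Ub g test_functions_L2[OF Ub U(2) test_functions_cnj[OF \<eta>]]] Ub
        by (simp add: integrable_restrict_space)
      fix \<psi> :: "plane \<Rightarrow> real" assume "smooth \<psi>"
      then have "smooth (\<lambda>z. complex_of_real (\<psi> z))"
        using smooth_on_linear_compose[OF open_UNIV bounded_linear_of_real, of \<psi>] by (simp add: smooth_on_UNIV)
      from z[OF test_functions_mult[OF \<eta> this]]
      show "(\<integral>z. \<psi> z *\<^sub>R ?F z \<partial>lborel) = 0"
        by (simp add: set_lebesgue_integral_def scaleR_conv_of_real mult_ac)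
    qed
    then show ?thesis by eventually_elim (auto simp: indicator_def)
  qed
  \<comment> \<open>The sets where some test function is nonzero cover U; by Lindelof countably many
    suffice, so the exceptional null sets add up to a null set.\<close>
  let ?FF = "(\<lambda>\<eta>. {z. \<eta> z \<noteq> 0}) ` test_functions U"
  have "open {z. \<eta> z \<noteq> 0}" if "\<eta> \<in> test_functions U" for \<eta>
    using smooth_continuous[OF test_functions_smooth[OF that]] by (intro open_Collect_neq) auto
  then obtain F' where F': "F' \<subseteq> ?FF" "countable F'" "\<Union>F' = \<Union>?FF"
    using Lindelof[of ?FF] by (metis (no_types, lifting) imageE)
  have "AE z in lborel. \<forall>W\<in>F'. z \<in> U \<longrightarrow> z \<in> W \<longrightarrow> g z = 0"
    unfolding AE_ball_countable[OF F'(2)]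
  proof
    fix W assume "W \<in> F'"
    then obtain \<eta> where c: "\<eta> \<in> test_functions U" "W = {z. \<eta> z \<noteq> 0}" using F'(1) by auto
    from one[OF c(1)] show "AE z in lborel. z \<in> U \<longrightarrow> z \<in> W \<longrightarrow> g z = 0"
      by eventually_elim (auto simp: c(2))
  qed
  then show ?thesis
  proof eventually_elim
    case (elim z)
    show ?case
    proof
      assume "z \<in> U"
      from exists_bump[OF U(1) this] have "z \<in> \<Union>?FF" by blast
      then have "z \<in> \<Union>F'" using F'(3) by simp
      with elim \<open>z \<in> U\<close> show "g z = 0" by blast
    qed
  qed
qed

section \<open>Weak eigenvalue problems for both operators\<close>

lemma Basis_plane: "(Basis :: plane set) = {(1, 0), (0, 1)}"
  by (auto simp: Basis_prod_def)

lemma set_integral_mult_eq_L2_inner: "(LINT z:U|lborel. f z * g z) = L2_inner U f (\<lambda>z. cnj (g z))"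
  by (simp add: L2_inner_def)

lemma integration_by_parts:
  assumes U: "open U" "bounded U" and \<phi>: "smooth \<phi>" and \<eta>: "\<eta> \<in> test_functions U"
    and e: "e \<in> {(1, 0), (0, 1)}"
  shows "(LINT z:U|lborel. \<phi> z * dirderiv e \<eta> z) = - (LINT z:U|lborel. dirderiv e \<phi> z * \<eta> z)"
proof -
  note e\<eta> = test_functions_smooth[OF \<eta>]
  have p: "(\<lambda>z. \<phi> z * \<eta> z) \<in> test_functions U" by (rule test_functions_mult[OF \<eta> \<phi>])
  have a: "(\<lambda>z. \<phi> z * dirderiv e \<eta> z) \<in> test_functions U"
    by (rule test_functions_mult[OF test_functions_dirderiv[OF \<eta>] \<phi>])
  have b: "(\<lambda>z. dirderiv e \<phi> z * \<eta> z) \<in> test_functions U"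
    by (rule test_functions_mult[OF \<eta> smooth_dirderiv[OF \<phi>]])
  have "0 = (\<integral>z. dirderiv e (\<lambda>z. \<phi> z * \<eta> z) z \<partial>lborel)"
    by (rule test_functions_integral_dirderiv[OF p e, symmetric])
  also have "\<dots> = (\<integral>z. \<phi> z * dirderiv e \<eta> z + dirderiv e \<phi> z * \<eta> z \<partial>lborel)"
    by (simp add: dirderiv_mult smooth_differentiable \<phi> e\<eta>)
  also have "\<dots> = (\<integral>z. \<phi> z * dirderiv e \<eta> z \<partial>lborel) + (\<integral>z. dirderiv e \<phi> z * \<eta> z \<partial>lborel)"
    by (rule Bochner_Integration.integral_add[OF test_functions_integrable[OF a] test_functions_integrable[OF b]])
  finally show ?thesis
    unfolding set_integral_test_function[OF a] set_integral_test_function[OF b]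
    by (simp add: eq_neg_iff_add_eq_0)
qed

lemma has_weak_deriv_limit:
  assumes U: "open U" "bounded U" and w: "w \<in> L2 U" and g: "g \<in> L2 U" and \<phi>: "\<And>n::nat. smooth (\<phi> n)"
    and e: "e \<in> {(1, 0), (0, 1)}"
    and lim: "(\<lambda>n. L2_norm U (\<lambda>z. \<phi> n z - w z)) \<longlonglongrightarrow> 0"
      "(\<lambda>n. L2_norm U (\<lambda>z. dirderiv e (\<phi> n) z - g z)) \<longlonglongrightarrow> 0"
  shows "has_weak_deriv U e w g"
  unfolding has_weak_deriv_def
proof (intro conjI ballI g)
  fix \<eta> assume \<eta>: "\<eta> \<in> test_functions U"
  have Ub: "U \<in> sets borel" using U by simp
  note sL = smooth_imp_L2[OF Ub U(2)]
  have m: "(\<lambda>z. cnj (\<eta> z)) \<in> L2 U" "(\<lambda>z. cnj (dirderiv e \<eta> z)) \<in> L2 U"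
    by (intro L2_cnj Ub sL test_functions_smooth[OF \<eta>] smooth_dirderiv)+
  have 1: "(\<lambda>n. LINT z:U|lborel. \<phi> n z * dirderiv e \<eta> z) \<longlonglongrightarrow> (LINT z:U|lborel. w z * dirderiv e \<eta> z)"
    unfolding set_integral_mult_eq_L2_inner
    by (rule L2_inner_tendsto[OF Ub sL[OF \<phi>] w m(2) lim(1)])
  have "(\<lambda>n. LINT z:U|lborel. dirderiv e (\<phi> n) z * \<eta> z) \<longlonglongrightarrow> (LINT z:U|lborel. g z * \<eta> z)"
    unfolding set_integral_mult_eq_L2_inner
    by (rule L2_inner_tendsto[OF Ub sL[OF smooth_dirderiv[OF \<phi>]] g m(1) lim(2)])
  then have 2: "(\<lambda>n. LINT z:U|lborel. \<phi> n z * dirderiv e \<eta> z) \<longlonglongrightarrow> - (LINT z:U|lborel. g z * \<eta> z)"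
    unfolding integration_by_parts[OF U \<phi> \<eta> e] by (rule tendsto_minus)
  show "(LINT z:U|lborel. w z * dirderiv e \<eta> z) = - (LINT z:U|lborel. g z * \<eta> z)"
    by (rule LIMSEQ_unique[OF 1 2])
qed

lemma has_weak_deriv_unique:
  assumes U: "open U" "bounded U" and d: "has_weak_deriv U e w g" "has_weak_deriv U e w h"
  shows "AE z in lborel. z \<in> U \<longrightarrow> g z = h z"
proof -
  have Ub: "U \<in> sets borel" using U by simp
  have m: "g \<in> L2 U" "h \<in> L2 U" using d by (auto simp: has_weak_deriv_def)
  have "AE z in lborel. z \<in> U \<longrightarrow> g z - h z = 0"
  proof (rule test_functions_orthogonal_imp_AE[OF U L2_diff[OF Ub m]])
    fix \<phi> assume p: "\<phi> \<in> test_functions U"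
    have "(LINT z:U|lborel. w z * dirderiv e \<phi> z) = - (LINT z:U|lborel. g z * \<phi> z)"
      using d(1) p by (simp add: has_weak_deriv_def)
    moreover have "(LINT z:U|lborel. w z * dirderiv e \<phi> z) = - (LINT z:U|lborel. h z * \<phi> z)"
      using d(2) p by (simp add: has_weak_deriv_def)
    ultimately have "(LINT z:U|lborel. g z * \<phi> z) = (LINT z:U|lborel. h z * \<phi> z)" by simp
    then show "(LINT z:U|lborel. (g z - h z) * \<phi> z) = 0"
      unfolding set_integral_mult_eq_L2_inner
      using L2_inner_diff_left[OF Ub m L2_cnj[OF Ub test_functions_L2[OF Ub U(2) p]]] by simp
  qed
  then show ?thesis by simp
qed

section \<open>The Dirichlet-Neumann Laplacian as a weak problem\<close>

definition mixed_functions :: "plane set \<Rightarrow> plane set \<Rightarrow> cfun set" where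
  "mixed_functions U N = {\<phi>. smooth \<phi> \<and> (\<forall>z\<in>frontier U - N. \<phi> z = 0)}"

abbreviation mixed_closure :: "plane set \<Rightarrow> plane set \<Rightarrow> (cfun \<times> cfun \<times> cfun) set" where
  "mixed_closure U N \<equiv> graph_closure U (mixed_functions U N) (dirderiv (1, 0)) (dirderiv (0, 1))"

lemma L2_graph_mixed:
  assumes "open U" "bounded U"
  shows "L2_graph U (mixed_functions U N) (dirderiv (1, 0)) (dirderiv (0, 1))"
  using assms by (auto simp: L2_graph_def mixed_functions_def intro!: smooth_imp_L2 smooth_dirderiv)

lemma mixed_closure_weak_deriv:
  assumes U: "open U" "bounded U" and w: "(w, g1, g2) \<in> mixed_closure U N"
  shows "has_weak_deriv U (1, 0) w g1" "has_weak_deriv U (0, 1) w g2"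
proof -
  from w obtain \<phi> :: "nat \<Rightarrow> cfun" where L: "w \<in> L2 U" "g1 \<in> L2 U" "g2 \<in> L2 U"
    and \<phi>: "\<And>n. \<phi> n \<in> mixed_functions U N" "(\<lambda>n. L2_norm U (\<lambda>z. \<phi> n z - w z)) \<longlonglongrightarrow> 0"
      "(\<lambda>n. L2_norm U (\<lambda>z. dirderiv (1, 0) (\<phi> n) z - g1 z)) \<longlonglongrightarrow> 0"
      "(\<lambda>n. L2_norm U (\<lambda>z. dirderiv (0, 1) (\<phi> n) z - g2 z)) \<longlonglongrightarrow> 0"
    unfolding graph_closure_iff_sequence by blast
  have s: "smooth (\<phi> n)" for n using \<phi>(1)[of n] by (simp add: mixed_functions_def)
  show "has_weak_deriv U (1, 0) w g1" by (rule has_weak_deriv_limit[OF U L(1,2) s _ \<phi>(2,3)]) simp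
  show "has_weak_deriv U (0, 1) w g2" by (rule has_weak_deriv_limit[OF U L(1,3) s _ \<phi>(2,4)]) simp
qed

lemma weak_deriv_has_weak_deriv:
  "has_weak_deriv U e w g \<Longrightarrow> has_weak_deriv U e w (weak_deriv U e w)"
  unfolding weak_deriv_def by (rule someI[where P="has_weak_deriv U e w"])

text \<open>\<open>weak_deriv\<close> is an arbitrary choice; uniqueness of weak derivatives
  identifies it almost everywhere with the limits of the classical derivatives.\<close>

lemma mixed_closure_weak_deriv_AE:
  assumes U: "open U" "bounded U" and w: "(w, g1, g2) \<in> mixed_closure U N"
  shows "AE z in lborel. z \<in> U \<longrightarrow> weak_deriv U (1, 0) w z = g1 z"
    "AE z in lborel. z \<in> U \<longrightarrow> weak_deriv U (0, 1) w z = g2 z"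
    "weak_deriv U (1, 0) w \<in> L2 U" "weak_deriv U (0, 1) w \<in> L2 U"
proof -
  note d = mixed_closure_weak_deriv[OF assms]
  note d' = weak_deriv_has_weak_deriv[OF d(1)] weak_deriv_has_weak_deriv[OF d(2)]
  show "AE z in lborel. z \<in> U \<longrightarrow> weak_deriv U (1, 0) w z = g1 z" by (rule has_weak_deriv_unique[OF U d'(1) d(1)])
  show "AE z in lborel. z \<in> U \<longrightarrow> weak_deriv U (0, 1) w z = g2 z" by (rule has_weak_deriv_unique[OF U d'(2) d(2)])
  show "weak_deriv U (1, 0) w \<in> L2 U" "weak_deriv U (0, 1) w \<in> L2 U"
    using d' by (auto simp: has_weak_deriv_def)
qed

text \<open>Limits of the derivatives of an approximating sequence are weak derivatives of the
  limit. Convergence to the chosen weak derivatives is therefore the same as convergence to some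
  square integrable functions.\<close>

lemma H1_vanishing_outside_iff:
  assumes U: "open U" "bounded U"
  shows "w \<in> H1_vanishing_outside U N \<longleftrightarrow> (\<exists>g1 g2. (w, g1, g2) \<in> mixed_closure U N)"
proof
  assume w: "w \<in> H1_vanishing_outside U N"
  then have "w \<in> L2 U" and ex: "\<forall>e\<in>Basis. \<exists>g. has_weak_deriv U e w g"
    by (auto simp: H1_vanishing_outside_def H1_def)
  moreover have "weak_deriv U e w \<in> L2 U" if "e \<in> Basis" for e
  proof -
    from ex that obtain g where "has_weak_deriv U e w g" by blast
    from weak_deriv_has_weak_deriv[OF this] show ?thesis by (simp add: has_weak_deriv_def)
  qed
  then have "weak_deriv U (1, 0) w \<in> L2 U" "weak_deriv U (0, 1) w \<in> L2 U" by (auto simp: Basis_plane)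
  moreover from w obtain \<phi> :: "nat \<Rightarrow> cfun" where "\<And>n. \<phi> n \<in> mixed_functions U N"
    "(\<lambda>n. L2_norm U (\<lambda>z. \<phi> n z - w z)) \<longlonglongrightarrow> 0"
    "\<forall>e\<in>Basis. (\<lambda>n. L2_norm U (\<lambda>z. dirderiv e (\<phi> n) z - weak_deriv U e w z)) \<longlonglongrightarrow> 0"
    unfolding H1_vanishing_outside_def mixed_functions_def by auto
  ultimately have "(w, weak_deriv U (1, 0) w, weak_deriv U (0, 1) w) \<in> mixed_closure U N"
    unfolding graph_closure_iff_sequence Basis_plane by (intro conjI exI[of _ \<phi>]) auto
  then show "\<exists>g1 g2. (w, g1, g2) \<in> mixed_closure U N" by blast
next
  assume "\<exists>g1 g2. (w, g1, g2) \<in> mixed_closure U N"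
  then obtain g1 g2 where w: "(w, g1, g2) \<in> mixed_closure U N" by blast
  have Ub: "U \<in> sets borel" using U by simp
  from w obtain \<phi> :: "nat \<Rightarrow> cfun" where L: "w \<in> L2 U" "g1 \<in> L2 U" "g2 \<in> L2 U"
    and \<phi>: "\<And>n. \<phi> n \<in> mixed_functions U N" "(\<lambda>n. L2_norm U (\<lambda>z. \<phi> n z - w z)) \<longlonglongrightarrow> 0"
      "(\<lambda>n. L2_norm U (\<lambda>z. dirderiv (1, 0) (\<phi> n) z - g1 z)) \<longlonglongrightarrow> 0"
      "(\<lambda>n. L2_norm U (\<lambda>z. dirderiv (0, 1) (\<phi> n) z - g2 z)) \<longlonglongrightarrow> 0"
    unfolding graph_closure_iff_sequence by blast
  note d = mixed_closure_weak_deriv[OF U w]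
  note ae = mixed_closure_weak_deriv_AE[OF U w]
  have "w \<in> H1 U" using L(1) d by (auto simp: H1_def Basis_plane)
  moreover have s: "smooth (\<phi> n)" for n using \<phi>(1)[of n] by (simp add: mixed_functions_def)
  moreover have eq: "L2_norm U (\<lambda>z. dirderiv e (\<phi> n) z - weak_deriv U e w z) = L2_norm U (\<lambda>z. dirderiv e (\<phi> n) z - g z)"
    if "AE z in lborel. z \<in> U \<longrightarrow> weak_deriv U e w z = g z" "weak_deriv U e w \<in> L2 U" "g \<in> L2 U" for e g n
  proof (rule L2_norm_cong[OF Ub])
    have p: "dirderiv e (\<phi> n) \<in> L2 U" by (rule smooth_imp_L2[OF Ub U(2) smooth_dirderiv[OF s]])
    show "(\<lambda>z. dirderiv e (\<phi> n) z - weak_deriv U e w z) \<in> L2 U" by (rule L2_diff[OF Ub p that(2)])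
    show "(\<lambda>z. dirderiv e (\<phi> n) z - g z) \<in> L2 U" by (rule L2_diff[OF Ub p that(3)])
    show "AE z in lborel. z \<in> U \<longrightarrow> dirderiv e (\<phi> n) z - weak_deriv U e w z = dirderiv e (\<phi> n) z - g z"
      using that(1) by eventually_elim simp
  qed
  note e1 = eq[OF ae(1,3) L(2)] and e2 = eq[OF ae(2,4) L(3)]
  have "\<forall>e\<in>Basis. (\<lambda>n. L2_norm U (\<lambda>z. dirderiv e (\<phi> n) z - weak_deriv U e w z)) \<longlonglongrightarrow> 0"
    using \<phi>(3,4) e1 e2 by (simp add: Basis_plane)
  moreover have "\<forall>n. smooth (\<phi> n) \<and> (\<forall>z\<in>frontier U - N. \<phi> n z = 0)"
    using \<phi>(1) by (simp add: mixed_functions_def)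
  ultimately show "w \<in> H1_vanishing_outside U N"
    using \<phi>(2) unfolding H1_vanishing_outside_def by blast
qed

lemma gradient_form_eq:
  assumes U: "open U" "bounded U" and w: "(w, g1, g2) \<in> mixed_closure U N" and v: "(v, h1, h2) \<in> mixed_closure U M"
  shows "gradient_form U w v = L2_inner U g1 h1 + L2_inner U g2 h2"
proof -
  have Ub: "U \<in> sets borel" using U by simp
  note a = mixed_closure_weak_deriv_AE[OF U w] and b = mixed_closure_weak_deriv_AE[OF U v]
  note L = graph_closure_L2[OF w] and M = graph_closure_L2[OF v]
  have "L2_inner U (weak_deriv U (1, 0) w) (weak_deriv U (1, 0) v) = L2_inner U g1 h1"
    by (rule L2_inner_cong[OF Ub a(3) _ b(3) _ a(1) b(1)]) (use L M in auto)
  moreover have "L2_inner U (weak_deriv U (0, 1) w) (weak_deriv U (0, 1) v) = L2_inner U g2 h2"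
    by (rule L2_inner_cong[OF Ub a(4) _ b(4) _ a(2) b(2)]) (use L M in auto)
  ultimately show ?thesis by (simp add: gradient_form_def Basis_plane)
qed

text \<open>Core functions belong to the form domain, which gives one direction; conversely an
  equation tested on the core extends by density, and the form may be computed with any limits of
  gradients.\<close>

lemma eigenvalues_DN_Laplacian:
  assumes U: "open U" "bounded U"
  shows "eigenvalues U (DN_Laplacian U N) =
    weak_eigenvalues U (mixed_functions U N) (dirderiv (1, 0)) (dirderiv (0, 1))"
proof -
  have Ub: "U \<in> sets borel" using U by simp
  note G = L2_graph_mixed[OF U, of N]
  have "(u, \<lambda>z. \<mu> * u z) \<in> DN_Laplacian U N \<longleftrightarrow>
    (\<exists>g1 g2. weak_solution U (mixed_functions U N) (dirderiv (1, 0)) (dirderiv (0, 1)) \<mu> u g1 g2)"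
    (is "?L \<longleftrightarrow> ?R") for u \<mu>
  proof
    assume ?L
    then have u: "u \<in> H1_vanishing_outside U N"
      and eq: "\<And>v. v \<in> H1_vanishing_outside U N \<Longrightarrow> gradient_form U u v = L2_inner U (\<lambda>z. \<mu> * u z) v"
      by (auto simp: DN_Laplacian_def form_operator_def)
    from u obtain g1 g2 where g: "(u, g1, g2) \<in> mixed_closure U N"
      unfolding H1_vanishing_outside_iff[OF U] by blast
    have "L2_inner U g1 (dirderiv (1, 0) \<phi>) + L2_inner U g2 (dirderiv (0, 1) \<phi>) = \<mu> * L2_inner U u \<phi>"
      if "\<phi> \<in> mixed_functions U N" for \<phi>
    proof -
      note p = graph_closure_base[OF G that]
      then have "\<phi> \<in> H1_vanishing_outside U N" unfolding H1_vanishing_outside_iff[OF U] by blast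
      from eq[OF this] show ?thesis
        by (simp add: gradient_form_eq[OF U g p] L2_inner_cmult_left[OF Ub])
    qed
    with g show ?R unfolding weak_solution_def by blast
  next
    assume ?R
    then obtain g1 g2 where s: "weak_solution U (mixed_functions U N) (dirderiv (1, 0)) (dirderiv (0, 1)) \<mu> u g1 g2"
      by blast
    then have g: "(u, g1, g2) \<in> mixed_closure U N" by (simp add: weak_solution_def)
    then have u: "u \<in> H1_vanishing_outside U N" unfolding H1_vanishing_outside_iff[OF U] by blast
    have "gradient_form U u v = L2_inner U (\<lambda>z. \<mu> * u z) v" if "v \<in> H1_vanishing_outside U N" for v
    proof -
      from that obtain h1 h2 where h: "(v, h1, h2) \<in> mixed_closure U N"
        unfolding H1_vanishing_outside_iff[OF U] by blast
      show ?thesis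
        using weak_solution_closure[OF G s h] by (simp add: gradient_form_eq[OF U g h] L2_inner_cmult_left[OF Ub])
    qed
    with u L2_cmult[OF Ub, of u \<mu>] graph_closure_L2[OF g] show ?L
      by (simp add: DN_Laplacian_def form_operator_def)
  qed
  then show ?thesis unfolding eigenvalues_def weak_eigenvalues_def by blast
qed

section \<open>The Aharonov-Bohm operator as a weak problem\<close>

abbreviation AB_D1 :: "cfun \<Rightarrow> cfun" where "AB_D1 \<equiv> mag_D (1, 0) AB_A1"
abbreviation AB_D2 :: "cfun \<Rightarrow> cfun" where "AB_D2 \<equiv> mag_D (0, 1) AB_A2"

lemma smooth_on_inverse_norm_sq: "smooth_on (- {0}) (\<lambda>z::plane. inverse ((fst z)\<^sup>2 + (snd z)\<^sup>2))"
proof -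
  have o: "open (- {0::plane})" by auto
  show ?thesis
    unfolding power2_eq_square
    by (intro smooth_on_inverse[OF o] smooth_on_add smooth_on_mult o smooth_on_bounded_linear
        bounded_linear_fst bounded_linear_snd)
       (auto simp: prod_eq_iff add_nonneg_eq_0_iff sum_squares_eq_zero_iff)
qed

lemma smooth_on_AB_A:
  "smooth_on (- {0}) AB_A1" "smooth_on (- {0}) AB_A2"
proof -
  have o: "open (- {0::plane})" by auto
  have 1: "AB_A1 = (\<lambda>z. (- (1/2)) * (snd z * inverse ((fst z)\<^sup>2 + (snd z)\<^sup>2)))"
    by (auto simp: AB_A1_def fun_eq_iff field_simps)
  have 2: "AB_A2 = (\<lambda>z. (1/2) * (fst z * inverse ((fst z)\<^sup>2 + (snd z)\<^sup>2)))"
    by (auto simp: AB_A2_def fun_eq_iff field_simps)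
  show "smooth_on (- {0}) AB_A1" unfolding 1
    by (intro smooth_on_mult o smooth_on_const smooth_on_bounded_linear bounded_linear_snd smooth_on_inverse_norm_sq)
  show "smooth_on (- {0}) AB_A2" unfolding 2
    by (intro smooth_on_mult o smooth_on_const smooth_on_bounded_linear bounded_linear_fst smooth_on_inverse_norm_sq)
qed

text \<open>f may be singular off W, as the potential is at the origin: the product is smooth on W,
  it is zero off a compact subset of U, and these two open sets cover the plane.\<close>

lemma test_functions_mult_local:
  assumes \<phi>: "\<phi> \<in> test_functions U" and W: "open W" "U \<subseteq> W" "smooth_on W f"
  shows "(\<lambda>z. f z * \<phi> z) \<in> test_functions U"
proof -
  obtain S where S: "smooth \<phi>" "compact S" "S \<subseteq> U" "\<And>z. z \<notin> S \<Longrightarrow> \<phi> z = 0"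
    using test_functionsE[OF \<phi>] by blast
  have oS: "open (- S)" using S(2) by (simp add: compact_imp_closed open_Compl)
  have 1: "smooth_on W (\<lambda>z. f z * \<phi> z)"
  proof (rule smooth_on_mult[OF W(1,3)])
    show "smooth_on W \<phi>" by (rule smooth_on_subset[of UNIV]) (simp_all add: smooth_on_UNIV S(1))
  qed
  have 2: "smooth_on (- S) (\<lambda>z. f z * \<phi> z)"
    by (rule smooth_on_cong[OF oS smooth_on_const[of _ 0]]) (simp add: S(4))
  have "W \<union> - S = UNIV" using S(3) W(2) by auto
  with smooth_on_Un[OF W(1) oS 1 2] have "smooth (\<lambda>z. f z * \<phi> z)" by (simp add: smooth_on_UNIV)
  then show ?thesis by (rule test_functionsI[OF _ S(2,3)]) (simp add: S(4))
qed

lemma test_functions_mag_D: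
  assumes \<phi>: "\<phi> \<in> test_functions U" and U: "0 \<notin> U" and A: "smooth_on (- {0}) A"
  shows "mag_D e A \<phi> \<in> test_functions U"
proof -
  have o: "open (- {0::plane})" by auto
  have 1: "(\<lambda>z. (- \<i>) * dirderiv e \<phi> z) \<in> test_functions U"
    by (rule test_functions_mult[OF test_functions_dirderiv[OF \<phi>] smooth_const])
  have 2: "(\<lambda>z. of_real (A z) * \<phi> z) \<in> test_functions U"
    using U by (intro test_functions_mult_local[OF \<phi> o _ smooth_on_linear_compose[OF o bounded_linear_of_real A]]) auto
  show ?thesis using test_functions_diff[OF 1 2] by (simp add: mag_D_def)
qed

lemma mag_D_diff:
  assumes "f differentiable at z" "g differentiable at z"
  shows "mag_D e A (\<lambda>z. f z - g z) z = mag_D e A f z - mag_D e A g z"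
  using assms by (simp add: mag_D_def dirderiv_diff algebra_simps)

text \<open>The potential is real, so its two contributions cancel and the integrands differ by
  -\<i> times a derivative of the test function \<open>\<phi> z * cnj (\<eta> z)\<close>, whose
  integral is 0.\<close>

lemma mag_D_symmetric:
  assumes U: "open U" "bounded U" "0 \<notin> U" and A: "smooth_on (- {0}) A"
    and \<phi>: "\<phi> \<in> test_functions U" and \<eta>: "\<eta> \<in> test_functions U" and e: "e \<in> {(1, 0), (0, 1)}"
  shows "L2_inner U (mag_D e A \<phi>) \<eta> = L2_inner U \<phi> (mag_D e A \<eta>)"
proof -
  have Ub: "U \<in> sets borel" using U by simp
  note tL = test_functions_L2[OF Ub U(2)]
  note m = tL[OF \<phi>] tL[OF \<eta>] tL[OF test_functions_mag_D[OF \<phi> U(3) A, of e]]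
    tL[OF test_functions_mag_D[OF \<eta> U(3) A, of e]]
  note c\<eta> = test_functions_cnj[OF \<eta>]
  have d: "\<phi> differentiable at z" "\<eta> differentiable at z" "(\<lambda>z. cnj (\<eta> z)) differentiable at z" for z
    using \<phi> \<eta> c\<eta> by (auto intro: smooth_differentiable test_functions_smooth)
  have p: "(\<lambda>z. \<phi> z * cnj (\<eta> z)) \<in> test_functions U"
    by (rule test_functions_mult[OF c\<eta> test_functions_smooth[OF \<phi>]])
  have pt: "mag_D e A \<phi> z * cnj (\<eta> z) - \<phi> z * cnj (mag_D e A \<eta> z) = - \<i> * dirderiv e (\<lambda>z. \<phi> z * cnj (\<eta> z)) z" for z
    by (simp add: mag_D_def dirderiv_mult[OF d(1,3)] dirderiv_cnj[OF d(2)] algebra_simps)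
  have "L2_inner U (mag_D e A \<phi>) \<eta> - L2_inner U \<phi> (mag_D e A \<eta>) =
    (\<integral>z. mag_D e A \<phi> z * cnj (\<eta> z) - \<phi> z * cnj (mag_D e A \<eta> z) \<partial>lborel_on U)"
    unfolding L2_inner_eq[OF Ub]
    by (rule Bochner_Integration.integral_diff[symmetric]) (intro L2_integrable_mult Ub m)+
  also have "\<dots> = - \<i> * (LINT z:U|lborel. dirderiv e (\<lambda>z. \<phi> z * cnj (\<eta> z)) z)"
    unfolding pt using Ub by (simp add: integral_restrict_space set_lebesgue_integral_def)
  also have "\<dots> = 0"
    using set_integral_test_function[OF test_functions_dirderiv[OF p]] test_functions_integral_dirderiv[OF p e] by simp
  finally show ?thesis by simp
qed

lemma L2_graph_AB:
  assumes U: "open U" "bounded U" "0 \<notin> U"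
  shows "L2_graph U (test_functions U) AB_D1 AB_D2"
proof -
  have Ub: "U \<in> sets borel" using U by simp
  note tL = test_functions_L2[OF Ub U(2)]
  show ?thesis unfolding L2_graph_def
  proof (intro conjI ballI Ub)
    fix \<phi> assume p: "\<phi> \<in> test_functions U"
    show "\<phi> \<in> L2 U" by (rule tL[OF p])
    show "AB_D1 \<phi> \<in> L2 U" by (rule tL[OF test_functions_mag_D[OF p U(3) smooth_on_AB_A(1)]])
    show "AB_D2 \<phi> \<in> L2 U" by (rule tL[OF test_functions_mag_D[OF p U(3) smooth_on_AB_A(2)]])
  qed
qed

lemma AB_expression_inner:
  assumes U: "open U" "bounded U" "0 \<notin> U" and \<phi>: "\<phi> \<in> test_functions U" and \<eta>: "\<eta> \<in> test_functions U"
  shows "L2_inner U (AB_expression \<phi>) \<eta> = L2_inner U (AB_D1 \<phi>) (AB_D1 \<eta>) + L2_inner U (AB_D2 \<phi>) (AB_D2 \<eta>)"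
    and "L2_inner U \<phi> (AB_expression \<eta>) = L2_inner U (AB_D1 \<phi>) (AB_D1 \<eta>) + L2_inner U (AB_D2 \<phi>) (AB_D2 \<eta>)"
    and "AB_expression \<eta> \<in> L2 U"
proof -
  have Ub: "U \<in> sets borel" using U by simp
  note tL = test_functions_L2[OF Ub U(2)]
  note t1 = test_functions_mag_D[OF _ U(3) smooth_on_AB_A(1)] and t2 = test_functions_mag_D[OF _ U(3) smooth_on_AB_A(2)]
  note s1 = mag_D_symmetric[OF U smooth_on_AB_A(1)] and s2 = mag_D_symmetric[OF U smooth_on_AB_A(2)]
  note E = AB_expression_def[abs_def]
  show "L2_inner U (AB_expression \<phi>) \<eta> = L2_inner U (AB_D1 \<phi>) (AB_D1 \<eta>) + L2_inner U (AB_D2 \<phi>) (AB_D2 \<eta>)"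
    unfolding E L2_inner_add_left[OF Ub tL[OF t1[OF t1[OF \<phi>]]] tL[OF t2[OF t2[OF \<phi>]]] tL[OF \<eta>]]
    using s1[OF t1[OF \<phi>] \<eta>] s2[OF t2[OF \<phi>] \<eta>] by simp
  show "L2_inner U \<phi> (AB_expression \<eta>) = L2_inner U (AB_D1 \<phi>) (AB_D1 \<eta>) + L2_inner U (AB_D2 \<phi>) (AB_D2 \<eta>)"
    unfolding E L2_inner_add_right[OF Ub tL[OF t1[OF t1[OF \<eta>]]] tL[OF t2[OF t2[OF \<eta>]]] tL[OF \<phi>]]
    using s1[OF \<phi> t1[OF \<eta>]] s2[OF \<phi> t2[OF \<eta>]] by simp
  show "AB_expression \<eta> \<in> L2 U"
    unfolding E by (rule L2_add[OF Ub tL[OF t1[OF t1[OF \<eta>]]] tL[OF t2[OF t2[OF \<eta>]]]])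
qed

abbreviation AB_closure :: "plane set \<Rightarrow> (cfun \<times> cfun \<times> cfun) set" where
  "AB_closure U \<equiv> graph_closure U (test_functions U) AB_D1 AB_D2"

lemma AB_form_diff:
  assumes U: "open U" "bounded U" "0 \<notin> U" and \<phi>: "\<phi> \<in> test_functions U" and \<eta>: "\<eta> \<in> test_functions U"
  shows "Re (L2_inner U (AB_expression (\<lambda>z. \<phi> z - \<eta> z)) (\<lambda>z. \<phi> z - \<eta> z)) =
    (L2_norm U (\<lambda>z. AB_D1 \<phi> z - AB_D1 \<eta> z))\<^sup>2 + (L2_norm U (\<lambda>z. AB_D2 \<phi> z - AB_D2 \<eta> z))\<^sup>2"
proof -
  have Ub: "U \<in> sets borel" using U by simp
  have d: "\<phi> differentiable at z" "\<eta> differentiable at z" for z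
    using \<phi> \<eta> by (auto intro: smooth_differentiable test_functions_smooth)
  have "AB_D1 (\<lambda>z. \<phi> z - \<eta> z) = (\<lambda>z. AB_D1 \<phi> z - AB_D1 \<eta> z)"
    "AB_D2 (\<lambda>z. \<phi> z - \<eta> z) = (\<lambda>z. AB_D2 \<phi> z - AB_D2 \<eta> z)"
    by (rule ext mag_D_diff d)+
  then show ?thesis
    using AB_expression_inner(1)[OF U test_functions_diff[OF \<phi> \<eta>] test_functions_diff[OF \<phi> \<eta>]]
    by (simp add: L2_inner_self[OF Ub])
qed

text \<open>The form is the sum of the squared norms of the two magnetic derivatives. A sequence is
  thus form-Cauchy exactly if its magnetic derivatives are Cauchy in L2, and completeness supplies
  g1 and g2.\<close>

lemma form_closure_domain_AB:
  assumes U: "open U" "bounded U" "0 \<notin> U"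
  shows "u \<in> form_closure_domain U (test_functions U) AB_expression \<longleftrightarrow> (\<exists>g1 g2. (u, g1, g2) \<in> AB_closure U)"
proof
  have Ub: "U \<in> sets borel" using U by simp
  note G = L2_graph_AB[OF U]
  {
    assume "u \<in> form_closure_domain U (test_functions U) AB_expression"
    then obtain \<phi> :: "nat \<Rightarrow> cfun" where u: "u \<in> L2 U" and \<phi>: "\<And>n. \<phi> n \<in> test_functions U"
      "(\<lambda>n. L2_norm U (\<lambda>z. \<phi> n z - u z)) \<longlonglongrightarrow> 0"
      and C: "\<And>\<epsilon>. \<epsilon> > 0 \<Longrightarrow> \<exists>N. \<forall>m\<ge>N. \<forall>n\<ge>N.
         Re (L2_inner U (AB_expression (\<lambda>z. \<phi> m z - \<phi> n z)) (\<lambda>z. \<phi> m z - \<phi> n z)) < \<epsilon>"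
      unfolding form_closure_domain_def by blast
    have m: "AB_D1 (\<phi> n) \<in> L2 U" "AB_D2 (\<phi> n) \<in> L2 U" for n
      using G \<phi>(1)[of n] by (auto simp: L2_graph_def)
    have c: "\<exists>N. \<forall>m\<ge>N. \<forall>n\<ge>N. L2_norm U (\<lambda>z. AB_D1 (\<phi> m) z - AB_D1 (\<phi> n) z) < \<epsilon> \<and>
        L2_norm U (\<lambda>z. AB_D2 (\<phi> m) z - AB_D2 (\<phi> n) z) < \<epsilon>" if "\<epsilon> > 0" for \<epsilon>
    proof -
      from that have "\<epsilon>\<^sup>2 > 0" by simp
      from C[OF this] obtain N where N: "\<forall>m\<ge>N. \<forall>n\<ge>N.
         Re (L2_inner U (AB_expression (\<lambda>z. \<phi> m z - \<phi> n z)) (\<lambda>z. \<phi> m z - \<phi> n z)) < \<epsilon>\<^sup>2" by blast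
      have "a < \<epsilon> \<and> b < \<epsilon>" if "a\<^sup>2 + b\<^sup>2 < \<epsilon>\<^sup>2" for a b
      proof -
        have "a\<^sup>2 < \<epsilon>\<^sup>2" "b\<^sup>2 < \<epsilon>\<^sup>2" using that by (smt (verit) zero_le_power2)+
        with \<open>\<epsilon> > 0\<close> show ?thesis by (auto intro: power2_less_imp_less)
      qed
      with N show ?thesis unfolding AB_form_diff[OF U \<phi>(1) \<phi>(1)] by blast
    qed
    obtain g1 where g1: "g1 \<in> L2 U" "(\<lambda>n. L2_norm U (\<lambda>z. AB_D1 (\<phi> n) z - g1 z)) \<longlonglongrightarrow> 0"
      using L2_complete[OF Ub U(2), of "\<lambda>n. AB_D1 (\<phi> n)", OF m(1)] c by blast
    obtain g2 where g2: "g2 \<in> L2 U" "(\<lambda>n. L2_norm U (\<lambda>z. AB_D2 (\<phi> n) z - g2 z)) \<longlonglongrightarrow> 0"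
      using L2_complete[OF Ub U(2), of "\<lambda>n. AB_D2 (\<phi> n)", OF m(2)] c by blast
    have "(u, g1, g2) \<in> AB_closure U"
      unfolding graph_closure_iff_sequence using u g1 g2 \<phi> by blast
    then show "\<exists>g1 g2. (u, g1, g2) \<in> AB_closure U" by blast
  next
    assume "\<exists>g1 g2. (u, g1, g2) \<in> AB_closure U"
    then obtain g1 g2 and \<phi> :: "nat \<Rightarrow> cfun" where L: "u \<in> L2 U" "g1 \<in> L2 U" "g2 \<in> L2 U"
      and \<phi>: "\<And>n. \<phi> n \<in> test_functions U" "(\<lambda>n. L2_norm U (\<lambda>z. \<phi> n z - u z)) \<longlonglongrightarrow> 0"
      "(\<lambda>n. L2_norm U (\<lambda>z. AB_D1 (\<phi> n) z - g1 z)) \<longlonglongrightarrow> 0"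
      "(\<lambda>n. L2_norm U (\<lambda>z. AB_D2 (\<phi> n) z - g2 z)) \<longlonglongrightarrow> 0"
      unfolding graph_closure_iff_sequence by blast
    have m: "AB_D1 (\<phi> n) \<in> L2 U" "AB_D2 (\<phi> n) \<in> L2 U" for n
      using G \<phi>(1)[of n] by (auto simp: L2_graph_def)
    have "\<exists>N. \<forall>m\<ge>N. \<forall>n\<ge>N. Re (L2_inner U (AB_expression (\<lambda>z. \<phi> m z - \<phi> n z)) (\<lambda>z. \<phi> m z - \<phi> n z)) < \<epsilon>"
      if e: "\<epsilon> > 0" for \<epsilon>
    proof -
      \<comment> \<open>Both differences then have norm at most half of
        \<open>sqrt \<epsilon>\<close>, so each square is at most \<epsilon>/4 and their sum stays
        below \<epsilon>.\<close>
      define \<delta> where "\<delta> = sqrt \<epsilon> / 4"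
      have d: "\<delta> > 0" using e by (simp add: \<delta>_def)
      have "\<forall>\<^sub>F n in sequentially. L2_norm U (\<lambda>z. AB_D1 (\<phi> n) z - g1 z) < \<delta> \<and>
          L2_norm U (\<lambda>z. AB_D2 (\<phi> n) z - g2 z) < \<delta>"
        using \<phi>(3,4)[THEN order_tendstoD(2), OF d] by (intro eventually_conj)
      then obtain N where N: "\<And>n. n \<ge> N \<Longrightarrow> L2_norm U (\<lambda>z. AB_D1 (\<phi> n) z - g1 z) < \<delta>"
          "\<And>n. n \<ge> N \<Longrightarrow> L2_norm U (\<lambda>z. AB_D2 (\<phi> n) z - g2 z) < \<delta>"
        unfolding eventually_sequentially by blast
      have sq: "a\<^sup>2 \<le> \<epsilon> / 4" if "0 \<le> a" "a \<le> 2 * \<delta>" for a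
      proof -
        have "a\<^sup>2 \<le> (2 * \<delta>)\<^sup>2" using that by (intro power_mono) auto
        also have "\<dots> = \<epsilon> / 4" using e by (simp add: \<delta>_def power_divide power_mult_distrib)
        finally show ?thesis .
      qed
      show ?thesis
      proof (intro exI[of _ N] allI impI)
        fix m n assume mn: "m \<ge> N" "n \<ge> N"
        have "L2_norm U (\<lambda>z. AB_D1 (\<phi> m) z - AB_D1 (\<phi> n) z) \<le> 2 * \<delta>"
          using L2_norm_triangle_diff[OF Ub m(1)[of m] L(2) m(1)[of n]] N(1)[OF mn(1)] N(1)[OF mn(2)]
            L2_norm_minus_commute[of U g1 "AB_D1 (\<phi> n)"] by linarith
        moreover have "L2_norm U (\<lambda>z. AB_D2 (\<phi> m) z - AB_D2 (\<phi> n) z) \<le> 2 * \<delta>"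
          using L2_norm_triangle_diff[OF Ub m(2)[of m] L(3) m(2)[of n]] N(2)[OF mn(1)] N(2)[OF mn(2)]
            L2_norm_minus_commute[of U g2 "AB_D2 (\<phi> n)"] by linarith
        ultimately show "Re (L2_inner U (AB_expression (\<lambda>z. \<phi> m z - \<phi> n z)) (\<lambda>z. \<phi> m z - \<phi> n z)) < \<epsilon>"
          unfolding AB_form_diff[OF U \<phi>(1) \<phi>(1)]
          using sq[OF L2_norm_nonneg, of U "\<lambda>z. AB_D1 (\<phi> m) z - AB_D1 (\<phi> n) z"]
            sq[OF L2_norm_nonneg, of U "\<lambda>z. AB_D2 (\<phi> m) z - AB_D2 (\<phi> n) z"] e by linarith
      qed
    qed
    with L(1) \<phi>(1,2) show "u \<in> form_closure_domain U (test_functions U) AB_expression"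
      unfolding form_closure_domain_def by blast
  }
qed

text \<open>In the Friedrichs extension the whole operator acts on the test function. Moving one
  magnetic derivative of each term back to u turns that condition into the weak equation.\<close>

lemma AB_closure_inner:
  assumes U: "open U" "bounded U" "0 \<notin> U" and u: "(u, g1, g2) \<in> AB_closure U" and \<psi>: "\<psi> \<in> test_functions U"
  shows "L2_inner U u (AB_expression \<psi>) = L2_inner U g1 (AB_D1 \<psi>) + L2_inner U g2 (AB_D2 \<psi>)"
proof -
  have Ub: "U \<in> sets borel" using U by simp
  note G = L2_graph_AB[OF U]
  from u obtain \<phi> :: "nat \<Rightarrow> cfun" where L: "u \<in> L2 U" "g1 \<in> L2 U" "g2 \<in> L2 U"
    and \<phi>: "\<And>n. \<phi> n \<in> test_functions U" "(\<lambda>n. L2_norm U (\<lambda>z. \<phi> n z - u z)) \<longlonglongrightarrow> 0"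
      "(\<lambda>n. L2_norm U (\<lambda>z. AB_D1 (\<phi> n) z - g1 z)) \<longlonglongrightarrow> 0"
      "(\<lambda>n. L2_norm U (\<lambda>z. AB_D2 (\<phi> n) z - g2 z)) \<longlonglongrightarrow> 0"
    unfolding graph_closure_iff_sequence by blast
  have m: "\<phi> n \<in> L2 U" "AB_D1 (\<phi> n) \<in> L2 U" "AB_D2 (\<phi> n) \<in> L2 U" for n
    using G \<phi>(1)[of n] by (auto simp: L2_graph_def)
  have p: "AB_D1 \<psi> \<in> L2 U" "AB_D2 \<psi> \<in> L2 U" using G \<psi> by (auto simp: L2_graph_def)
  note E = AB_expression_inner(2,3)[OF U \<phi>(1) \<psi>]
  have 1: "(\<lambda>n. L2_inner U (\<phi> n) (AB_expression \<psi>)) \<longlonglongrightarrow> L2_inner U u (AB_expression \<psi>)"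
    by (rule L2_inner_tendsto[OF Ub m(1) L(1) E(2) \<phi>(2)])
  have 2: "(\<lambda>n. L2_inner U (\<phi> n) (AB_expression \<psi>)) \<longlonglongrightarrow> L2_inner U g1 (AB_D1 \<psi>) + L2_inner U g2 (AB_D2 \<psi>)"
    unfolding E(1)
    by (rule tendsto_add[OF L2_inner_tendsto[OF Ub m(2) L(2) p(1) \<phi>(3)] L2_inner_tendsto[OF Ub m(3) L(3) p(2) \<phi>(4)]])
  show ?thesis by (rule LIMSEQ_unique[OF 1 2])
qed

lemma eigenvalues_AB_Dirichlet:
  assumes U: "open U" "bounded U" "0 \<notin> U"
  shows "eigenvalues U (AB_Dirichlet U) = weak_eigenvalues U (test_functions U) AB_D1 AB_D2"
proof -
  have Ub: "U \<in> sets borel" using U by simp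
  have "(u, \<lambda>z. \<mu> * u z) \<in> AB_Dirichlet U \<longleftrightarrow>
    (\<exists>g1 g2. weak_solution U (test_functions U) AB_D1 AB_D2 \<mu> u g1 g2)" (is "?L \<longleftrightarrow> ?R") for u \<mu>
  proof
    assume L: ?L
    then obtain g1 g2 where g: "(u, g1, g2) \<in> AB_closure U"
      using form_closure_domain_AB[OF U] by (auto simp: AB_Dirichlet_def friedrichs_extension_def)
    with L show ?R
      unfolding weak_solution_def AB_Dirichlet_def friedrichs_extension_def
      using AB_closure_inner[OF U g] L2_inner_cmult_left[OF Ub] by fastforce
  next
    assume ?R
    then obtain g1 g2 where s: "weak_solution U (test_functions U) AB_D1 AB_D2 \<mu> u g1 g2" by blast
    then have g: "(u, g1, g2) \<in> AB_closure U" by (simp add: weak_solution_def)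
    have "u \<in> form_closure_domain U (test_functions U) AB_expression"
      using g form_closure_domain_AB[OF U] by blast
    moreover have "(\<lambda>z. \<mu> * u z) \<in> L2 U" using graph_closure_L2[OF g] L2_cmult[OF Ub] by blast
    ultimately show ?L
      using s AB_closure_inner[OF U g] L2_inner_cmult_left[OF Ub]
      by (simp add: weak_solution_def AB_Dirichlet_def friedrichs_extension_def)
  qed
  then show ?thesis unfolding eigenvalues_def weak_eigenvalues_def by blast
qed

section \<open>The half phase\<close>

text \<open>This is exp (\<i>\<theta>), with value 0 at the origin by the convention for
  division.\<close>

definition phase :: cfun where
  "phase z = Complex (fst z) (snd z) / of_real (norm z)"

text \<open>For \<theta> between -\<pi> and \<pi> this is exp (\<i>\<theta>/2): the number r + x +
  \<i>y equals 2 r cos (\<theta>/2) exp (\<i>\<theta>/2), and the cosine is positive. Smoothness can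
  thus be read off without an angle function; on the slit the value is
  \<open>sgn 0 = 0\<close>.\<close>

definition half_phase :: cfun where
  "half_phase z = sgn (Complex (norm z + fst z) (snd z))"

definition slit_plane :: "plane set" where
  "slit_plane = - {z. snd z = 0 \<and> fst z \<le> 0}"

lemma open_slit_plane: "open slit_plane"
proof -
  have "closed ({z::plane. snd z = 0} \<inter> {z. fst z \<le> 0})"
    by (intro closed_Int closed_Collect_eq closed_Collect_le continuous_intros)
  then have "open (- ({z::plane. snd z = 0} \<inter> {z. fst z \<le> 0}))" by (rule open_Compl)
  then show ?thesis unfolding slit_plane_def by (simp only: Collect_conj_eq)
qed

lemma norm_plane_power2: "(norm (z::plane))\<^sup>2 = (fst z)\<^sup>2 + (snd z)\<^sup>2"
  by (cases z) (simp add: norm_Pair)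

lemma norm_add_fst_pos: "z \<in> slit_plane \<Longrightarrow> norm z + fst z > 0"
proof -
  assume z: "z \<in> slit_plane"
  show ?thesis
  proof (cases "snd z = 0")
    case True
    then have "fst z > 0" using z by (auto simp: slit_plane_def)
    then show ?thesis by (simp add: add_nonneg_pos)
  next
    case False
    then have "(fst z)\<^sup>2 < (norm z)\<^sup>2" by (simp add: norm_plane_power2)
    then have "\<bar>fst z\<bar> < norm z" using power2_less_imp_less[of "\<bar>fst z\<bar>" "norm z"] by simp
    then show ?thesis by linarith
  qed
qed

lemma smooth_on_norm_plane: "smooth_on (- {0}) (norm :: plane \<Rightarrow> real)"
proof -
  have o: "open (- {0::plane})" by auto
  have e: "norm z = sqrt (z \<bullet> z)" for z :: plane by (simp add: norm_eq_sqrt_inner)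
  show ?thesis unfolding e
    by (intro smooth_on_sqrt o smooth_on_bilinear[OF bounded_bilinear_inner o] smooth_on_bounded_linear[OF o]
        bounded_linear_ident) auto
qed

lemma smooth_on_Complex:
  assumes "open S" "smooth_on S f" "smooth_on S g"
  shows "smooth_on S (\<lambda>z. Complex (f z) (g z))"
proof -
  have "smooth_on S (\<lambda>z. complex_of_real (f z) + complex_of_real (g z) * \<i>)"
    by (intro smooth_on_add smooth_on_mult smooth_on_const assms(1)
        smooth_on_linear_compose[OF assms(1) bounded_linear_of_real] assms(2,3))
  also have "(\<lambda>z. complex_of_real (f z) + complex_of_real (g z) * \<i>) = (\<lambda>z. Complex (f z) (g z))"
    by (auto simp: complex_eq_iff)
  finally show ?thesis .
qed

lemma smooth_on_sgn:
  fixes W :: "'a::real_normed_vector \<Rightarrow> complex"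
  assumes S: "open S" and W: "smooth_on S W" and nz: "\<And>z. z \<in> S \<Longrightarrow> W z \<noteq> 0"
  shows "smooth_on S (\<lambda>z. sgn (W z))"
proof -
  have "sgn w = inverse (sqrt (w \<bullet> w)) *\<^sub>R w" for w :: complex
    by (simp add: sgn_div_norm norm_eq_sqrt_inner)
  then show ?thesis
    using nz by (simp only:) (intro smooth_on_scaleR S W smooth_on_inverse smooth_on_sqrt
        smooth_on_bilinear[OF bounded_bilinear_inner]; simp)
qed

lemma smooth_on_half_phase: "smooth_on slit_plane half_phase"
proof -
  have s: "slit_plane \<subseteq> - {0}" by (auto simp: slit_plane_def)
  show ?thesis unfolding half_phase_def[abs_def]
    by (intro smooth_on_sgn smooth_on_Complex smooth_on_add open_slit_plane
        smooth_on_subset[OF smooth_on_norm_plane s] smooth_on_bounded_linear bounded_linear_fst bounded_linear_snd)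
       (use norm_add_fst_pos in \<open>fastforce simp: complex_eq_iff\<close>)
qed

lemma norm_half_phase: "z \<in> slit_plane \<Longrightarrow> cmod (half_phase z) = 1"
  using norm_add_fst_pos[of z] by (auto simp: half_phase_def norm_sgn complex_eq_iff)

lemma norm_half_phase_le: "cmod (half_phase z) \<le> 1"
  by (simp add: half_phase_def norm_sgn)

lemma half_phase_mult_cnj:
  assumes "z \<in> slit_plane"
  shows "half_phase z * cnj (half_phase z) = 1" "cnj (half_phase z) * half_phase z = 1"
  using norm_half_phase[OF assms] complex_norm_square[of "half_phase z"] by (auto simp: mult.commute)

text \<open>With w = r + x + \<i>y one has w^2 = 2 (r + x) (x + \<i>y) and |w|^2 = 2 r (r + x); the
  common factor is positive off the slit and cancels.\<close>

lemma half_phase_square: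
  assumes "z \<in> slit_plane"
  shows "half_phase z * half_phase z = phase z"
proof -
  define r where "r = norm z"
  define x y where "x = fst z" and "y = snd z"
  have p: "r + x > 0" using norm_add_fst_pos[OF assms] by (simp add: r_def x_def)
  have r2: "r * r = x * x + y * y" using norm_plane_power2[of z] by (simp add: r_def x_def y_def power2_eq_square)
  have r: "r > 0" using assms by (auto simp: r_def slit_plane_def)
  let ?w = "Complex (r + x) y"
  have w: "?w \<noteq> 0" using p by (simp add: complex_eq_iff)
  have n: "(cmod ?w)\<^sup>2 = 2 * r * (r + x)" unfolding cmod_power2 using r2 by (simp add: power2_eq_square algebra_simps)
  have sq: "?w * ?w = of_real (2 * (r + x)) * Complex x y"
    using r2 by (simp add: complex_eq_iff algebra_simps)
  have "half_phase z * half_phase z = ?w * ?w / of_real ((cmod ?w)\<^sup>2)"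
    by (simp add: half_phase_def sgn_eq r_def x_def y_def power2_eq_square)
  also have "\<dots> = Complex x y / of_real r"
  proof -
    have "of_real (2 * r * (r + x)) = of_real (2 * (r + x)) * complex_of_real r" by simp
    moreover have "complex_of_real (2 * (r + x)) \<noteq> 0" using p by (simp only: of_real_eq_0_iff) simp
    ultimately show ?thesis unfolding n sq by (simp only: nonzero_mult_divide_mult_cancel_left) simp
  qed
  finally show ?thesis by (simp add: phase_def r_def x_def y_def)
qed

text \<open>v is a positive multiple of w exactly if v times the conjugate of w is positive. This
  compares directions without evaluating the norms inside \<open>sgn\<close>.\<close>

lemma sgn_eqI:
  fixes v w :: complex
  assumes "Im (v * cnj w) = 0" "Re (v * cnj w) > 0"
  shows "sgn v = sgn w"
proof -
  define t where "t = Re (v * cnj w) / (cmod w)\<^sup>2"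
  have w: "w \<noteq> 0" using assms(2) by auto
  have "v * cnj w = of_real (Re (v * cnj w))" using assms(1) by (simp add: complex_eq_iff)
  then have "v * (cnj w * w) = of_real (Re (v * cnj w)) * w" by (simp add: mult.assoc[symmetric])
  then have "v * of_real ((cmod w)\<^sup>2) = of_real (Re (v * cnj w)) * w"
    using complex_norm_square[of w] by (simp add: mult.commute)
  then have "v = of_real t * w" using w by (simp add: t_def field_simps)
  moreover have "t > 0" using assms(2) w by (simp add: t_def)
  ultimately show ?thesis by (simp add: sgn_mult sgn_of_real)
qed

text \<open>The same branch on the upper half plane, but smooth across the negative half axis, where
  \<open>half_phase\<close> is cut.\<close>

definition half_phase_cut_down :: cfun where
  "half_phase_cut_down z = sgn (Complex (norm z + snd z + fst z) (norm z + snd z - fst z))"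

lemma smooth_on_half_phase_cut_down:
  "smooth_on (- {z. fst z = 0 \<and> snd z \<le> 0}) half_phase_cut_down" "open (- {z::plane. fst z = 0 \<and> snd z \<le> 0})"
proof -
  let ?S = "- {z::plane. fst z = 0 \<and> snd z \<le> 0}"
  have "closed ({z::plane. fst z = 0} \<inter> {z. snd z \<le> 0})"
    by (intro closed_Int closed_Collect_eq closed_Collect_le continuous_intros)
  then have "open (- ({z::plane. fst z = 0} \<inter> {z. snd z \<le> 0}))" by (rule open_Compl)
  then show o: "open ?S" by (simp only: Collect_conj_eq)
  have s: "?S \<subseteq> - {0}" by auto
  have nz: "Complex (norm z + snd z + fst z) (norm z + snd z - fst z) \<noteq> 0" if "z \<in> ?S" for z
  proof
    assume "Complex (norm z + snd z + fst z) (norm z + snd z - fst z) = 0"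
    then have "norm z + snd z + fst z = 0" "norm z + snd z - fst z = 0" by (simp_all add: complex_eq_iff)
    then have "fst z = 0" "snd z = - norm z" by linarith+
    then show False using that by (simp add: \<open>fst z = 0\<close>)
  qed
  show "smooth_on ?S half_phase_cut_down"
    unfolding half_phase_cut_down_def[abs_def]
    by (intro smooth_on_sgn smooth_on_Complex smooth_on_add smooth_on_diff o nz
        smooth_on_subset[OF smooth_on_norm_plane s] smooth_on_bounded_linear bounded_linear_fst bounded_linear_snd)
qed

text \<open>The number under \<open>sgn\<close> is (1 + \<i>) (r + y - \<i>x), where y - \<i>x is
  the point x + \<i>y turned by -\<pi>/2 and 1 + \<i> has argument \<pi>/4. So it is again a half
  phase, with a turned cut, and for y > 0 it has the direction of r + x + \<i>y.\<close>

lemma half_phase_cut_down_upper: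
  assumes "snd z > 0"
  shows "half_phase_cut_down z = half_phase z"
proof -
  define r where "r = norm z"
  define x y where "x = fst z" and "y = snd z"
  have r2: "r * r = x * x + y * y" using norm_plane_power2[of z] by (simp add: r_def x_def y_def power2_eq_square)
  have z: "z \<in> slit_plane" using assms by (auto simp: slit_plane_def)
  have p: "r + x > 0" using norm_add_fst_pos[OF z] by (simp add: r_def x_def)
  have y: "y > 0" and r: "r > 0" using assms by (auto simp: r_def y_def)
  show ?thesis
    unfolding half_phase_cut_down_def half_phase_def r_def[symmetric] x_def[symmetric] y_def[symmetric]
  proof (rule sgn_eqI)
    show "Im (Complex (r + y + x) (r + y - x) * cnj (Complex (r + x) y)) = 0"
      using r2 by (simp add: algebra_simps)
    have "Re (Complex (r + y + x) (r + y - x) * cnj (Complex (r + x) y)) = 2 * (r * (r + x) + r * y)"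
      using r2 by (simp add: algebra_simps)
    also have "\<dots> > 0" using p y r by (simp add: add_pos_pos)
    finally show "Re (Complex (r + y + x) (r + y - x) * cnj (Complex (r + x) y)) > 0" .
  qed
qed

lemma half_phase_cut_down_negative:
  assumes "x < 0"
  shows "half_phase_cut_down (x, 0) = \<i>"
proof -
  have "half_phase_cut_down (x, 0) = sgn (Complex 0 (- 2 * x))"
    using assms by (simp add: half_phase_cut_down_def norm_Pair)
  also have "\<dots> = sgn \<i>" by (rule sgn_eqI) (use assms in auto)
  finally show ?thesis by (simp add: sgn_eq)
qed

lemma half_phase_mirror: "half_phase (x, - y) = cnj (half_phase (x, y))"
  by (simp add: half_phase_def norm_Pair sgn_eq complex_eq_iff cmod_def)

text \<open>The reflection sends \<theta> to \<pi> - \<theta>, both between 0 and \<pi> for y > 0,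
  and exp (\<i>(\<pi> - \<theta>)/2) = \<i> exp (-\<i>\<theta>/2).\<close>

lemma half_phase_reflect:
  assumes "y > 0"
  shows "half_phase (- x, y) = \<i> * cnj (half_phase (x, y))"
proof -
  define r where "r = norm (x, y)"
  have r2: "r * r = x * x + y * y" using norm_plane_power2[of "(x, y)"] by (simp add: r_def power2_eq_square)
  have r: "r > 0" using assms by (auto simp: r_def prod_eq_iff)
  have rr: "norm (- x, y) = r" by (simp add: r_def norm_Pair)
  have "half_phase (- x, y) = sgn (Complex y (r + x))"
    unfolding half_phase_def rr fst_conv snd_conv
  proof (rule sgn_eqI)
    show "Im (Complex (r + - x) y * cnj (Complex y (r + x))) = 0" using r2 by (simp add: algebra_simps)
    show "Re (Complex (r + - x) y * cnj (Complex y (r + x))) > 0"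
      using mult_pos_pos[OF r assms] by (simp add: algebra_simps)
  qed
  also have "Complex y (r + x) = \<i> * cnj (Complex (r + x) y)" by (simp add: complex_eq_iff)
  also have "sgn \<dots> = \<i> * cnj (half_phase (x, y))"
    by (simp add: half_phase_def r_def sgn_eq norm_mult)
  finally show ?thesis .
qed

text \<open>The potential is half the gradient of \<theta>, hence the factor 2 \<i> A for exp
  (\<i>\<theta>). The proof differentiates the quotient defining \<open>phase\<close> instead of an
  angle.\<close>

lemma phase_has_derivative:
  assumes "z \<noteq> 0"
  shows "phase differentiable at z"
    and "dirderiv (1, 0) phase z = 2 * \<i> * of_real (AB_A1 z) * phase z"
    and "dirderiv (0, 1) phase z = 2 * \<i> * of_real (AB_A2 z) * phase z"
proof -
  define r where "r = norm z"
  define x y where "x = fst z" and "y = snd z"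
  have z: "z = (x, y)" by (simp add: x_def y_def)
  have r: "r > 0" using assms by (simp add: r_def)
  have r2: "r * r = x * x + y * y" using norm_plane_power2[of z] by (simp add: r_def x_def y_def power2_eq_square)
  have inner: "z \<bullet> h = x * fst h + y * snd h" for h by (simp add: z inner_prod_def)
  have n: "(norm has_derivative (\<lambda>h. (x * fst h + y * snd h) / r)) (at z)"
    using has_derivative_norm[of z] assms
    by (simp add: inner sgn_div_norm inner_commute[of _ "z"] r_def divide_inverse mult.commute)
  have N: "((\<lambda>z::plane. Complex (fst z) (snd z)) has_derivative (\<lambda>h. Complex (fst h) (snd h))) (at z)"
    unfolding Complex_eq by (auto intro!: derivative_eq_intros)
  have "((\<lambda>z. Complex (fst z) (snd z) * of_real (inverse (norm z))) has_derivative
      (\<lambda>h. Complex x y * of_real (- (inverse r * ((x * fst h + y * snd h) / r) * inverse r)) +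
         Complex (fst h) (snd h) * of_real (inverse r))) (at z)"
    using has_derivative_mult[OF N has_derivative_of_real[OF Deriv.has_derivative_inverse[OF _ n]]] r
    by (simp add: r_def x_def y_def)
  then have d: "(phase has_derivative
      (\<lambda>h. Complex x y * of_real (- (inverse r * ((x * fst h + y * snd h) / r) * inverse r)) +
         Complex (fst h) (snd h) * of_real (inverse r))) (at z)"
    by (simp add: phase_def[abs_def] divide_inverse)
  then show "phase differentiable at z" by (auto simp: differentiable_def)
  \<comment> \<open>With s = 1/r all terms become polynomials, and s^2 (x^2 + y^2) = 1 is the only
    relation left; it is prepared in the form in which s^3 arises from differentiating 1/r.\<close>
  define s where "s = inverse r"
  have "s * s * (x * x + y * y) = 1" using r by (simp add: s_def field_simps flip: r2)
  then have "s * (s * s * (x * x + y * y)) = s" by simp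
  then have s3: "s * s * s * x * x + s * s * s * y * y = s" by (simp add: algebra_simps)
  have ph: "phase z = Complex x y * of_real s" by (simp add: phase_def x_def y_def s_def r_def divide_inverse)
  have ir: "inverse r = s" "a / r = a * s" for a by (auto simp: s_def divide_inverse)
  have "x\<^sup>2 + y\<^sup>2 = r * r" using r2 by (simp add: power2_eq_square)
  then have A: "AB_A1 z = - y * (s * s) / 2" "AB_A2 z = x * (s * s) / 2"
    using r by (simp_all add: AB_A1_def AB_A2_def z s_def field_simps)
  show "dirderiv (1, 0) phase z = 2 * \<i> * of_real (AB_A1 z) * phase z"
    unfolding dirderiv_eqI[OF d] ph A ir using s3 by (simp add: complex_eq_iff algebra_simps)
  show "dirderiv (0, 1) phase z = 2 * \<i> * of_real (AB_A2 z) * phase z"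
    unfolding dirderiv_eqI[OF d] ph A ir using s3 by (simp add: complex_eq_iff algebra_simps)
qed

text \<open>Differentiating the identity q^2 = \<open>phase\<close> gives 2 q \<partial>q = 2 \<i> A
  q^2, and q is nonzero off the slit.\<close>

lemma dirderiv_half_phase:
  assumes z: "z \<in> slit_plane"
  shows "half_phase differentiable at z"
    and "dirderiv (1, 0) half_phase z = \<i> * of_real (AB_A1 z) * half_phase z"
    and "dirderiv (0, 1) half_phase z = \<i> * of_real (AB_A2 z) * half_phase z"
proof -
  show d: "half_phase differentiable at z" by (rule smooth_on_differentiable[OF smooth_on_half_phase z])
  have z0: "z \<noteq> 0" using z by (auto simp: slit_plane_def)
  have nz: "half_phase z \<noteq> 0" using norm_half_phase[OF z] by auto
  have sq: "2 * half_phase z * dirderiv e half_phase z = dirderiv e phase z" for e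
  proof -
    have "dirderiv e (\<lambda>z. half_phase z * half_phase z) z = dirderiv e phase z"
      by (rule dirderiv_cong[OF open_slit_plane z])
         (use d half_phase_square in \<open>auto intro: differentiable_mult\<close>)
    then show ?thesis by (simp add: dirderiv_mult[OF d d] algebra_simps)
  qed
  have solve: "dirderiv e half_phase z = \<i> * of_real a * half_phase z"
    if "dirderiv e phase z = 2 * \<i> * of_real a * phase z" for e a
  proof -
    have "2 * half_phase z * dirderiv e half_phase z = 2 * half_phase z * (\<i> * of_real a * half_phase z)"
      unfolding sq that half_phase_square[OF z, symmetric] by simp
    then show ?thesis using nz by simp
  qed
  show "dirderiv (1, 0) half_phase z = \<i> * of_real (AB_A1 z) * half_phase z"
    by (rule solve[OF phase_has_derivative(2)[OF z0]])
  show "dirderiv (0, 1) half_phase z = \<i> * of_real (AB_A2 z) * half_phase z"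
    by (rule solve[OF phase_has_derivative(3)[OF z0]])
qed

lemma dirderiv_compose_linear:
  assumes L: "bounded_linear L" and f: "f differentiable at (L z)"
  shows "(\<lambda>z. f (L z)) differentiable at z" "dirderiv e (\<lambda>z. f (L z)) z = dirderiv (L e) f (L z)"
proof -
  have "((\<lambda>z. f (L z)) has_derivative (\<lambda>h. dirderiv (L h) f (L z))) (at z)"
    by (rule has_derivative_compose[OF bounded_linear_imp_has_derivative[OF L]])
       (use f in \<open>simp add: frechet_derivative_works\<close>)
  then show "(\<lambda>z. f (L z)) differentiable at z" "dirderiv e (\<lambda>z. f (L z)) z = dirderiv (L e) f (L z)"
    by (auto simp: differentiable_def dirderiv_eqI)
qed

lemma dirderiv_uminus_direction:
  assumes "f differentiable at z"
  shows "dirderiv (- e) f z = - dirderiv e f z"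
proof -
  have "bounded_linear (\<lambda>e. dirderiv e f z)"
    using assms by (simp add: frechet_derivative_works has_derivative_bounded_linear)
  from linear_neg[OF bounded_linear.linear[OF this]] show ?thesis .
qed

section \<open>Symmetrization of test functions\<close>

definition mirror :: "plane \<Rightarrow> plane" where "mirror z = (fst z, - snd z)"
definition upfold :: "plane \<Rightarrow> plane" where "upfold z = (fst z, \<bar>snd z\<bar>)"

text \<open>The coefficients intertwining \<open>(w, \<partial>\<^sub>1 w, \<partial>\<^sub>2 w)\<close> on the upper half with \<open>(u, D\<^sub>1 u, D\<^sub>2 u)\<close>, where
  \<open>u\<close> is the even extension of \<open>w\<close> times the half phase. The value \<open>0\<close> on the axis keeps the products Borel
  measurable, since elements of \<open>L\<^sup>2\<close> of the upper half are arbitrary on the axis.\<close>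

definition coeff0 :: cfun where "coeff0 z = (if snd z = 0 then 0 else half_phase z)"
definition coeff1 :: cfun where "coeff1 z = - \<i> * coeff0 z"
definition coeff2 :: cfun where "coeff2 z = - \<i> * of_real (sgn (snd z)) * coeff0 z"

abbreviation extend :: "cfun \<Rightarrow> cfun \<Rightarrow> cfun" where
  "extend c f \<equiv> (\<lambda>z. c z * f (upfold z))"
abbreviation symmetrize :: "cfun \<Rightarrow> cfun \<Rightarrow> cfun" where
  "symmetrize c g \<equiv> (\<lambda>z. cnj (c z) * g z + cnj (c (mirror z)) * g (mirror z))"

lemma half_phase_measurable: "half_phase \<in> borel_measurable borel"
proof -
  have "half_phase = (\<lambda>z. inverse (cmod (complex_of_real (norm z + fst z) + \<i> * complex_of_real (snd z))) *\<^sub>R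
      (complex_of_real (norm z + fst z) + \<i> * complex_of_real (snd z)))"
    by (simp add: half_phase_def[abs_def] sgn_div_norm Complex_eq)
  also have "\<dots> \<in> borel_measurable borel"
  proof -
    have [measurable]: "(\<lambda>z::plane. complex_of_real (norm z + fst z) + \<i> * complex_of_real (snd z)) \<in> borel_measurable borel"
      by (intro borel_measurable_continuous_onI continuous_intros)
    show ?thesis by measurable
  qed
  finally show ?thesis .
qed

lemma coeff_measurable:
  "coeff0 \<in> borel_measurable borel" "coeff1 \<in> borel_measurable borel" "coeff2 \<in> borel_measurable borel"
proof -
  note [measurable] = half_phase_measurable
  have [measurable]: "(fst :: plane \<Rightarrow> real) \<in> borel_measurable borel" "(snd :: plane \<Rightarrow> real) \<in> borel_measurable borel"
    by (intro borel_measurable_continuous_onI continuous_intros)+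
  show [measurable]: "coeff0 \<in> borel_measurable borel" unfolding coeff0_def[abs_def] by measurable
  show "coeff1 \<in> borel_measurable borel" unfolding coeff1_def[abs_def] by measurable
  show "coeff2 \<in> borel_measurable borel" unfolding coeff2_def[abs_def] sgn_real_def by measurable
qed

lemma coeff_norm_le: "cmod (coeff0 z) \<le> 1" "cmod (coeff1 z) \<le> 1" "cmod (coeff2 z) \<le> 1"
  using norm_half_phase_le[of z] by (auto simp: coeff0_def coeff1_def coeff2_def norm_mult sgn_real_def)

lemma coeff_axis: "snd z = 0 \<Longrightarrow> coeff0 z = 0" "snd z = 0 \<Longrightarrow> coeff1 z = 0" "snd z = 0 \<Longrightarrow> coeff2 z = 0"
  by (auto simp: coeff0_def coeff1_def coeff2_def)

lemma lborel_iso_mirror: "lborel_iso mirror mirror"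
  using lborel_iso_linear_scale[of 1 "-1"] by (simp add: mirror_def[abs_def] case_prod_unfold)

lemma bounded_linear_mirror: "bounded_linear mirror"
  unfolding mirror_def[abs_def]
  by (intro bounded_linear_Pair bounded_linear_fst bounded_linear_minus[OF bounded_linear_snd])

lemma mirror_mirror [simp]: "mirror (mirror z) = z"
  by (simp add: mirror_def)

text \<open>The half-domain argument is carried out for the upper half only. It is instantiated a
  second time for the domain turned by a right angle, with b in the role of a, which yields the left
  half.\<close>

locale mirror_domain =
  fixes \<Omega> :: "plane set" and a :: real
  assumes bounded: "bounded \<Omega>" and convex: "convex \<Omega>" and "open": "open \<Omega>" and origin: "0 \<in> \<Omega>"
    and mirror: "\<And>z. z \<in> \<Omega> \<Longrightarrow> mirror z \<in> \<Omega>"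
    and axis: "\<And>x. (x, 0) \<in> \<Omega> \<longleftrightarrow> - a / 2 < x \<and> x < a / 2"
begin

definition "upper = \<Omega> \<inter> {z. snd z > 0}"
definition "punctured = \<Omega> - {0}"
definition "ray = {0<..a / 2} \<times> {0::real}"

lemma upper_open: "open upper" and upper_bounded: "bounded upper" and upper_borel: "upper \<in> sets borel"
proof -
  show o: "open upper" unfolding upper_def by (intro open_Int "open" open_Collect_less continuous_intros)
  show "bounded upper" using bounded by (auto simp: upper_def intro: bounded_subset)
  show "upper \<in> sets borel" using o by simp
qed

lemma punctured_open: "open punctured" and punctured_bounded: "bounded punctured"
  and punctured_borel: "punctured \<in> sets borel" and punctured_0: "0 \<notin> punctured"
proof -
  show o: "open punctured" unfolding punctured_def by (intro open_Diff "open") auto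
  show "bounded punctured" using bounded by (auto simp: punctured_def intro: bounded_subset)
  show "punctured \<in> sets borel" using o by simp
qed (simp add: punctured_def)

lemma mirror_punctured: "z \<in> punctured \<longleftrightarrow> mirror z \<in> punctured"
proof -
  have "mirror z \<in> punctured" if "z \<in> punctured" for z
    using that mirror[of z] by (auto simp: punctured_def mirror_def prod_eq_iff)
  from this[of z] this[of "mirror z"] show ?thesis by auto
qed

lemma fold_adjoint:
  assumes c: "c \<in> borel_measurable borel" "\<And>z. cmod (c z) \<le> 1" "\<And>z. snd z = 0 \<Longrightarrow> c z = 0"
  shows "L2_adjoint upper punctured (extend c) (symmetrize c)"
proof (rule L2_adjoint_fold[OF lborel_iso_mirror _ punctured_borel _ upper_borel])
  show "upfold \<in> borel_measurable borel"
    unfolding upfold_def[abs_def] by (intro borel_measurable_continuous_onI continuous_intros)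
  show "upper \<subseteq> punctured" by (auto simp: upper_def punctured_def)
  show "c z = 0" if "z \<in> punctured" "z \<notin> upper" "mirror z \<notin> upper" for z
  proof -
    have "z \<in> \<Omega>" "mirror z \<in> \<Omega>" using that mirror by (auto simp: punctured_def)
    then have "\<not> snd z > 0" "\<not> snd z < 0" using that by (auto simp: upper_def mirror_def)
    then show ?thesis using c(3) by simp
  qed
qed (use c mirror_punctured in \<open>auto simp: upper_def upfold_def mirror_def\<close>)

lemmas fold_adjoint0 = fold_adjoint[OF coeff_measurable(1) coeff_norm_le(1) coeff_axis(1)]
lemmas fold_adjoint1 = fold_adjoint[OF coeff_measurable(2) coeff_norm_le(2) coeff_axis(2)]
lemmas fold_adjoint2 = fold_adjoint[OF coeff_measurable(3) coeff_norm_le(3) coeff_axis(3)]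

lemma upper_slit_plane: "z \<in> upper \<Longrightarrow> z \<in> slit_plane" "z \<in> upper \<Longrightarrow> mirror z \<in> slit_plane"
  by (auto simp: upper_def slit_plane_def mirror_def)

text \<open>The mixed core asks for smoothness on the whole plane, so the symmetrization is rebuilt
  from the branch that is smooth across the negative half axis, and then cut off below the
  axis.\<close>

lemma symmetrize_smooth:
  assumes \<psi>: "\<psi> \<in> test_functions punctured"
  obtains P where "P \<in> mixed_functions upper ray"
    "\<And>z. snd z > 0 \<Longrightarrow> P z = cnj (half_phase z) * \<psi> z + half_phase z * \<psi> (mirror z)"
proof -
  obtain S where S: "smooth \<psi>" "compact S" "S \<subseteq> punctured" "\<And>z. z \<notin> S \<Longrightarrow> \<psi> z = 0"
    using test_functionsE[OF \<psi>] by blast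
  have "open (- S)" "0 \<in> - S" using S(2,3) punctured_0 by (auto simp: compact_imp_closed)
  then obtain \<rho> where \<rho>: "\<rho> > 0" "ball 0 \<rho> \<subseteq> - S" using open_contains_ball by blast
  define Q where "Q = half_phase_cut_down"
  \<comment> \<open>The cutoff is 1 for y \<ge> 0 and 0 for y \<le> -\<rho>/2.\<close>
  define P where "P z = complex_of_real (step (2 + 2 / \<rho> * (snd z - 0))) *
     (cnj (Q z) * \<psi> z + Q z * \<psi> (mirror z))" for z
  let ?W1 = "- {z::plane. fst z = 0 \<and> snd z \<le> 0}"
  let ?W2 = "{z::plane. snd z < - \<rho> / 2}"
  note o1 = smooth_on_half_phase_cut_down(2)
  have o2: "open ?W2" by (intro open_Collect_less continuous_intros)
  have Qs: "smooth_on ?W1 Q" unfolding Q_def by (rule smooth_on_half_phase_cut_down(1))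
  have psi: "smooth_on W \<psi>" for W using S(1) smooth_on_subset[of UNIV \<psi> W] by (simp add: smooth_on_UNIV)
  have m: "smooth_on UNIV (\<lambda>z. \<psi> (mirror z))"
    by (rule smooth_on_compose[OF open_UNIV open_UNIV _ psi smooth_on_bounded_linear[OF open_UNIV bounded_linear_mirror]]) simp
  have psim: "smooth_on W (\<lambda>z. \<psi> (mirror z))" for W using m smooth_on_subset by blast
  have st: "smooth_on W (\<lambda>z::plane. complex_of_real (step (2 + 2 / \<rho> * (snd z - 0))))" for W
  proof -
    have "smooth_on UNIV (\<lambda>z::plane. step (2 + 2 / \<rho> * (snd z - 0)))"
      using smooth_step_affine[OF bounded_linear_snd] unfolding smooth_on_UNIV .
    from smooth_on_linear_compose[OF open_UNIV bounded_linear_of_real this] show ?thesis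
      by (rule smooth_on_subset) simp
  qed
  have 1: "smooth_on ?W1 P" unfolding P_def[abs_def]
    by (intro smooth_on_mult smooth_on_add o1 st psi psim Qs smooth_on_linear_compose[OF o1 bounded_linear_cnj])
  have P2: "P z = 0" if "z \<in> ?W2" for z
  proof -
    have "2 + 2 / \<rho> * (snd z - 0) \<le> 1" using that \<rho>(1) by (simp add: field_simps)
    then show ?thesis unfolding P_def by (simp only: step_le) simp
  qed
  have nm: "norm (mirror z) = norm z" for z by (simp add: mirror_def norm_prod_def)
  have P3: "P z = 0" if "z \<in> ball 0 \<rho>" for z
  proof -
    have "mirror z \<in> ball 0 \<rho>" using that nm[of z] by simp
    with that \<rho>(2) have "z \<notin> S" "mirror z \<notin> S" by blast+
    then show ?thesis by (simp add: P_def S(4))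
  qed
  have 2: "smooth_on ?W2 P" by (rule smooth_on_cong[OF o2 smooth_on_const[of _ 0]]) (use P2 in auto)
  have 3: "smooth_on (ball 0 \<rho>) P" by (rule smooth_on_cong[OF open_ball smooth_on_const[of _ 0]]) (use P3 in auto)
  \<comment> \<open>The first two sets miss only the piece of the cut with -\<rho>/2 \<le> y \<le>
    0; it lies in the ball around the origin on which \<psi> vanishes.\<close>
  have "z \<in> ?W1 \<union> ?W2 \<union> ball 0 \<rho>" for z
  proof (cases "fst z = 0 \<and> - \<rho> / 2 \<le> snd z \<and> snd z \<le> 0")
    case True
    then have "norm z = \<bar>snd z\<bar>" by (cases z) (simp add: norm_Pair)
    then show ?thesis using True \<rho>(1) by auto
  qed auto
  then have U: "?W1 \<union> ?W2 \<union> ball 0 \<rho> = UNIV" by blast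
  have sm: "smooth P"
    using smooth_on_Un[OF open_Un[OF o1 o2] open_ball smooth_on_Un[OF o1 o2 1 2] 3]
    unfolding U by (simp add: smooth_on_UNIV)
  have "P z = 0" if z: "z \<in> frontier upper - ray" for z
  proof -
    have zc: "z \<in> closure upper" "z \<notin> upper" using z upper_open by (auto simp: frontier_def interior_open)
    have "closure upper \<subseteq> {z. 0 \<le> snd z}"
      by (rule closure_minimal) (auto simp: upper_def intro!: closed_Collect_le continuous_intros)
    then have s: "snd z \<ge> 0" using zc(1) by auto
    show ?thesis
    proof (cases "z \<in> \<Omega>")
      case False
      then have "mirror z \<notin> \<Omega>" using mirror[of "mirror z"] by auto
      with False have "\<psi> z = 0" "\<psi> (mirror z) = 0"
        using test_functions_outside[OF \<psi>] by (auto simp: punctured_def)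
      then show ?thesis by (simp add: P_def)
    next
      case True
      then have "snd z = 0" using zc(2) s by (auto simp: upper_def)
      then have zx: "z = (fst z, 0)" by (simp add: prod_eq_iff)
      have x: "fst z \<le> 0"
      proof (rule ccontr)
        assume "\<not> fst z \<le> 0"
        then have "z \<in> ray" using True zx axis[of "fst z"] \<open>snd z = 0\<close> by (auto simp: ray_def mem_Times_iff)
        then show False using z by simp
      qed
      have mz: "mirror z = z" by (subst zx, subst (2) zx) (simp add: mirror_def \<open>snd z = 0\<close>)
      show ?thesis
      proof (cases "fst z = 0")
        case True
        then have "z = 0" using zx by (simp add: zero_prod_def)
        then have "\<psi> z = 0" using test_functions_outside[OF \<psi>] punctured_0 by simp
        then show ?thesis by (simp add: P_def mz)
      next
        case False
        \<comment> \<open>The Dirichlet condition on the slit: the point is its own mirror image, so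
          the bracket is \<psi> times the sum of \<i> and its conjugate, which is 0.\<close>
        then have "Q z = \<i>" using x half_phase_cut_down_negative[of "fst z"] zx by (simp add: Q_def)
        then show ?thesis by (simp add: P_def mz)
      qed
    qed
  qed
  with sm have "P \<in> mixed_functions upper ray" by (simp add: mixed_functions_def)
  moreover have "P z = cnj (half_phase z) * \<psi> z + half_phase z * \<psi> (mirror z)" if "snd z > 0" for z
  proof -
    have "step (2 + 2 / \<rho> * (snd z - 0)) = 1" using that \<rho>(1) by (intro step_ge) simp
    then show ?thesis unfolding P_def Q_def half_phase_cut_down_upper[OF that] by simp
  qed
  ultimately show thesis by (rule that)
qed

text \<open>Because \<partial>q = \<i> A q, the ordinary derivatives of the two terms are again
  phases times magnetic derivatives of \<psi>. For the mirrored term this works because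
  \<open>AB_A1\<close> is odd and \<open>AB_A2\<close> even in y; the y-derivative brings the
  additional sign built into \<open>coeff2\<close>.\<close>

lemma symmetrize_closure:
  assumes \<psi>: "\<psi> \<in> test_functions punctured"
  shows "(symmetrize coeff0 \<psi>, symmetrize coeff1 (AB_D1 \<psi>), symmetrize coeff2 (AB_D2 \<psi>)) \<in> mixed_closure upper ray"
proof -
  obtain P where P: "P \<in> mixed_functions upper ray"
    "\<And>z. snd z > 0 \<Longrightarrow> P z = cnj (half_phase z) * \<psi> z + half_phase z * \<psi> (mirror z)"
    using symmetrize_smooth[OF \<psi>] by blast
  have hm: "half_phase (mirror z) = cnj (half_phase z)" for z
    using half_phase_mirror[of "fst z" "snd z"] by (simp add: mirror_def)
  have c0: "coeff0 z = half_phase z" "coeff0 (mirror z) = cnj (half_phase z)"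
    and c1: "coeff1 z = - \<i> * half_phase z" "coeff1 (mirror z) = - \<i> * cnj (half_phase z)"
    and c2: "coeff2 z = - \<i> * half_phase z" "coeff2 (mirror z) = \<i> * cnj (half_phase z)" if "z \<in> upper" for z
    using that hm[of z] by (auto simp: coeff0_def coeff1_def coeff2_def upper_def mirror_def)
  have d: "\<psi> differentiable at z" for z by (rule smooth_differentiable[OF test_functions_smooth[OF \<psi>]])
  note dm = dirderiv_compose_linear[OF bounded_linear_mirror d]
  have m: "mirror (1, 0) = (1, 0)" "mirror (0, 1) = - (0, 1)" by (simp_all add: mirror_def)
  have A: "AB_A1 (mirror z) = - AB_A1 z" "AB_A2 (mirror z) = AB_A2 z" for z
    by (simp_all add: AB_A1_def AB_A2_def mirror_def case_prod_unfold)
  have der: "dirderiv e P z = cnj (half_phase z) * dirderiv e \<psi> z + cnj (dirderiv e half_phase z) * \<psi> z +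
     (half_phase z * dirderiv (mirror e) \<psi> (mirror z) + dirderiv e half_phase z * \<psi> (mirror z))"
    if z: "z \<in> upper" for e z
  proof -
    note h = dirderiv_half_phase(1)[OF upper_slit_plane(1)[OF z]]
    have hc: "(\<lambda>z. cnj (half_phase z)) differentiable at z"
      using has_derivative_cnj h unfolding differentiable_def by blast
    have 1: "(\<lambda>z. cnj (half_phase z) * \<psi> z) differentiable at z"
      and 2: "(\<lambda>z. half_phase z * \<psi> (mirror z)) differentiable at z"
      by (intro differentiable_mult hc d h dm(1))+
    have "dirderiv e (\<lambda>z. cnj (half_phase z) * \<psi> z + half_phase z * \<psi> (mirror z)) z = dirderiv e P z"
      by (rule dirderiv_cong[OF upper_open z]) (use P(2) in \<open>auto simp: upper_def intro!: differentiable_add 1 2\<close>)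
    then show ?thesis
      by (simp add: dirderiv_add[OF 1 2] dirderiv_mult[OF hc d] dirderiv_mult[OF h dm(1)] dirderiv_cnj[OF h] dm(2))
  qed
  show ?thesis
  proof (rule graph_closure_cong[OF graph_closure_base[OF L2_graph_mixed[OF upper_open upper_bounded] P(1)]])
    fix z assume z: "z \<in> upper"
    note h = dirderiv_half_phase[OF upper_slit_plane(1)[OF z]]
    show "P z = symmetrize coeff0 \<psi> z" using z P(2)[of z] by (simp add: c0 upper_def)
    show "dirderiv (1, 0) P z = symmetrize coeff1 (AB_D1 \<psi>) z"
      unfolding der[OF z] m h c1[OF z] by (simp add: mag_D_def A algebra_simps)
    show "dirderiv (0, 1) P z = symmetrize coeff2 (AB_D2 \<psi>) z"
      unfolding der[OF z] m h c2[OF z] dirderiv_uminus_direction[OF d] by (simp add: mag_D_def A algebra_simps)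
  qed
qed

end

section \<open>Truncation near the zero set\<close>

text \<open>A zero with nonzero derivative is isolated among the zeros, and a set of isolated points
  of the line is countable.\<close>

lemma countable_transversal_zeros:
  fixes g :: "real \<Rightarrow> complex"
  assumes d: "\<And>t. (g has_vector_derivative g' t) (at t)" and c: "continuous_on UNIV g'"
  shows "countable {t. g t = 0 \<and> g' t \<noteq> 0}"
proof -
  let ?D = "{t. g' t \<noteq> 0}" and ?Z = "{t. g t = 0}"
  have D: "open ?D" using c by (intro open_Collect_neq) auto
  have "\<not> t islimpt ?Z" if "t \<in> ?D" for t
  proof -
    have "\<forall>\<^sub>F s in at t. g s \<noteq> 0"
    proof (cases "g t = 0")
      case False
      have "(g \<longlongrightarrow> g t) (at t)"
        using has_vector_derivative_continuous[OF d[of t]] by (simp add: continuous_at)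
      from tendsto_imp_eventually_ne[OF this False] show ?thesis .
    next
      case True
      \<comment> \<open>If g s were 0 as well, the quotient would equal the norm of
        \<open>g' t\<close>; differentiability makes it smaller near t.\<close>
      have "((\<lambda>s. norm ((g s - g t) - (s - t) *\<^sub>R g' t) / norm (s - t)) \<longlongrightarrow> 0) (at t)"
        using d[of t] unfolding has_vector_derivative_def has_derivative_iff_norm by simp
      then have "\<forall>\<^sub>F s in at t. norm ((g s - g t) - (s - t) *\<^sub>R g' t) / norm (s - t) < norm (g' t)"
        using that by (intro order_tendstoD(2)) auto
      moreover have "\<forall>\<^sub>F s in at t. s \<noteq> t" by (simp add: eventually_at_filter)
      ultimately show ?thesis by eventually_elim (auto simp: True)
    qed
    then show ?thesis by (simp add: islimpt_iff_eventually)
  qed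
  then have "?Z sparse_in ?D" using sparse_in_open[OF D] by blast
  from sparse_imp_countable[OF D this] show ?thesis by (simp add: Collect_conj_eq Int_commute)
qed

lemma AE_countable_complement: "countable A \<Longrightarrow> AE t in lborel. (t::real) \<notin> A"
  using countable_imp_null_set_lborel[of A] by (rule AE_not_in)

lemma AE_plane_lines:
  assumes P: "{z. P z} \<in> sets (borel :: plane measure)"
    and ae: "(\<forall>y. AE x in lborel. P (x, y)) \<or> (\<forall>x. AE y in lborel. P (x, y))"
  shows "AE z in (lborel :: plane measure). P z"
proof -
  have s: "{z \<in> space (lborel \<Otimes>\<^sub>M lborel). P (fst z, snd z)} \<in> sets (lborel \<Otimes>\<^sub>M lborel :: plane measure)"
    unfolding lborel_prod using P by simp
  show ?thesis using ae
  proof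
    assume "\<forall>y. AE x in lborel. P (x, y)"
    then have "AE y in lborel. AE x in lborel. P (x, y)" by simp
    then have "AE x in lborel. AE y in lborel. P (x, y)"
      by (subst lborel_pair.AE_commute[of "\<lambda>x y. P (x, y)"]) (use s in auto)
    then have "AE z in lborel \<Otimes>\<^sub>M lborel. P z"
      by (intro lborel_pair.AE_pair_measure) (use s in auto)
    then show ?thesis unfolding lborel_prod .
  next
    assume "\<forall>x. AE y in lborel. P (x, y)"
    then have "AE z in lborel \<Otimes>\<^sub>M lborel. P z"
      by (intro lborel_pair.AE_pair_measure) (use s in auto)
    then show ?thesis unfolding lborel_prod .
  qed
qed

text \<open>On each line in direction e the exceptional points are transversal zeros, hence
  countably many.\<close>

lemma AE_derivative_zero_on_zeros:
  fixes f :: cfun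
  assumes f: "smooth f" and e: "e \<in> {(1, 0), (0, 1)}"
  shows "AE z in lborel. f z = 0 \<longrightarrow> dirderiv e f z = 0"
proof (rule AE_plane_lines)
  note c = smooth_continuous[OF f, of UNIV] smooth_continuous[OF smooth_dirderiv[OF f, of e], of UNIV]
  have "{z. f z = 0 \<longrightarrow> dirderiv e f z = 0} = {z. f z \<noteq> 0} \<union> {z. dirderiv e f z = 0}" by auto
  also have "\<dots> \<in> sets borel"
    by (rule sets.Un[OF borel_open[OF open_Collect_neq[OF c(1) continuous_on_const]]
          borel_closed[OF closed_Collect_eq[OF c(2) continuous_on_const]]])
  finally show "{z. f z = 0 \<longrightarrow> dirderiv e f z = 0} \<in> sets borel" .
  have 1: "AE t in lborel. f (p t) = 0 \<longrightarrow> dirderiv e f (p t) = 0"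
    if p: "\<And>t. (p has_derivative (\<lambda>h. h *\<^sub>R e)) (at t)" for p :: "real \<Rightarrow> plane"
  proof -
    have "continuous_on UNIV p" using p by (intro continuous_at_imp_continuous_on ballI has_derivative_continuous)
    then have "continuous_on UNIV (\<lambda>t. dirderiv e f (p t))"
      by (rule continuous_on_compose2[OF c(2)]) simp
    from AE_countable_complement[OF countable_transversal_zeros[OF smooth_has_vector_derivative_line[OF f p] this]]
    show ?thesis by eventually_elim auto
  qed
  show "(\<forall>y. AE x in lborel. f (x, y) = 0 \<longrightarrow> dirderiv e f (x, y) = 0) \<or>
    (\<forall>x. AE y in lborel. f (x, y) = 0 \<longrightarrow> dirderiv e f (x, y) = 0)"
  proof (cases "e = (1, 0)")
    case True
    have "AE x in lborel. f (x, y) = 0 \<longrightarrow> dirderiv e f (x, y) = 0" for y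
      by (rule 1) (auto intro!: derivative_eq_intros simp: True)
    then show ?thesis by blast
  next
    case False
    then have "e = (0, 1)" using e by auto
    then have "AE y in lborel. f (x, y) = 0 \<longrightarrow> dirderiv e f (x, y) = 0" for x
      by (intro 1) (auto intro!: derivative_eq_intros)
    then show ?thesis by blast
  qed
qed

lemma AE_off_axis: "AE z in (lborel :: plane measure). snd z \<noteq> 0"
proof (rule AE_plane_lines)
  show "{z::plane. snd z \<noteq> 0} \<in> sets borel"
    by (intro borel_open open_Collect_neq continuous_intros)
  show "(\<forall>y. AE x in lborel. snd (x, y) \<noteq> 0) \<or> (\<forall>x. AE y in lborel. snd (x, y) \<noteq> 0)"
    by (intro disjI2 allI) (simp add: AE_lborel_singleton)
qed

text \<open>The truncation converges to \<open>\<phi>\<close> together with its first derivatives almost everywhere, because the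
  derivatives of \<open>\<phi>\<close> vanish almost everywhere on its zero set.\<close>

definition truncate :: "cfun \<Rightarrow> nat \<Rightarrow> cfun" where
  "truncate \<phi> n z = of_real (step (real n * (cmod (\<phi> z))\<^sup>2)) * \<phi> z"

lemma step_has_derivative: "(step has_real_derivative deriv step s) (at s)"
proof -
  have "step differentiable at s" using smooth_differentiable[OF smooth_step] .
  then show ?thesis
    by (metis DERIV_deriv_iff_real_differentiable)
qed

lemma deriv_step_eq_0: "s < 1 \<Longrightarrow> deriv step s = 0" "s > 2 \<Longrightarrow> deriv step s = 0"
proof -
  have "(step has_real_derivative 0) (at s)" if "s < 1"
    by (rule DERIV_cong_ev[THEN iffD1, OF refl _ refl DERIV_const[of 0]])
       (use that in \<open>auto simp: eventually_nhds step_le intro!: exI[of _ "{..<1}"]\<close>)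
  then show "s < 1 \<Longrightarrow> deriv step s = 0" using DERIV_imp_deriv by blast
  have "(step has_real_derivative 0) (at s)" if "s > 2"
    by (rule DERIV_cong_ev[THEN iffD1, OF refl _ refl DERIV_const[of 1]])
       (use that in \<open>auto simp: eventually_nhds step_ge intro!: exI[of _ "{2<..}"]\<close>)
  then show "s > 2 \<Longrightarrow> deriv step s = 0" using DERIV_imp_deriv by blast
qed

text \<open>\<open>step\<close> is constant on both sides of the interval from 1 to 2. The product
  with s is the quantity that occurs in the derivative of a truncation, where s = n |\<phi>|^2, and
  its boundedness makes the estimate uniform in n.\<close>

lemma deriv_step_bounded: obtains C where "C \<ge> 0" "\<And>s. \<bar>s * deriv step s\<bar> \<le> C"
proof -
  have "deriv step s = dirderiv 1 step s" for s
    using dirderiv_eqI[OF step_has_derivative[of s, unfolded has_field_derivative_def], of 1] by simp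
  then have "deriv step = dirderiv 1 step" by auto
  then have "continuous_on UNIV (deriv step)"
    using smooth_continuous[OF smooth_dirderiv[OF smooth_step]] by simp
  then have "continuous_on {1..2} (deriv step)" using continuous_on_subset subset_UNIV by blast
  then have "continuous_on {1..2} (\<lambda>s. s * deriv step s)"
    by (rule continuous_on_mult[OF continuous_on_id])
  from compact_imp_bounded[OF compact_continuous_image[OF this compact_Icc]]
  obtain C where "\<forall>s\<in>{1..2}. \<bar>s * deriv step s\<bar> \<le> C"
    unfolding bounded_iff by auto
  then have C: "\<And>s. 1 \<le> s \<Longrightarrow> s \<le> 2 \<Longrightarrow> \<bar>s * deriv step s\<bar> \<le> C" by simp
  have "\<bar>s * deriv step s\<bar> \<le> max C 0" for s
    using C[of s] deriv_step_eq_0[of s] by (cases "s < 1"; cases "s > 2") auto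
  then show thesis by (intro that[of "max C 0"]) auto
qed

lemma smooth_truncate:
  assumes "smooth \<phi>"
  shows "smooth (truncate \<phi> n)"
proof -
  have p: "smooth_on UNIV \<phi>" using assms by (simp add: smooth_on_UNIV)
  have "smooth_on UNIV (\<lambda>z. step (real n * (\<phi> z \<bullet> \<phi> z)))"
    by (intro smooth_on_step_compose smooth_on_mult smooth_on_const smooth_on_bilinear[OF bounded_bilinear_inner] open_UNIV p)
  then have "smooth_on UNIV (\<lambda>z. complex_of_real (step (real n * (\<phi> z \<bullet> \<phi> z))) * \<phi> z)"
    by (intro smooth_on_mult open_UNIV p smooth_on_linear_compose[OF open_UNIV bounded_linear_of_real])
  then show ?thesis by (simp add: smooth_on_UNIV truncate_def[abs_def] dot_square_norm)
qed

lemma dirderiv_truncate: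
  assumes "smooth \<phi>"
  shows "dirderiv e (truncate \<phi> n) z = of_real (step (real n * (cmod (\<phi> z))\<^sup>2)) * dirderiv e \<phi> z +
    of_real (deriv step (real n * (cmod (\<phi> z))\<^sup>2) * (real n * (2 * (\<phi> z \<bullet> dirderiv e \<phi> z)))) * \<phi> z"
proof -
  note d = smooth_has_derivative[OF assms, of z]
  have "((\<lambda>z. real n * (\<phi> z \<bullet> \<phi> z)) has_derivative (\<lambda>e. real n * (\<phi> z \<bullet> dirderiv e \<phi> z + dirderiv e \<phi> z \<bullet> \<phi> z))) (at z)"
    by (intro has_derivative_mult_right has_derivative_inner d)
  from has_derivative_compose[OF this step_has_derivative[unfolded has_field_derivative_def]]
  have "((\<lambda>z. step (real n * (\<phi> z \<bullet> \<phi> z))) has_derivative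
      (\<lambda>e. deriv step (real n * (\<phi> z \<bullet> \<phi> z)) * (real n * (\<phi> z \<bullet> dirderiv e \<phi> z + dirderiv e \<phi> z \<bullet> \<phi> z)))) (at z)" .
  from has_derivative_mult[OF has_derivative_of_real[OF this] d]
  have "(truncate \<phi> n has_derivative (\<lambda>e. of_real (step (real n * (\<phi> z \<bullet> \<phi> z))) * dirderiv e \<phi> z +
      of_real (deriv step (real n * (\<phi> z \<bullet> \<phi> z)) * (real n * (\<phi> z \<bullet> dirderiv e \<phi> z + dirderiv e \<phi> z \<bullet> \<phi> z))) * \<phi> z)) (at z)"
    by (simp add: truncate_def[abs_def] dot_square_norm)
  from dirderiv_eqI[OF this] show ?thesis
    by (simp add: dot_square_norm inner_commute[of "dirderiv e \<phi> z"])
qed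

lemma truncate_closure:
  assumes U: "open U" "bounded U" and \<phi>: "smooth \<phi>"
  shows "(\<phi>, dirderiv (1, 0) \<phi>, dirderiv (0, 1) \<phi>) \<in>
    graph_closure U (range (truncate \<phi>)) (dirderiv (1, 0)) (dirderiv (0, 1))"
proof -
  have Ub: "U \<in> sets borel" using U by simp
  note sL = smooth_imp_L2[OF Ub U(2)]
  \<comment> \<open>The bound 3 lies strictly beyond 2, so that \<open>step\<close> is 1 there and
    its derivative is 0.\<close>
  have ev: "\<forall>\<^sub>F n in sequentially. 3 \<le> real n * (cmod (\<phi> z))\<^sup>2" if "\<phi> z \<noteq> 0" for z
  proof -
    have p: "(cmod (\<phi> z))\<^sup>2 > 0" using that by simp
    obtain N :: nat where "3 / (cmod (\<phi> z))\<^sup>2 < real N" using reals_Archimedean2 by blast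
    then have "3 \<le> real n * (cmod (\<phi> z))\<^sup>2" if "n \<ge> N" for n
    proof -
      have "3 / (cmod (\<phi> z))\<^sup>2 \<le> real n" using \<open>_ < real N\<close> that by linarith
      then show ?thesis using p by (simp add: field_simps)
    qed
    then show ?thesis by (auto simp: eventually_sequentially)
  qed
  have bd: "\<exists>B. \<forall>z\<in>U. cmod (f z) \<le> B" if "smooth f" for f :: cfun
  proof -
    have "compact (f ` closure U)"
      using U(2) by (intro compact_continuous_image smooth_continuous[OF that]) (simp add: compact_closure)
    then obtain B where "\<forall>w\<in>f ` closure U. cmod w \<le> B"
      using compact_imp_bounded bounded_iff by metis
    then show ?thesis using closure_subset by blast
  qed
  have 0: "(\<lambda>n. L2_norm U (\<lambda>z. truncate \<phi> n z - \<phi> z)) \<longlonglongrightarrow> 0"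
  proof -
    obtain B where B: "\<forall>z\<in>U. cmod (\<phi> z) \<le> B" using bd[OF \<phi>] by blast
    show ?thesis
    proof (rule L2_dominated_convergence[OF Ub U(2) sL[OF smooth_truncate[OF \<phi>]] sL[OF \<phi>]])
      show "AE z in lborel. z \<in> U \<longrightarrow> (\<lambda>n. truncate \<phi> n z) \<longlonglongrightarrow> \<phi> z"
      proof (intro AE_I2 impI)
        fix z
        show "(\<lambda>n. truncate \<phi> n z) \<longlonglongrightarrow> \<phi> z"
        proof (cases "\<phi> z = 0")
          case False
          from ev[OF this] have "\<forall>\<^sub>F n in sequentially. truncate \<phi> n z = \<phi> z"
            by eventually_elim (simp add: truncate_def step_ge)
          then show ?thesis by (rule tendsto_eventually)
        qed (simp add: truncate_def)
      qed
      show "cmod (truncate \<phi> n z) \<le> B" if "z \<in> U" for n z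
      proof -
        have "cmod (truncate \<phi> n z) \<le> 1 * cmod (\<phi> z)"
          unfolding truncate_def norm_mult by (intro mult_right_mono) (auto simp: step_nonneg step_le_1)
        with B that show ?thesis by auto
      qed
    qed
  qed
  obtain C where C: "C \<ge> 0" "\<And>s. \<bar>s * deriv step s\<bar> \<le> C" using deriv_step_bounded by blast
  have 1: "(\<lambda>n. L2_norm U (\<lambda>z. dirderiv e (truncate \<phi> n) z - dirderiv e \<phi> z)) \<longlonglongrightarrow> 0"
    if e: "e \<in> {(1, 0), (0, 1)}" for e
  proof -
    obtain B where B: "\<forall>z\<in>U. cmod (dirderiv e \<phi> z) \<le> B" using bd[OF smooth_dirderiv[OF \<phi>]] by blast
    show ?thesis
    proof (rule L2_dominated_convergence[OF Ub U(2) sL[OF smooth_dirderiv[OF smooth_truncate[OF \<phi>]]] sL[OF smooth_dirderiv[OF \<phi>]]])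
      show "AE z in lborel. z \<in> U \<longrightarrow> (\<lambda>n. dirderiv e (truncate \<phi> n) z) \<longlonglongrightarrow> dirderiv e \<phi> z"
        using AE_derivative_zero_on_zeros[OF \<phi> e]
      proof eventually_elim
        case (elim z)
        have "(\<lambda>n. dirderiv e (truncate \<phi> n) z) \<longlonglongrightarrow> dirderiv e \<phi> z"
        proof (cases "\<phi> z = 0")
          case True
          with elim show ?thesis by (simp add: dirderiv_truncate[OF \<phi>])
        next
          case False
          from ev[OF this] have "\<forall>\<^sub>F n in sequentially. dirderiv e (truncate \<phi> n) z = dirderiv e \<phi> z"
            by eventually_elim (simp add: dirderiv_truncate[OF \<phi>] step_ge deriv_step_eq_0)
          then show ?thesis by (rule tendsto_eventually)
        qed
        then show ?case ..
      qed
      show "cmod (dirderiv e (truncate \<phi> n) z) \<le> (1 + 2 * C) * B" if z: "z \<in> U" for n z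
      proof -
        let ?s = "real n * (cmod (\<phi> z))\<^sup>2" and ?d = "dirderiv e \<phi> z"
        have B0: "cmod ?d \<le> B" using B z by blast
        have "cmod (of_real (step ?s) * ?d) \<le> 1 * cmod ?d"
          unfolding norm_mult by (intro mult_right_mono) (auto simp: step_nonneg step_le_1)
        moreover have "cmod (of_real (deriv step ?s * (real n * (2 * (\<phi> z \<bullet> ?d)))) * \<phi> z) \<le> 2 * C * cmod ?d"
        proof -
          have "cmod (of_real (deriv step ?s * (real n * (2 * (\<phi> z \<bullet> ?d)))) * \<phi> z) =
            \<bar>deriv step ?s\<bar> * (real n * (2 * \<bar>\<phi> z \<bullet> ?d\<bar>)) * cmod (\<phi> z)"
            by (simp only: norm_mult norm_of_real abs_mult abs_of_nat abs_numeral)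
          also have "\<dots> \<le> \<bar>deriv step ?s\<bar> * (real n * (2 * (cmod (\<phi> z) * cmod ?d))) * cmod (\<phi> z)"
            by (intro mult_right_mono mult_left_mono Cauchy_Schwarz_ineq2) auto
          \<comment> \<open>The factor n and the two factors |\<phi>| combine to the argument of
            \<open>step\<close>; thus n disappears from the bound.\<close>
          also have "\<dots> = 2 * \<bar>?s * deriv step ?s\<bar> * cmod ?d"
            by (simp add: abs_mult power2_eq_square mult_ac)
          also have "\<dots> \<le> 2 * C * cmod ?d" by (intro mult_right_mono mult_left_mono C) auto
          finally show ?thesis .
        qed
        ultimately have "cmod (dirderiv e (truncate \<phi> n) z) \<le> 1 * cmod ?d + 2 * C * cmod ?d"
          unfolding dirderiv_truncate[OF \<phi>] by (intro norm_triangle_le add_mono)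
        also have "\<dots> = (1 + 2 * C) * cmod ?d" by (simp add: algebra_simps)
        also have "\<dots> \<le> (1 + 2 * C) * B" using B0 C(1) by (intro mult_left_mono) auto
        finally show ?thesis .
      qed
    qed
  qed
  show ?thesis
    unfolding graph_closure_iff_sequence
  proof (intro conjI exI[of _ "truncate \<phi>"] allI)
    show "(\<lambda>n. L2_norm U (\<lambda>z. dirderiv (1, 0) (truncate \<phi> n) z - dirderiv (1, 0) \<phi> z)) \<longlonglongrightarrow> 0" by (rule 1) simp
    show "(\<lambda>n. L2_norm U (\<lambda>z. dirderiv (0, 1) (truncate \<phi> n) z - dirderiv (0, 1) \<phi> z)) \<longlonglongrightarrow> 0" by (rule 1) simp
  qed (use 0 in \<open>auto intro!: sL \<phi> smooth_dirderiv\<close>)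
qed

section \<open>Extension across the symmetry axis\<close>

definition lift :: "real \<Rightarrow> plane \<Rightarrow> plane" where
  "lift \<eta> z = (fst z, sqrt ((snd z)\<^sup>2 + \<eta>\<^sup>2))"

lemma smooth_on_Pair:
  fixes f g :: "'a::real_normed_vector \<Rightarrow> real"
  assumes "open S" "smooth_on S f" "smooth_on S g"
  shows "smooth_on S (\<lambda>z. (f z, g z))"
proof -
  have "smooth_on S (\<lambda>z. f z *\<^sub>R ((1::real), (0::real)) + g z *\<^sub>R (0, 1))"
    by (intro smooth_on_add smooth_on_scaleR smooth_on_const assms)
  then show ?thesis by simp
qed

lemma smooth_on_lift:
  assumes "\<eta> > 0"
  shows "smooth_on UNIV (lift \<eta>)"
  unfolding lift_def[abs_def] power2_eq_square
  by (intro smooth_on_Pair smooth_on_sqrt smooth_on_add smooth_on_mult smooth_on_const open_UNIV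
      smooth_on_bounded_linear bounded_linear_fst bounded_linear_snd)
     (use assms in \<open>simp add: add_nonneg_pos\<close>)

lemma lift_has_derivative:
  assumes "\<eta> > 0"
  shows "(lift \<eta> has_derivative (\<lambda>h. (fst h, snd z / sqrt ((snd z)\<^sup>2 + \<eta>\<^sup>2) * snd h))) (at z)"
proof -
  have p: "(snd z)\<^sup>2 + \<eta>\<^sup>2 > 0" using assms by (simp add: add_nonneg_pos)
  have "((\<lambda>z::plane. sqrt ((snd z)\<^sup>2 + \<eta>\<^sup>2)) has_derivative (\<lambda>h. snd z / sqrt ((snd z)\<^sup>2 + \<eta>\<^sup>2) * snd h)) (at z)"
    using p by (auto intro!: derivative_eq_intros simp: field_simps)
  then show ?thesis unfolding lift_def[abs_def]
    by (intro has_derivative_Pair has_derivative_fst has_derivative_ident)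
qed

lemma dist_lift_upfold:
  assumes "\<eta> > 0"
  shows "dist (lift \<eta> z) (upfold z) \<le> \<eta>"
proof -
  have "sqrt ((snd z)\<^sup>2 + \<eta>\<^sup>2) \<le> \<bar>snd z\<bar> + \<bar>\<eta>\<bar>" by (rule sqrt_sum_squares_le_sum_abs)
  moreover have "\<bar>snd z\<bar> \<le> sqrt ((snd z)\<^sup>2 + \<eta>\<^sup>2)" by (rule real_le_rsqrt) simp
  ultimately show ?thesis using assms by (simp add: lift_def upfold_def dist_Pair_Pair dist_real_def)
qed

lemma dist_upfold_le: "dist (upfold z) (upfold w) \<le> dist z w"
proof -
  have "(\<bar>snd z\<bar> - \<bar>snd w\<bar>)\<^sup>2 \<le> (snd z - snd w)\<^sup>2"
    by (rule abs_le_square_iff[THEN iffD1]) linarith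
  then show ?thesis by (cases z; cases w) (simp add: upfold_def dist_Pair_Pair dist_real_def)
qed

lemma norm_upfold: "norm (upfold z) = norm z"
  by (simp add: upfold_def norm_prod_def)

context mirror_domain
begin

text \<open>Where the even extension times the half phase has to vanish: the boundary and the slit
  inside the domain, including the origin.\<close>

definition "barrier = frontier \<Omega> \<union> ({- a / 2..0} \<times> {0::real})"

lemma a_pos: "a > 0"
  using axis[of 0] origin by (simp add: zero_prod_def)

lemma frontier_upper:
  assumes "z \<in> frontier \<Omega>" "snd z > 0"
  shows "z \<in> frontier upper"
proof -
  have "z \<in> {z. snd z > 0} \<inter> closure \<Omega>" using assms by (auto simp: frontier_def)
  also have "\<dots> \<subseteq> closure ({z. snd z > 0} \<inter> \<Omega>)"
    by (rule open_Int_closure_subset) (intro open_Collect_less continuous_intros)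
  also have "{z. snd z > 0} \<inter> \<Omega> = upper" by (auto simp: upper_def)
  finally show ?thesis
    using assms "open" upper_open by (auto simp: frontier_def interior_open upper_def)
qed

lemma axis_upper:
  assumes "(x, 0) \<in> \<Omega>"
  shows "(x, 0) \<in> frontier upper"
proof -
  have "(x, 0) \<in> closure upper"
    unfolding closure_approachable
  proof (intro allI impI)
    fix e :: real assume "e > 0"
    obtain d where d: "d > 0" "ball (x, 0) d \<subseteq> \<Omega>" using assms "open" open_contains_ball by blast
    define t where "t = min d e / 2"
    have t: "0 < t" "t < d" "t < e" using d \<open>e > 0\<close> by (auto simp: t_def)
    have "dist (x, t) (x, 0) = t" using t by (simp add: dist_Pair_Pair)
    then have "(x, t) \<in> upper" using d(2) t by (auto simp: upper_def dist_commute)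
    then show "\<exists>y\<in>upper. dist y (x, 0) < e" using \<open>dist (x, t) (x, 0) = t\<close> t by (intro bexI[of _ "(x, t)"]) auto
  qed
  moreover have "(x, 0) \<notin> upper" by (simp add: upper_def)
  ultimately show ?thesis by (simp add: frontier_def interior_open[OF upper_open])
qed

text \<open>By convexity the segment from 0 to a boundary point runs in the domain except for its
  end. A boundary point of the axis further out than a/2 would put a point with absolute value a/2
  into the domain.\<close>

lemma frontier_axis:
  assumes "(x, 0) \<in> frontier \<Omega>"
  shows "\<bar>x\<bar> = a / 2"
proof (rule ccontr)
  assume ne: "\<bar>x\<bar> \<noteq> a / 2"
  have "(x, 0) \<notin> \<Omega>" using assms "open" by (auto simp: frontier_def interior_open)
  then have gt: "\<bar>x\<bar> > a / 2" using axis[of x] ne by (auto simp: abs_if split: if_splits)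
  \<comment> \<open>The factor that scales x to absolute value a/2.\<close>
  define u where "u = a / 2 / \<bar>x\<bar>"
  have u: "0 < u" "u < 1" using gt a_pos by (auto simp: u_def divide_less_eq)
  have "(u * x, 0) = (1 - u) *\<^sub>R 0 + u *\<^sub>R (x, 0::real)" by (simp add: zero_prod_def)
  then have "(u * x, 0) \<in> open_segment 0 (x, 0)"
    using u gt a_pos unfolding in_segment by (auto simp: zero_prod_def)
  moreover have "open_segment 0 (x, 0) \<subseteq> interior \<Omega>"
    by (rule in_interior_closure_convex_segment[OF convex])
       (use assms origin "open" in \<open>auto simp: frontier_def interior_open\<close>)
  ultimately have "(u * x, 0) \<in> \<Omega>" using interior_subset by blast
  then have "\<bar>u * x\<bar> < a / 2" using axis[of "u * x"] by (auto simp: abs_if)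
  moreover have "\<bar>u * x\<bar> = a / 2" using u gt a_pos by (simp add: abs_mult u_def)
  ultimately show False by simp
qed

text \<open>The midpoint of a point and its mirror image lies on the axis and, by convexity, in the
  domain.\<close>

lemma above_endpoint:
  assumes "\<bar>x\<bar> = a / 2"
  shows "(x, y) \<notin> \<Omega>"
proof
  assume "(x, y) \<in> \<Omega>"
  with mirror[of "(x, y)"] have "(1/2) *\<^sub>R (x, y) + (1/2) *\<^sub>R (x, - y) \<in> \<Omega>"
    using convex by (intro convexD) (auto simp: mirror_def)
  then have "(x, 0) \<in> \<Omega>" by simp
  then show False using axis[of x] assms by (auto simp: abs_if split: if_splits)
qed

text \<open>The endpoint \<open>(a/2, 0)\<close> belongs to the Neumann part, so a function of the core vanishes there only by
  continuity, as a limit of boundary points off the axis.\<close>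

lemma endpoint_approx:
  assumes x: "\<bar>x\<bar> = a / 2" and e: "e > 0"
  shows "\<exists>w\<in>frontier \<Omega>. snd w > 0 \<and> dist w (x, 0) < e"
proof -
  \<comment> \<open>The bound a/4 keeps p inside the domain, and e/3 keeps the segment from p to r
    within distance e of the endpoint.\<close>
  define t where "t = min (e / 3) (a / 4)"
  have t: "t > 0" "t \<le> e / 3" "t \<le> a / 4" using e a_pos by (auto simp: t_def)
  define p where "p = (x - sgn x * t, 0::real)"
  define r where "r = (x, t)"
  have x0: "x \<noteq> 0" using x a_pos by auto
  have p: "p \<in> \<Omega>" unfolding p_def axis using x t a_pos by (auto simp: sgn_real_def abs_if split: if_splits)
  have r: "r \<notin> \<Omega>" unfolding r_def by (rule above_endpoint[OF x])
  \<comment> \<open>The segment leaves the domain somewhere, and not at p; as p is its only point on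
    the axis, the crossing lies above the axis.\<close>
  have "closed_segment p r \<inter> frontier \<Omega> \<noteq> {}"
    by (rule connected_Int_frontier) (use p r in auto)
  then obtain w u where w: "w \<in> frontier \<Omega>" "w = (1 - u) *\<^sub>R p + u *\<^sub>R r" "0 \<le> u" "u \<le> 1"
    unfolding closed_segment_def by blast
  have w2: "w = (x - (1 - u) * (sgn x * t), u * t)"
    by (simp add: w(2) p_def r_def algebra_simps)
  have "u \<noteq> 0"
  proof
    assume "u = 0"
    then have "w = p" using w(2) by simp
    then show False using w(1) p "open" by (auto simp: frontier_def interior_open)
  qed
  then have s: "snd w > 0" using w2 w(3) t by simp
  have "dist w (x, 0) = norm (- ((1 - u) * (sgn x * t)), u * t)"
    unfolding dist_norm w2 by simp
  also have "\<dots> \<le> \<bar>(1 - u) * (sgn x * t)\<bar> + \<bar>u * t\<bar>"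
    unfolding norm_Pair by (rule order_trans[OF sqrt_sum_squares_le_sum_abs]) simp
  also have "\<bar>(1 - u) * (sgn x * t)\<bar> = (1 - u) * t" using w t x0 by (simp add: abs_mult abs_sgn_eq)
  also have "\<bar>u * t\<bar> = u * t" using w t by simp
  also have "(1 - u) * t + u * t = t" by (simp add: algebra_simps)
  finally have "dist w (x, 0) < e" using t e by linarith
  with w(1) s show ?thesis by blast
qed

lemma closure_vanish:
  assumes c: "continuous_on UNIV (\<phi> :: cfun)" and A: "\<And>z. z \<in> A \<Longrightarrow> \<phi> z = 0" and z: "z \<in> closure A"
  shows "\<phi> z = 0"
proof -
  have "closed {z. \<phi> z = 0}" using c by (intro closed_Collect_eq) auto
  then have "closure A \<subseteq> {z. \<phi> z = 0}" using A by (intro closure_minimal) auto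
  then show ?thesis using z by auto
qed

text \<open>On the slit and above the axis the value is 0 by the boundary condition, below the axis
  after mirroring, and at the two endpoints by continuity.\<close>

lemma mixed_functions_barrier:
  assumes \<phi>: "\<phi> \<in> mixed_functions upper ray" and z: "z \<in> barrier"
  shows "\<phi> (upfold z) = 0"
proof -
  have c: "continuous_on UNIV \<phi>" using \<phi> by (auto simp: mixed_functions_def intro: smooth_continuous)
  have v: "\<phi> w = 0" if "w \<in> frontier upper" "w \<notin> ray" for w
    using \<phi> that by (auto simp: mixed_functions_def)
  have up: "\<phi> w = 0" if "w \<in> frontier \<Omega>" "snd w > 0" for w
    by (rule v[OF frontier_upper[OF that]]) (use that in \<open>auto simp: ray_def\<close>)
  have ends: "\<phi> (x, 0) = 0" if x: "\<bar>x\<bar> = a / 2" for x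
  proof (rule closure_vanish[OF c])
    show "(x, 0) \<in> closure {w \<in> frontier \<Omega>. snd w > 0}"
      unfolding closure_approachable using endpoint_approx[OF x] by blast
  qed (use up in auto)
  show ?thesis
  proof (cases "z \<in> frontier \<Omega>")
    case True
    show ?thesis
    proof (cases "snd z = 0")
      case True
      then have "z = (fst z, 0)" by (simp add: prod_eq_iff)
      with \<open>z \<in> frontier \<Omega>\<close> frontier_axis[of "fst z"] ends[of "fst z"] True show ?thesis
        by (simp add: upfold_def)
    next
      case False
      have f: "mirror z \<in> frontier \<Omega>"
      proof -
        have mm: "mirror ` \<Omega> = \<Omega>" using mirror by (auto simp: image_iff) (metis mirror_mirror)
        have lm: "linear mirror" using bounded_linear_mirror by (rule bounded_linear.linear)
        have "inj mirror" by (metis injI mirror_mirror)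
        from closure_injective_linear_image[OF lm this, of \<Omega>] have "mirror ` closure \<Omega> = closure \<Omega>"
          by (simp add: mm)
        then have "mirror z \<in> closure \<Omega>" using True by (auto simp: frontier_def)
        moreover have "mirror z \<notin> \<Omega>"
        proof
          assume "mirror z \<in> \<Omega>"
          then have "z \<in> \<Omega>" using mirror[of "mirror z"] by simp
          then show False using True "open" by (auto simp: frontier_def interior_open)
        qed
        ultimately show ?thesis using "open" by (simp add: frontier_def interior_open)
      qed
      show ?thesis
      proof (cases "snd z > 0")
        case True
        then show ?thesis using up[OF \<open>z \<in> frontier \<Omega>\<close>] by (simp add: upfold_def)
      next
        case s: False
        then have "upfold z = mirror z" "snd (mirror z) > 0" using False by (auto simp: upfold_def mirror_def)
        then show ?thesis using up[OF f] by simp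
      qed
    qed
  next
    case False
    then obtain x where x: "z = (x, 0)" "- a / 2 \<le> x" "x \<le> 0" using z by (auto simp: barrier_def)
    have "\<phi> (x, 0) = 0"
    proof (cases "x = - a / 2")
      case True
      then show ?thesis using ends[of x] a_pos by simp
    next
      case False
      then have "(x, 0) \<in> \<Omega>" using x axis[of x] a_pos by auto
      then show ?thesis using v[OF axis_upper] x by (auto simp: ray_def)
    qed
    then show ?thesis by (simp add: x upfold_def)
  qed
qed

text \<open>\<phi> vanishes at \<open>upfold k\<close>, so by uniform continuity |\<phi>| \<le> 1/(n
  + 1) nearby. Then n |\<phi>|^2 \<le> 1, where \<open>step\<close> is 0.\<close>

lemma truncate_near_barrier:
  assumes \<phi>: "\<phi> \<in> mixed_functions upper ray"
  obtains \<rho> where "\<rho> > 0"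
    "\<And>z k \<eta>. z \<in> \<Omega> \<Longrightarrow> k \<in> barrier \<Longrightarrow> dist z k < \<rho> \<Longrightarrow> 0 < \<eta> \<Longrightarrow> \<eta> < \<rho> \<Longrightarrow> truncate \<phi> n (lift \<eta> z) = 0"
proof -
  have c: "continuous_on UNIV \<phi>" using \<phi> by (auto simp: mixed_functions_def intro: smooth_continuous)
  obtain R where R: "\<And>z. z \<in> \<Omega> \<Longrightarrow> norm z \<le> R" using bounded by (auto simp: bounded_iff)
  let ?B = "cball (0::plane) (R + 2)"
  have "uniformly_continuous_on ?B \<phi>"
    using c by (intro compact_uniformly_continuous continuous_on_subset[OF c]) auto
  then obtain d where d: "d > 0" "\<And>p q. p \<in> ?B \<Longrightarrow> q \<in> ?B \<Longrightarrow> dist q p < d \<Longrightarrow> dist (\<phi> q) (\<phi> p) < 1 / (real n + 1)"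
    unfolding uniformly_continuous_on_def by (metis add_nonneg_pos of_nat_0_le_iff zero_less_divide_1_iff zero_less_one)
  \<comment> \<open>Lifting and passing from z to k move the argument by less than \<rho> each,
    hence d/2; the bound 1 keeps all points in the ball on which uniform continuity is used.\<close>
  define \<rho> where "\<rho> = min (d / 2) 1"
  have \<rho>: "\<rho> > 0" "2 * \<rho> \<le> d" "\<rho> \<le> 1" using d(1) by (auto simp: \<rho>_def)
  show thesis
  proof (rule that[OF \<rho>(1)])
    fix z k \<eta> assume z: "z \<in> \<Omega>" and k: "k \<in> barrier" and zk: "dist z k < \<rho>" and \<eta>: "0 < \<eta>" "\<eta> < \<rho>"
    have d1: "dist (lift \<eta> z) (upfold z) \<le> \<eta>" by (rule dist_lift_upfold[OF \<eta>(1)])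
    have d2: "dist (upfold z) (upfold k) \<le> dist z k" by (rule dist_upfold_le)
    have "norm k \<le> norm z + dist z k"
      using norm_triangle_ineq2[of k z] by (simp add: dist_norm norm_minus_commute)
    then have "upfold k \<in> ?B" using R[OF z] zk \<rho> by (simp add: norm_upfold)
    moreover have "norm (lift \<eta> z) \<le> norm (upfold z) + dist (lift \<eta> z) (upfold z)"
      using norm_triangle_ineq2[of "lift \<eta> z" "upfold z"] by (simp add: dist_norm)
    then have "lift \<eta> z \<in> ?B" using R[OF z] d1 \<eta> \<rho> by (simp add: norm_upfold)
    moreover have "dist (lift \<eta> z) (upfold k) < d"
      using dist_triangle[of "lift \<eta> z" "upfold k" "upfold z"] d1 d2 zk \<eta> \<rho> by linarith
    ultimately have "dist (\<phi> (lift \<eta> z)) (\<phi> (upfold k)) < 1 / (real n + 1)" by (intro d(2))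
    then have le: "cmod (\<phi> (lift \<eta> z)) \<le> 1 / (real n + 1)"
      by (simp add: mixed_functions_barrier[OF \<phi> k] dist_norm)
    have "real n * (cmod (\<phi> (lift \<eta> z)))\<^sup>2 \<le> real n * (1 / (real n + 1))\<^sup>2"
      by (intro mult_left_mono power_mono le) auto
    also have "\<dots> = (real n / (real n + 1)) * (1 / (real n + 1))" by (simp add: power2_eq_square)
    also have "\<dots> \<le> 1 * 1" by (intro mult_mono) auto
    finally show "truncate \<phi> n (lift \<eta> z) = 0" by (simp add: truncate_def step_le)
  qed
qed

lemma punctured_barrier: "z \<in> \<Omega> \<Longrightarrow> z \<notin> slit_plane \<Longrightarrow> z \<in> barrier"
proof -
  assume "z \<in> \<Omega>" "z \<notin> slit_plane"
  then have "z = (fst z, 0)" "fst z \<le> 0" by (auto simp: slit_plane_def prod_eq_iff)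
  moreover from this \<open>z \<in> \<Omega>\<close> have "- a / 2 < fst z" using axis[of "fst z"] by metis
  ultimately show "z \<in> barrier" unfolding barrier_def by (auto simp: mem_Times_iff prod_eq_iff)
qed

text \<open>Vanishing near the barrier keeps the support away from the boundary and from the slit,
  across which the half phase jumps. Off the slit the gauge identity removes the potential, so only
  derivatives of T remain.\<close>

lemma lifted_test_function:
  assumes T: "smooth T" and \<eta>: "\<eta> > 0" and \<rho>: "\<rho> > 0"
    and near: "\<And>z k. z \<in> \<Omega> \<Longrightarrow> k \<in> barrier \<Longrightarrow> dist z k < \<rho> \<Longrightarrow> T (lift \<eta> z) = 0"
  defines "\<Phi> \<equiv> (\<lambda>z. if z \<in> \<Omega> then half_phase z * T (lift \<eta> z) else 0)"
  shows "\<Phi> \<in> test_functions punctured"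
    and "\<And>z. z \<in> \<Omega> \<Longrightarrow> z \<in> slit_plane \<Longrightarrow> AB_D1 \<Phi> z = - \<i> * half_phase z * dirderiv (1, 0) T (lift \<eta> z)"
    and "\<And>z. z \<in> \<Omega> \<Longrightarrow> z \<in> slit_plane \<Longrightarrow> AB_D2 \<Phi> z =
      - \<i> * half_phase z * (of_real (snd z / sqrt ((snd z)\<^sup>2 + \<eta>\<^sup>2)) * dirderiv (0, 1) T (lift \<eta> z))"
    and "\<And>z. z \<notin> slit_plane \<Longrightarrow> AB_D1 \<Phi> z = 0 \<and> AB_D2 \<Phi> z = 0"
proof -
  \<comment> \<open>The distance condition is imposed for each point of the barrier separately,
    which makes S an intersection of closed sets.\<close>
  define S where "S = closure \<Omega> \<inter> (\<Inter>k\<in>barrier. {z. \<rho> \<le> dist z k})"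
  have "closed {z. \<rho> \<le> dist z k}" for k :: plane by (intro closed_Collect_le continuous_intros)
  then have S: "compact S" unfolding S_def
    by (intro compact_Int_closed closed_INT) (use bounded in \<open>auto simp: compact_closure\<close>)
  then have oS: "open (- S)" by (simp add: compact_imp_closed open_Compl)
  have S1: "z \<in> \<Omega> \<and> z \<notin> barrier" if "z \<in> S" for z
  proof -
    have nb: "z \<notin> barrier" using that \<rho> by (auto simp: S_def)
    then show ?thesis using that "open" by (auto simp: S_def barrier_def frontier_def interior_open)
  qed
  have S2: "S \<subseteq> \<Omega> \<inter> slit_plane" using S1 punctured_barrier by blast
  have z0: "\<Phi> z = 0" if "z \<notin> S" for z
  proof (cases "z \<in> \<Omega>")
    case True
    then have "z \<in> closure \<Omega>" using closure_subset by blast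
    with that obtain k where "k \<in> barrier" "dist z k < \<rho>" by (auto simp: S_def not_le)
    from near[OF True this] show ?thesis by (simp add: \<Phi>_def)
  qed (simp add: \<Phi>_def)
  let ?W = "\<Omega> \<inter> slit_plane"
  have oW: "open ?W" by (intro open_Int "open" open_slit_plane)
  have Tl: "smooth_on UNIV (\<lambda>z. T (lift \<eta> z))"
    by (rule smooth_on_compose[OF open_UNIV open_UNIV _ _ smooth_on_lift[OF \<eta>]]) (use T in \<open>auto simp: smooth_on_UNIV\<close>)
  have "smooth_on ?W (\<lambda>z. half_phase z * T (lift \<eta> z))"
    by (intro smooth_on_mult oW smooth_on_subset[OF smooth_on_half_phase] smooth_on_subset[OF Tl]) auto
  then have s1: "smooth_on ?W \<Phi>" by (rule smooth_on_cong[OF oW]) (simp add: \<Phi>_def)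
  have s2: "smooth_on (- S) \<Phi>" by (rule smooth_on_cong[OF oS smooth_on_const[of _ 0]]) (use z0 in auto)
  have "?W \<union> - S = UNIV" using S2 by blast
  with smooth_on_Un[OF oW oS s1 s2] have sm: "smooth \<Phi>" by (simp add: smooth_on_UNIV)
  have Sp: "S \<subseteq> punctured"
  proof
    fix z assume "z \<in> S"
    with S2 have "z \<in> \<Omega>" "z \<in> slit_plane" by auto
    then show "z \<in> punctured" by (auto simp: punctured_def slit_plane_def)
  qed
  show "\<Phi> \<in> test_functions punctured" by (rule test_functionsI[OF sm S Sp z0])
  have der: "dirderiv e \<Phi> z = half_phase z * dirderiv e (\<lambda>z. T (lift \<eta> z)) z + dirderiv e half_phase z * T (lift \<eta> z)"
    if "z \<in> \<Omega>" "z \<in> slit_plane" for e z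
  proof -
    have d: "(\<lambda>z. T (lift \<eta> z)) differentiable at z" using smooth_on_differentiable[OF Tl] by simp
    note h = dirderiv_half_phase(1)[OF that(2)]
    have "dirderiv e (\<lambda>z. half_phase z * T (lift \<eta> z)) z = dirderiv e \<Phi> z"
      by (rule dirderiv_cong[OF oW]) (use that d h in \<open>auto simp: \<Phi>_def intro: differentiable_mult\<close>)
    then show ?thesis by (simp add: dirderiv_mult[OF h d])
  qed
  have Tder: "dirderiv e (\<lambda>z. T (lift \<eta> z)) z = dirderiv (fst e, snd z / sqrt ((snd z)\<^sup>2 + \<eta>\<^sup>2) * snd e) T (lift \<eta> z)" for e z
    by (rule dirderiv_eqI[OF has_derivative_compose[OF lift_has_derivative[OF \<eta>] smooth_has_derivative[OF T]]])
  have scal: "dirderiv (0, c) T w = of_real c * dirderiv (0, 1) T w" for c w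
  proof -
    have b: "bounded_linear (\<lambda>e. dirderiv e T w)" using smooth_has_derivative[OF T] by (rule has_derivative_bounded_linear)
    from linear_simps(5)[OF b, of c "(0, 1)"] show ?thesis by (simp add: scaleR_conv_of_real)
  qed
  fix z
  show "AB_D1 \<Phi> z = - \<i> * half_phase z * dirderiv (1, 0) T (lift \<eta> z)" if "z \<in> \<Omega>" "z \<in> slit_plane"
    unfolding mag_D_def der[OF that] Tder dirderiv_half_phase(2)[OF that(2)] fst_conv snd_conv mult_zero_right
    using that by (simp add: \<Phi>_def algebra_simps)
  show "AB_D2 \<Phi> z = - \<i> * half_phase z * (of_real (snd z / sqrt ((snd z)\<^sup>2 + \<eta>\<^sup>2)) * dirderiv (0, 1) T (lift \<eta> z))"
    if "z \<in> \<Omega>" "z \<in> slit_plane"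
    unfolding mag_D_def der[OF that] Tder dirderiv_half_phase(3)[OF that(2)] fst_conv snd_conv mult_1_right
      scal[where c="snd z / sqrt ((snd z)\<^sup>2 + \<eta>\<^sup>2)"]
    using that by (simp add: \<Phi>_def algebra_simps)
  show "AB_D1 \<Phi> z = 0 \<and> AB_D2 \<Phi> z = 0" if "z \<notin> slit_plane"
  proof -
    have "z \<notin> S" using that S2 by blast
    with z0[OF this] dirderiv_eq_0[OF compact_imp_closed[OF S] z0 this] show ?thesis by (simp add: mag_D_def)
  qed
qed

text \<open>The limit of vanishing \<eta> at fixed n. The y-derivative of the lift, y / sqrt (y^2 +
  \<eta>^2), is bounded by 1 and tends to the sign of y off the axis, a null set; this is where the
  sign in \<open>coeff2\<close> comes from.\<close>

lemma extend_truncate_closure: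
  fixes n
  assumes \<phi>: "\<phi> \<in> mixed_functions upper ray"
  defines "T \<equiv> truncate \<phi> n"
  shows "(extend coeff0 T, extend coeff1 (dirderiv (1, 0) T), extend coeff2 (dirderiv (0, 1) T)) \<in> AB_closure punctured"
proof -
  have T: "smooth T" unfolding T_def using \<phi> by (intro smooth_truncate) (simp add: mixed_functions_def)
  note Td = smooth_dirderiv[OF T]
  obtain \<rho> where \<rho>: "\<rho> > 0"
    and near: "\<And>z k \<eta>. z \<in> \<Omega> \<Longrightarrow> k \<in> barrier \<Longrightarrow> dist z k < \<rho> \<Longrightarrow> 0 < \<eta> \<Longrightarrow> \<eta> < \<rho> \<Longrightarrow> T (lift \<eta> z) = 0"
    using truncate_near_barrier[OF \<phi>, of n] unfolding T_def by blast
  \<comment> \<open>The summand 2 keeps \<eta> strictly below \<rho> already for k = 0.\<close>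
  define \<eta> where "\<eta> k = \<rho> / (real k + 2)" for k :: nat
  have \<eta>: "0 < \<eta> k" "\<eta> k < \<rho>" "\<eta> k \<le> \<rho>" for k
    using \<rho> by (auto simp: \<eta>_def field_simps add_pos_nonneg)
  have \<eta>0: "\<eta> \<longlonglongrightarrow> 0"
    using LIMSEQ_ignore_initial_segment[OF lim_const_over_n[of \<rho>], of 2] by (simp add: \<eta>_def[abs_def] add.commute)
  define \<Phi> where "\<Phi> k = (\<lambda>z. if z \<in> \<Omega> then half_phase z * T (lift (\<eta> k) z) else 0)" for k
  have near': "T (lift (\<eta> k) z) = 0" if "z \<in> \<Omega>" "w \<in> barrier" "dist z w < \<rho>" for z w k
    by (rule near[OF that \<eta>(1,2)])
  have L: "\<Phi> k \<in> test_functions punctured"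
    "z \<in> \<Omega> \<Longrightarrow> z \<in> slit_plane \<Longrightarrow> AB_D1 (\<Phi> k) z = - \<i> * half_phase z * dirderiv (1, 0) T (lift (\<eta> k) z)"
    "z \<in> \<Omega> \<Longrightarrow> z \<in> slit_plane \<Longrightarrow> AB_D2 (\<Phi> k) z =
      - \<i> * half_phase z * (of_real (snd z / sqrt ((snd z)\<^sup>2 + (\<eta> k)\<^sup>2)) * dirderiv (0, 1) T (lift (\<eta> k) z))"
    "z \<notin> slit_plane \<Longrightarrow> AB_D1 (\<Phi> k) z = 0 \<and> AB_D2 (\<Phi> k) z = 0" for k z
    unfolding \<Phi>_def by (rule lifted_test_function[OF T \<eta>(1) \<rho> near']; assumption)+
  note sL = smooth_imp_L2[OF upper_borel upper_bounded]
  have m: "extend coeff0 T \<in> L2 punctured" "extend coeff1 (dirderiv (1, 0) T) \<in> L2 punctured"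
    "extend coeff2 (dirderiv (0, 1) T) \<in> L2 punctured"
    using fold_adjoint0 fold_adjoint1 fold_adjoint2 sL[OF T] sL[OF Td] by (auto simp: L2_adjoint_def)
  have mk: "\<Phi> k \<in> L2 punctured" "AB_D1 (\<Phi> k) \<in> L2 punctured" "AB_D2 (\<Phi> k) \<in> L2 punctured" for k
    using L2_graph_AB[OF punctured_open punctured_bounded punctured_0] L(1)[of k] by (auto simp: L2_graph_def)
  obtain R where R: "\<And>z. z \<in> \<Omega> \<Longrightarrow> norm z \<le> R" using bounded by (auto simp: bounded_iff)
  have liftR: "lift (\<eta> k) z \<in> cball 0 (R + \<rho>)" if "z \<in> \<Omega>" for k z
    using norm_triangle_ineq2[of "lift (\<eta> k) z" "upfold z"] dist_lift_upfold[OF \<eta>(1)[of k], of z] R[OF that] \<eta>(3)[of k]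
    by (simp add: dist_norm norm_upfold)
  have bd: "\<exists>B\<ge>0. \<forall>k. \<forall>z\<in>\<Omega>. cmod (f (lift (\<eta> k) z)) \<le> B" if "smooth f" for f :: cfun
  proof -
    have "compact (f ` cball 0 (R + \<rho>))"
      by (intro compact_continuous_image smooth_continuous[OF that] compact_cball)
    then obtain B where "\<forall>w\<in>f ` cball 0 (R + \<rho>). cmod w \<le> B"
      using compact_imp_bounded bounded_iff by metis
    then have "cmod (f (lift (\<eta> k) z)) \<le> max B 0" if "z \<in> \<Omega>" for k z
      using liftR[OF that, of k] by (meson image_eqI le_max_iff_disj)
    then show ?thesis by (intro exI[of _ "max B 0"]) simp
  qed
  have conv: "(\<lambda>k. f (lift (\<eta> k) z)) \<longlonglongrightarrow> f (upfold z)" if "smooth f" for f :: cfun and z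
  proof -
    have "(\<lambda>k. lift (\<eta> k) z) \<longlonglongrightarrow> upfold z"
      by (rule metric_tendsto_imp_tendsto[OF \<eta>0])
         (use dist_lift_upfold[OF \<eta>(1)] \<eta>(1) in \<open>auto intro!: always_eventually simp: dist_real_def abs_of_pos\<close>)
    moreover have "isCont f (upfold z)"
      using smooth_continuous[OF that, of UNIV] unfolding continuous_on_eq_continuous_at[OF open_UNIV] by blast
    ultimately show ?thesis by (rule isCont_tendsto_compose[rotated])
  qed
  have slope: "(\<lambda>k. y / sqrt (y\<^sup>2 + (\<eta> k)\<^sup>2)) \<longlonglongrightarrow> sgn y" if "y \<noteq> 0" for y
  proof -
    have "(\<lambda>k. y / sqrt (y\<^sup>2 + (\<eta> k)\<^sup>2)) \<longlonglongrightarrow> y / sqrt (y\<^sup>2 + 0\<^sup>2)"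
      using that by (intro tendsto_intros \<eta>0) auto
    then show ?thesis using that by (simp add: sgn_real_def abs_if split: if_splits)
  qed
  have slope_le: "\<bar>y / sqrt (y\<^sup>2 + (\<eta> k)\<^sup>2)\<bar> \<le> 1" for y k
  proof -
    have "\<bar>y\<bar> \<le> sqrt (y\<^sup>2 + (\<eta> k)\<^sup>2)" by (rule real_le_rsqrt) simp
    moreover have "sqrt (y\<^sup>2 + (\<eta> k)\<^sup>2) > 0" using \<eta>(1)[of k] by (simp add: add_nonneg_pos)
    ultimately show ?thesis by (simp only: abs_divide abs_of_pos divide_le_eq_1_pos)
  qed
  have off: "z \<in> slit_plane" if "snd z \<noteq> 0" for z using that by (simp add: slit_plane_def)
  have sub: "z \<in> \<Omega>" if "z \<in> punctured" for z using that by (simp add: punctured_def)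
  have p1: "cmod (half_phase z * w) \<le> B" if "cmod w \<le> B" for z w B
    using mult_mono[OF norm_half_phase_le[of z] that] by (simp add: norm_mult)
  have 0: "(\<lambda>k. L2_norm punctured (\<lambda>z. \<Phi> k z - extend coeff0 T z)) \<longlonglongrightarrow> 0"
  proof -
    obtain B where B: "B \<ge> 0" "\<forall>k. \<forall>z\<in>\<Omega>. cmod (T (lift (\<eta> k) z)) \<le> B" using bd[OF T] by blast
    show ?thesis
    proof (rule L2_dominated_convergence[OF punctured_borel punctured_bounded mk(1) m(1)])
      show "AE z in lborel. z \<in> punctured \<longrightarrow> (\<lambda>k. \<Phi> k z) \<longlonglongrightarrow> extend coeff0 T z"
        using AE_off_axis
      proof eventually_elim
        case (elim z)
        then show ?case using sub[of z] conv[OF T, of z]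
          by (auto simp: \<Phi>_def coeff0_def intro!: tendsto_intros)
      qed
      show "cmod (\<Phi> k z) \<le> B" if "z \<in> punctured" for k z
        using B(2) sub[OF that] by (simp add: \<Phi>_def p1)
    qed
  qed
  have 1: "(\<lambda>k. L2_norm punctured (\<lambda>z. AB_D1 (\<Phi> k) z - extend coeff1 (dirderiv (1, 0) T) z)) \<longlonglongrightarrow> 0"
  proof -
    obtain B where B: "B \<ge> 0" "\<forall>k. \<forall>z\<in>\<Omega>. cmod (dirderiv (1, 0) T (lift (\<eta> k) z)) \<le> B" using bd[OF Td] by blast
    show ?thesis
    proof (rule L2_dominated_convergence[OF punctured_borel punctured_bounded mk(2) m(2)])
      show "AE z in lborel. z \<in> punctured \<longrightarrow> (\<lambda>k. AB_D1 (\<Phi> k) z) \<longlonglongrightarrow> extend coeff1 (dirderiv (1, 0) T) z"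
        using AE_off_axis
      proof eventually_elim
        case (elim z)
        then show ?case using L(2)[OF sub off, of z]
          by (auto simp: coeff0_def coeff1_def intro!: tendsto_intros conv[OF Td])
      qed
      show "cmod (AB_D1 (\<Phi> k) z) \<le> B" if "z \<in> punctured" for k z
      proof (cases "z \<in> slit_plane")
        case True
        then show ?thesis using L(2)[OF sub[OF that] True, of k] B(2) sub[OF that]
          p1[of "dirderiv (1, 0) T (lift (\<eta> k) z)" B z] by (simp add: norm_mult)
      qed (use L(4) B in simp)
    qed
  qed
  have 2: "(\<lambda>k. L2_norm punctured (\<lambda>z. AB_D2 (\<Phi> k) z - extend coeff2 (dirderiv (0, 1) T) z)) \<longlonglongrightarrow> 0"
  proof -
    obtain B where B: "B \<ge> 0" "\<forall>k. \<forall>z\<in>\<Omega>. cmod (dirderiv (0, 1) T (lift (\<eta> k) z)) \<le> B" using bd[OF Td] by blast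
    show ?thesis
    proof (rule L2_dominated_convergence[OF punctured_borel punctured_bounded mk(3) m(3)])
      show "AE z in lborel. z \<in> punctured \<longrightarrow> (\<lambda>k. AB_D2 (\<Phi> k) z) \<longlonglongrightarrow> extend coeff2 (dirderiv (0, 1) T) z"
        using AE_off_axis
      proof eventually_elim
        case (elim z)
        show ?case
        proof
          assume "z \<in> punctured"
          have "(\<lambda>k. - \<i> * half_phase z * (of_real (snd z / sqrt ((snd z)\<^sup>2 + (\<eta> k)\<^sup>2)) * dirderiv (0, 1) T (lift (\<eta> k) z)))
            \<longlonglongrightarrow> - \<i> * half_phase z * (of_real (sgn (snd z)) * dirderiv (0, 1) T (upfold z))"
            by (rule tendsto_mult[OF tendsto_const tendsto_mult[OF tendsto_of_real[OF slope[OF elim]] conv[OF Td]]])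
          also have "- \<i> * half_phase z * (of_real (sgn (snd z)) * dirderiv (0, 1) T (upfold z)) =
            extend coeff2 (dirderiv (0, 1) T) z" using elim by (simp add: coeff2_def coeff0_def)
          finally show "(\<lambda>k. AB_D2 (\<Phi> k) z) \<longlonglongrightarrow> extend coeff2 (dirderiv (0, 1) T) z"
            unfolding L(3)[OF sub[OF \<open>z \<in> punctured\<close>] off[OF elim]] .
        qed
      qed
      show "cmod (AB_D2 (\<Phi> k) z) \<le> B" if "z \<in> punctured" for k z
      proof (cases "z \<in> slit_plane")
        case True
        have "cmod (of_real (snd z / sqrt ((snd z)\<^sup>2 + (\<eta> k)\<^sup>2)) * dirderiv (0, 1) T (lift (\<eta> k) z)) \<le> 1 * B"
          unfolding norm_mult norm_of_real using B sub[OF that] by (intro mult_mono slope_le) auto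
        from p1[OF this, of z] show ?thesis
          unfolding L(3)[OF sub[OF that] True] by (simp only: norm_mult mult.assoc norm_minus_cancel norm_ii mult_1_left)
      qed (use L(4) B in simp)
    qed
  qed
  show ?thesis
    unfolding graph_closure_iff_sequence
    by (intro conjI exI[of _ \<Phi>] allI m L(1) 0 1 2)
qed

text \<open>The limit over n. The truncations of \<phi> serve as a core of their own, with \<phi> in
  its closure, and \<open>graph_closure_map\<close> carries that closure across the fold.\<close>

lemma extend_closure:
  assumes \<phi>: "\<phi> \<in> mixed_functions upper ray"
  shows "(extend coeff0 \<phi>, extend coeff1 (dirderiv (1, 0) \<phi>), extend coeff2 (dirderiv (0, 1) \<phi>)) \<in> AB_closure punctured"
proof -
  have s: "smooth \<phi>" using \<phi> by (simp add: mixed_functions_def)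
  have G: "L2_graph upper (range (truncate \<phi>)) (dirderiv (1, 0)) (dirderiv (0, 1))"
    unfolding L2_graph_def
    by (auto intro!: upper_borel smooth_imp_L2[OF upper_borel upper_bounded] smooth_dirderiv smooth_truncate s)
  show ?thesis
    by (rule graph_closure_map[OF G L2_graph_AB[OF punctured_open punctured_bounded punctured_0]
          fold_adjoint0 fold_adjoint1 fold_adjoint2 _ truncate_closure[OF upper_open upper_bounded s]])
       (auto intro: extend_truncate_closure[OF \<phi>])
qed

end

section \<open>Equality of the spectra\<close>

lemma AE_lborel_iso:
  assumes "lborel_iso \<rho> \<rho>'" "AE z in lborel. P z"
  shows "AE z in lborel. P (\<rho> z)"
proof -
  have "distr lborel borel \<rho> = lborel" using assms(1) unfolding lborel_iso_def by blast
  then have "AE z in distr lborel borel \<rho>. P z" using assms(2) by (simp only:)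
  then show ?thesis using AE_distrD[of \<rho> lborel borel P] lborel_iso_measurable[OF assms(1)] by simp
qed

section \<open>Invariance under reflections and quarter turns\<close>

lemma weak_eigenvalues_pullback_subset:
  assumes \<rho>: "lborel_iso \<rho> \<rho>'" and UV: "U \<in> sets borel" "V \<in> sets borel" "\<And>z. z \<in> V \<longleftrightarrow> \<rho> z \<in> U"
    and G: "L2_graph U C d1 d2" "L2_graph V C' d1' d2'" and s: "s1 \<in> {-1, 1}" "s2 \<in> {-1, 1::complex}"
    and C: "\<And>\<phi>. \<phi> \<in> C \<Longrightarrow> (\<lambda>z. \<phi> (\<rho> z)) \<in> C'"
      "\<And>\<phi> z. \<phi> \<in> C \<Longrightarrow> z \<in> V \<Longrightarrow> d1' (\<lambda>z. \<phi> (\<rho> z)) z = s1 * d1 \<phi> (\<rho> z)"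
      "\<And>\<phi> z. \<phi> \<in> C \<Longrightarrow> z \<in> V \<Longrightarrow> d2' (\<lambda>z. \<phi> (\<rho> z)) z = s2 * d2 \<phi> (\<rho> z)"
    and C': "\<And>\<psi>. \<psi> \<in> C' \<Longrightarrow> (\<lambda>z. \<psi> (\<rho>' z)) \<in> C"
      "\<And>\<psi> z. \<psi> \<in> C' \<Longrightarrow> z \<in> U \<Longrightarrow> d1 (\<lambda>z. \<psi> (\<rho>' z)) z = s1 * d1' \<psi> (\<rho>' z)"
      "\<And>\<psi> z. \<psi> \<in> C' \<Longrightarrow> z \<in> U \<Longrightarrow> d2 (\<lambda>z. \<psi> (\<rho>' z)) z = s2 * d2' \<psi> (\<rho>' z)"
  shows "weak_eigenvalues U C d1 d2 \<subseteq> weak_eigenvalues V C' d1' d2'"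
proof
  fix \<mu> assume "\<mu> \<in> weak_eigenvalues U C d1 d2"
  then obtain w g1 g2 where w: "weak_solution U C d1 d2 \<mu> w g1 g2" and nz: "\<not> (AE z in lborel. z \<in> U \<longrightarrow> w z = 0)"
    unfolding weak_eigenvalues_def by blast
  have adj: "L2_adjoint U V (\<lambda>f z. c * f (\<rho> z)) (\<lambda>g z. c * g (\<rho>' z))" if "c \<in> {-1, 1}" for c
    using L2_adjoint_pullback[OF \<rho> UV, of "\<lambda>_. c"] that by auto
  have "weak_solution V C' d1' d2' \<mu> (\<lambda>z. 1 * w (\<rho> z)) (\<lambda>z. s1 * g1 (\<rho> z)) (\<lambda>z. s2 * g2 (\<rho> z))"
  proof (rule weak_solution_map[OF G adj adj[OF s(1)] adj[OF s(2)] _ _ w])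
    fix \<phi> assume p: "\<phi> \<in> C"
    show "(\<lambda>z. 1 * \<phi> (\<rho> z), \<lambda>z. s1 * d1 \<phi> (\<rho> z), \<lambda>z. s2 * d2 \<phi> (\<rho> z)) \<in> graph_closure V C' d1' d2'"
      by (rule graph_closure_cong[OF graph_closure_base[OF G(2) C(1)[OF p]]]) (use C(2,3)[OF p] in auto)
  next
    fix \<psi> assume p: "\<psi> \<in> C'"
    show "(\<lambda>z. 1 * \<psi> (\<rho>' z), \<lambda>z. s1 * d1' \<psi> (\<rho>' z), \<lambda>z. s2 * d2' \<psi> (\<rho>' z)) \<in> graph_closure U C d1 d2"
      by (rule graph_closure_cong[OF graph_closure_base[OF G(1) C'(1)[OF p]]]) (use C'(2,3)[OF p] in auto)
  qed simp
  moreover have "\<not> (AE z in lborel. z \<in> V \<longrightarrow> 1 * w (\<rho> z) = 0)"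
  proof
    assume "AE z in lborel. z \<in> V \<longrightarrow> 1 * w (\<rho> z) = 0"
    from AE_lborel_iso[OF lborel_iso_sym[OF \<rho>] this] nz show False
      by (simp add: UV(3) lborel_iso_inverse[OF \<rho>])
  qed
  ultimately show "\<mu> \<in> weak_eigenvalues V C' d1' d2'" unfolding weak_eigenvalues_def by blast
qed

lemma weak_eigenvalues_pullback:
  assumes \<rho>: "lborel_iso \<rho> \<rho>'" and UV: "U \<in> sets borel" "V \<in> sets borel" "\<And>z. z \<in> V \<longleftrightarrow> \<rho> z \<in> U"
    and G: "L2_graph U C d1 d2" "L2_graph V C' d1' d2'" and s: "s1 \<in> {-1, 1}" "s2 \<in> {-1, 1::complex}"
    and C: "\<And>\<phi>. \<phi> \<in> C \<Longrightarrow> (\<lambda>z. \<phi> (\<rho> z)) \<in> C'"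
      "\<And>\<phi> z. \<phi> \<in> C \<Longrightarrow> z \<in> V \<Longrightarrow> d1' (\<lambda>z. \<phi> (\<rho> z)) z = s1 * d1 \<phi> (\<rho> z)"
      "\<And>\<phi> z. \<phi> \<in> C \<Longrightarrow> z \<in> V \<Longrightarrow> d2' (\<lambda>z. \<phi> (\<rho> z)) z = s2 * d2 \<phi> (\<rho> z)"
    and C': "\<And>\<psi>. \<psi> \<in> C' \<Longrightarrow> (\<lambda>z. \<psi> (\<rho>' z)) \<in> C"
      "\<And>\<psi> z. \<psi> \<in> C' \<Longrightarrow> z \<in> U \<Longrightarrow> d1 (\<lambda>z. \<psi> (\<rho>' z)) z = s1 * d1' \<psi> (\<rho>' z)"
      "\<And>\<psi> z. \<psi> \<in> C' \<Longrightarrow> z \<in> U \<Longrightarrow> d2 (\<lambda>z. \<psi> (\<rho>' z)) z = s2 * d2' \<psi> (\<rho>' z)"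
  shows "weak_eigenvalues V C' d1' d2' = weak_eigenvalues U C d1 d2"
proof (rule subset_antisym)
  have VU: "z \<in> U \<longleftrightarrow> \<rho>' z \<in> V" for z using UV(3) lborel_iso_inverse[OF \<rho>] by simp
  show "weak_eigenvalues V C' d1' d2' \<subseteq> weak_eigenvalues U C d1 d2"
    by (rule weak_eigenvalues_pullback_subset[OF lborel_iso_sym[OF \<rho>] UV(2,1) VU G(2,1) s C' C])
  show "weak_eigenvalues U C d1 d2 \<subseteq> weak_eigenvalues V C' d1' d2'"
    by (rule weak_eigenvalues_pullback_subset[OF \<rho> UV G s C C'])
qed

lemma smooth_compose_linear:
  fixes L :: "plane \<Rightarrow> plane" and \<phi> :: cfun
  assumes "bounded_linear L" "smooth \<phi>"
  shows "smooth (\<lambda>z. \<phi> (L z))"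
proof -
  have "smooth_on UNIV (\<lambda>z. \<phi> (L z))"
    by (rule smooth_on_compose[OF open_UNIV open_UNIV _ _ smooth_on_bounded_linear[OF open_UNIV assms(1)]])
       (use assms(2) in \<open>auto simp: smooth_on_UNIV\<close>)
  then show ?thesis by (simp add: smooth_on_UNIV)
qed

lemma test_functions_compose_linear:
  assumes L: "bounded_linear L" "bounded_linear L'" "\<And>z. L (L' z) = z" "\<And>z. L' (L z) = z"
    and VU: "\<And>z. z \<in> V \<longleftrightarrow> L z \<in> U" and \<phi>: "\<phi> \<in> test_functions U"
  shows "(\<lambda>z. \<phi> (L z)) \<in> test_functions V"
proof -
  obtain S where S: "smooth \<phi>" "compact S" "S \<subseteq> U" "\<And>z. z \<notin> S \<Longrightarrow> \<phi> z = 0"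
    using test_functionsE[OF \<phi>] by blast
  show ?thesis
  proof (rule test_functionsI[OF smooth_compose_linear[OF L(1) S(1)]])
    show "compact (L' ` S)" by (intro compact_continuous_image S(2) linear_continuous_on L(2))
    show "L' ` S \<subseteq> V"
    proof (rule image_subsetI)
      fix w assume "w \<in> S"
      then have "L (L' w) \<in> U" using S(3) L(3)[of w] by auto
      then show "L' w \<in> V" using VU by blast
    qed
    fix z assume "z \<notin> L' ` S"
    then have "L z \<notin> S" using L(4)[of z] by (metis imageI)
    then show "\<phi> (L z) = 0" by (rule S(4))
  qed
qed

lemma mixed_functions_compose_linear:
  fixes L :: "plane \<Rightarrow> plane"
  assumes L: "bounded_linear L" "bounded_linear L'" "\<And>z. L (L' z) = z" "\<And>z. L' (L z) = z"
    and VU: "\<And>z. z \<in> V \<longleftrightarrow> L z \<in> U" and N: "\<And>z. z \<in> N' \<longleftrightarrow> L z \<in> N" and \<phi>: "\<phi> \<in> mixed_functions U N"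
  shows "(\<lambda>z. \<phi> (L z)) \<in> mixed_functions V N'"
proof -
  have "V = L' ` U"
  proof (intro set_eqI iffI)
    fix z assume "z \<in> V"
    then show "z \<in> L' ` U" using VU L(4)[of z] by (metis imageI)
  next
    fix z assume "z \<in> L' ` U"
    then obtain w where "w \<in> U" "z = L' w" by blast
    then show "z \<in> V" using VU[of z] L(3)[of w] by simp
  qed
  moreover have "inj L'" by (metis injI L(3))
  moreover have "linear L'" using L(2) by (rule bounded_linear.linear)
  moreover have "surj L'" by (metis surjI L(4))
  ultimately have "frontier V = L' ` frontier U"
    by (simp add: frontier_def closure_injective_linear_image interior_bijective_linear_image bij_def image_set_diff)
  then have "L z \<in> frontier U" if "z \<in> frontier V" for z
  proof -
    from that \<open>frontier V = L' ` frontier U\<close> obtain w where "w \<in> frontier U" "z = L' w" by blast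
    then show ?thesis using L(3)[of w] by simp
  qed
  then show ?thesis using \<phi> N by (auto simp: mixed_functions_def intro!: smooth_compose_linear[OF L(1)])
qed

definition reflect :: "plane \<Rightarrow> plane" where "reflect z = (- fst z, snd z)"
text \<open>This quarter turn takes the left half to the upper half and the positive y-axis to the
  positive x-axis. A turn is chosen instead of the exchange of coordinates because it preserves the
  potential, which the exchange would turn into its negative.\<close>

definition rot :: "plane \<Rightarrow> plane" where "rot z = (snd z, - fst z)"
definition rot' :: "plane \<Rightarrow> plane" where "rot' z = (- snd z, fst z)"

lemma bounded_linear_reflect: "bounded_linear reflect"
  unfolding reflect_def[abs_def]
  by (intro bounded_linear_Pair bounded_linear_minus[OF bounded_linear_fst] bounded_linear_snd)

lemma bounded_linear_rot: "bounded_linear rot" "bounded_linear rot'"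
  unfolding rot_def[abs_def] rot'_def[abs_def]
  by (intro bounded_linear_Pair bounded_linear_minus[OF bounded_linear_fst] bounded_linear_minus[OF bounded_linear_snd]
      bounded_linear_snd bounded_linear_fst)+

lemma reflect_reflect [simp]: "reflect (reflect z) = z" and rot_rot' [simp]: "rot (rot' z) = z" "rot' (rot z) = z"
  by (simp_all add: reflect_def rot_def rot'_def)

lemma lborel_iso_reflect: "lborel_iso reflect reflect"
  using lborel_iso_linear_scale[of "-1" 1] by (simp add: reflect_def[abs_def] case_prod_unfold)

lemma lborel_iso_rot: "lborel_iso rot rot'"
proof -
  have "rot = (\<lambda>z. (\<lambda>(x, y). (y, x)) (reflect z))" "rot' = (\<lambda>z. reflect ((\<lambda>(x, y). (y, x)) z))"
    by (auto simp: rot_def rot'_def reflect_def)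
  then show ?thesis using lborel_iso_compose[OF lborel_iso_swap lborel_iso_reflect] by simp
qed

text \<open>Meant for the reflections in the axes: s1 and s2 record which partial derivative changes
  sign.\<close>

lemma weak_eigenvalues_mixed_involution:
  assumes U: "open U" "bounded U" and V: "open V" "bounded V"
    and L: "lborel_iso L L" "bounded_linear L" "\<And>z. L (L z) = z"
    and s: "s1 \<in> {-1, 1}" "s2 \<in> {-1, 1}" "L (1, 0) = (s1, 0)" "L (0, 1) = (0, s2)"
    and VU: "\<And>z. z \<in> V \<longleftrightarrow> L z \<in> U" and N: "\<And>z. z \<in> N' \<longleftrightarrow> L z \<in> N"
  shows "weak_eigenvalues V (mixed_functions V N') (dirderiv (1, 0)) (dirderiv (0, 1)) =
    weak_eigenvalues U (mixed_functions U N) (dirderiv (1, 0)) (dirderiv (0, 1))"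
proof (rule weak_eigenvalues_pullback[OF L(1) _ _ VU L2_graph_mixed[OF U] L2_graph_mixed[OF V],
      where ?s1.0="of_real s1" and ?s2.0="of_real s2"])
  note m = mixed_functions_compose_linear[OF L(2) L(2) L(3) L(3)]
  have UV: "z \<in> U \<longleftrightarrow> L z \<in> V" "z \<in> N \<longleftrightarrow> L z \<in> N'" for z using VU[of "L z"] N[of "L z"] L(3) by simp_all
  show "(\<lambda>z. \<phi> (L z)) \<in> mixed_functions V N'" if "\<phi> \<in> mixed_functions U N" for \<phi> by (rule m[OF VU N that])
  show "(\<lambda>z. \<phi> (L z)) \<in> mixed_functions U N" if "\<phi> \<in> mixed_functions V N'" for \<phi> by (rule m[OF UV that])
  have d: "dirderiv (1, 0) (\<lambda>z. \<phi> (L z)) z = of_real s1 * dirderiv (1, 0) \<phi> (L z)"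
    "dirderiv (0, 1) (\<lambda>z. \<phi> (L z)) z = of_real s2 * dirderiv (0, 1) \<phi> (L z)" if "smooth \<phi>" for \<phi> :: cfun and z
    using dirderiv_compose_linear(2)[OF L(2) smooth_differentiable[OF that]] s
      dirderiv_uminus_direction[OF smooth_differentiable[OF that], where e="(1, 0)" and z="L z"]
      dirderiv_uminus_direction[OF smooth_differentiable[OF that], where e="(0, 1)" and z="L z"]
    by auto
  show "dirderiv (1, 0) (\<lambda>z. \<phi> (L z)) z = of_real s1 * dirderiv (1, 0) \<phi> (L z)"
    "dirderiv (0, 1) (\<lambda>z. \<phi> (L z)) z = of_real s2 * dirderiv (0, 1) \<phi> (L z)"
    if "\<phi> \<in> mixed_functions U N" for \<phi> z using that d by (simp_all add: mixed_functions_def)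
  show "dirderiv (1, 0) (\<lambda>z. \<phi> (L z)) z = of_real s1 * dirderiv (1, 0) \<phi> (L z)"
    "dirderiv (0, 1) (\<lambda>z. \<phi> (L z)) z = of_real s2 * dirderiv (0, 1) \<phi> (L z)"
    if "\<phi> \<in> mixed_functions V N'" for \<phi> z using that d by (simp_all add: mixed_functions_def)
qed (use U V s in auto)

lemma dirderiv_rot:
  assumes "smooth (\<phi> :: cfun)"
  shows "dirderiv (1, 0) (\<lambda>z. \<phi> (rot z)) z = - 1 * dirderiv (0, 1) \<phi> (rot z)"
    "dirderiv (0, 1) (\<lambda>z. \<phi> (rot z)) z = 1 * dirderiv (1, 0) \<phi> (rot z)"
    "dirderiv (0, 1) (\<lambda>z. \<phi> (rot' z)) z = - 1 * dirderiv (1, 0) \<phi> (rot' z)"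
    "dirderiv (1, 0) (\<lambda>z. \<phi> (rot' z)) z = 1 * dirderiv (0, 1) \<phi> (rot' z)"
  using dirderiv_compose_linear(2)[OF bounded_linear_rot(1) smooth_differentiable[OF assms]]
    dirderiv_compose_linear(2)[OF bounded_linear_rot(2) smooth_differentiable[OF assms]]
    dirderiv_uminus_direction[OF smooth_differentiable[OF assms], where e="(1, 0)"]
    dirderiv_uminus_direction[OF smooth_differentiable[OF assms], where e="(0, 1)"]
  by (simp_all add: rot_def rot'_def)

text \<open>A quarter turn exchanges the two partial derivatives up to sign, so the pullback is
  applied to the source with its derivatives in exchanged order.\<close>

lemma weak_eigenvalues_mixed_rot:
  assumes U: "open U" "bounded U" and V: "open V" "bounded V"
    and VU: "\<And>z. z \<in> V \<longleftrightarrow> rot z \<in> U" and N: "\<And>z. z \<in> N' \<longleftrightarrow> rot z \<in> N"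
  shows "weak_eigenvalues V (mixed_functions V N') (dirderiv (1, 0)) (dirderiv (0, 1)) =
    weak_eigenvalues U (mixed_functions U N) (dirderiv (1, 0)) (dirderiv (0, 1))"
proof (rule trans[OF weak_eigenvalues_pullback[OF lborel_iso_rot _ _ VU L2_graph_swap[THEN iffD2, OF L2_graph_mixed[OF U]]
      L2_graph_mixed[OF V], where ?s1.0="-1" and ?s2.0=1] weak_eigenvalues_swap])
  have UV: "z \<in> U \<longleftrightarrow> rot' z \<in> V" "z \<in> N \<longleftrightarrow> rot' z \<in> N'" for z using VU[of "rot' z"] N[of "rot' z"] by auto
  show "(\<lambda>z. \<phi> (rot z)) \<in> mixed_functions V N'" if "\<phi> \<in> mixed_functions U N" for \<phi>
    by (rule mixed_functions_compose_linear[OF bounded_linear_rot rot_rot' VU N that])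
  show "(\<lambda>z. \<phi> (rot' z)) \<in> mixed_functions U N" if "\<phi> \<in> mixed_functions V N'" for \<phi>
    by (rule mixed_functions_compose_linear[OF bounded_linear_rot(2,1) rot_rot'(2,1) UV that])
qed (use U V dirderiv_rot in \<open>auto simp: mixed_functions_def\<close>)

lemma weak_eigenvalues_AB_rot:
  assumes U: "open U" "bounded U" "0 \<notin> U" and V: "open V" "bounded V" "0 \<notin> V"
    and VU: "\<And>z. z \<in> V \<longleftrightarrow> rot z \<in> U"
  shows "weak_eigenvalues V (test_functions V) AB_D1 AB_D2 = weak_eigenvalues U (test_functions U) AB_D1 AB_D2"
proof (rule trans[OF weak_eigenvalues_pullback[OF lborel_iso_rot _ _ VU L2_graph_swap[THEN iffD2, OF L2_graph_AB[OF U]]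
      L2_graph_AB[OF V], where ?s1.0="-1" and ?s2.0=1] weak_eigenvalues_swap])
  have UV: "z \<in> U \<longleftrightarrow> rot' z \<in> V" for z using VU[of "rot' z"] by auto
  show "(\<lambda>z. \<phi> (rot z)) \<in> test_functions V" if "\<phi> \<in> test_functions U" for \<phi>
    by (rule test_functions_compose_linear[OF bounded_linear_rot rot_rot' VU that])
  show "(\<lambda>z. \<phi> (rot' z)) \<in> test_functions U" if "\<phi> \<in> test_functions V" for \<phi>
    by (rule test_functions_compose_linear[OF bounded_linear_rot(2,1) rot_rot'(2,1) UV that])
  have A: "AB_A1 (rot z) = AB_A2 z" "AB_A2 (rot z) = - AB_A1 z" "AB_A1 (rot' z) = - AB_A2 z" "AB_A2 (rot' z) = AB_A1 z" for z
    by (simp_all add: AB_A1_def AB_A2_def rot_def rot'_def case_prod_unfold add.commute)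
  have d: "AB_D1 (\<lambda>z. \<phi> (rot z)) z = - 1 * AB_D2 \<phi> (rot z)" "AB_D2 (\<lambda>z. \<phi> (rot z)) z = 1 * AB_D1 \<phi> (rot z)"
    "AB_D2 (\<lambda>z. \<phi> (rot' z)) z = - 1 * AB_D1 \<phi> (rot' z)" "AB_D1 (\<lambda>z. \<phi> (rot' z)) z = 1 * AB_D2 \<phi> (rot' z)"
    if "smooth \<phi>" for \<phi> z
    unfolding mag_D_def dirderiv_rot[OF that] A by (simp_all add: algebra_simps)
  show "AB_D1 (\<lambda>z. \<phi> (rot z)) z = - 1 * AB_D2 \<phi> (rot z)" "AB_D2 (\<lambda>z. \<phi> (rot z)) z = 1 * AB_D1 \<phi> (rot z)"
    if "\<phi> \<in> test_functions U" for \<phi> z using d test_functions_smooth[OF that] by auto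
  show "AB_D2 (\<lambda>z. \<phi> (rot' z)) z = - 1 * AB_D1 \<phi> (rot' z)" "AB_D1 (\<lambda>z. \<phi> (rot' z)) z = 1 * AB_D2 \<phi> (rot' z)"
    if "\<phi> \<in> test_functions V" for \<phi> z using d test_functions_smooth[OF that] by auto
qed (use U V in auto)

section \<open>The symmetry that exchanges even and odd parts\<close>

lemma phase_measurable: "phase \<in> borel_measurable borel"
proof -
  have "phase = (\<lambda>z. inverse (norm z) *\<^sub>R (complex_of_real (fst z) + \<i> * complex_of_real (snd z)))"
    by (auto simp: phase_def[abs_def] scaleR_conv_of_real Complex_eq divide_inverse mult.commute)
  also have "\<dots> \<in> borel_measurable borel"
  proof -
    have [measurable]: "(\<lambda>z::plane. complex_of_real (fst z) + \<i> * complex_of_real (snd z)) \<in> borel_measurable borel"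
      by (intro borel_measurable_continuous_onI continuous_intros)
    show ?thesis by measurable
  qed
  finally show ?thesis .
qed

lemma norm_phase_le: "cmod (phase z) \<le> 1"
proof -
  have "cmod (Complex (fst z) (snd z)) = norm z" by (simp add: cmod_def norm_prod_def)
  then show ?thesis by (simp add: phase_def norm_divide)
qed

text \<open>The left side is the coefficient of the adjoint of f \<mapsto> phase f(-x, y), so that
  map is minus its own adjoint.\<close>

lemma phase_reflect: "cnj (phase (reflect z)) = - phase z"
proof -
  have "norm (reflect z) = norm z" by (simp add: reflect_def norm_prod_def)
  then show ?thesis by (simp add: phase_def reflect_def complex_eq_iff)
qed

lemma smooth_on_phase: "smooth_on (- {0}) phase"
proof -
  have o: "open (- {0::plane})" by auto
  have "smooth_on (- {0}) (\<lambda>z. inverse (norm z) *\<^sub>R Complex (fst z) (snd z))"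
    by (intro smooth_on_scaleR smooth_on_inverse smooth_on_norm_plane smooth_on_Complex o
        smooth_on_bounded_linear bounded_linear_fst bounded_linear_snd) auto
  then show ?thesis
    by (rule smooth_on_cong[OF o]) (simp add: phase_def scaleR_conv_of_real divide_inverse mult.commute)
qed

locale doubly_symmetric_domain = mirror_domain +
  assumes reflect: "\<And>z. z \<in> \<Omega> \<Longrightarrow> reflect z \<in> \<Omega>"
begin

lemma reflect_punctured: "z \<in> punctured \<longleftrightarrow> reflect z \<in> punctured"
proof -
  have "reflect z \<in> punctured" if "z \<in> punctured" for z
    using that reflect[of z] by (auto simp: punctured_def reflect_def prod_eq_iff)
  from this[of z] this[of "reflect z"] show ?thesis by auto
qed

text \<open>The reflection reverses the circulation and turns the potential A into -A; the factor
  exp (\<i>\<theta>) then adds 2 A and restores it. The constant s is free because the adjoint map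
  needs s = -1.\<close>

lemma phase_reflect_test:
  assumes \<phi>: "\<phi> \<in> test_functions punctured"
  shows "((\<lambda>z. s * phase z * \<phi> (reflect z)), (\<lambda>z. - s * phase z * AB_D1 \<phi> (reflect z)),
    (\<lambda>z. s * phase z * AB_D2 \<phi> (reflect z))) \<in> AB_closure punctured"
proof -
  let ?f = "\<lambda>z. s * (phase z * \<phi> (reflect z))"
  have r: "(\<lambda>z. \<phi> (reflect z)) \<in> test_functions punctured"
    by (rule test_functions_compose_linear[OF bounded_linear_reflect bounded_linear_reflect
          reflect_reflect reflect_reflect reflect_punctured \<phi>])
  have "(\<lambda>z. phase z * \<phi> (reflect z)) \<in> test_functions punctured"
    by (rule test_functions_mult_local[OF r _ _ smooth_on_phase]) (use punctured_0 in auto)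
  from test_functions_mult[OF this smooth_const, of s] have f: "?f \<in> test_functions punctured" .
  have d: "\<phi> differentiable at z" for z by (rule smooth_differentiable[OF test_functions_smooth[OF \<phi>]])
  note dr = dirderiv_compose_linear[OF bounded_linear_reflect d]
  have m: "reflect (1, 0) = - (1, 0)" "reflect (0, 1) = (0, 1)" by (simp_all add: reflect_def)
  have A: "AB_A1 (reflect z) = AB_A1 z" "AB_A2 (reflect z) = - AB_A2 z" for z
    by (simp_all add: AB_A1_def AB_A2_def reflect_def case_prod_unfold)
  have der: "dirderiv e ?f z = s * (phase z * dirderiv (reflect e) \<phi> (reflect z) + dirderiv e phase z * \<phi> (reflect z))"
    if "z \<noteq> 0" for e z
    using dirderiv_cmult[OF differentiable_mult[OF phase_has_derivative(1)[OF that] dr(1)]]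
      dirderiv_mult[OF phase_has_derivative(1)[OF that] dr(1)] dr(2) by simp
  show ?thesis
  proof (rule graph_closure_cong[OF graph_closure_base[OF L2_graph_AB[OF punctured_open punctured_bounded punctured_0] f]])
    fix z assume "z \<in> punctured"
    then have z: "z \<noteq> 0" by (simp add: punctured_def)
    show "?f z = s * phase z * \<phi> (reflect z)" by simp
    show "AB_D1 ?f z = - s * phase z * AB_D1 \<phi> (reflect z)"
      unfolding mag_D_def der[OF z] m dirderiv_uminus_direction[OF d] phase_has_derivative(2)[OF z] A
      by (simp add: algebra_simps)
    show "AB_D2 ?f z = s * phase z * AB_D2 \<phi> (reflect z)"
      unfolding mag_D_def der[OF z] m phase_has_derivative(3)[OF z] A by (simp add: algebra_simps)
  qed
qed

lemma weak_solution_phase_reflect: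
  assumes u: "weak_solution punctured (test_functions punctured) AB_D1 AB_D2 \<mu> u g1 g2"
  shows "weak_solution punctured (test_functions punctured) AB_D1 AB_D2 \<mu> (\<lambda>z. phase z * u (reflect z))
    (\<lambda>z. - phase z * g1 (reflect z)) (\<lambda>z. phase z * g2 (reflect z))"
proof -
  note G = L2_graph_AB[OF punctured_open punctured_bounded punctured_0]
  have m: "(\<lambda>z. - phase z) \<in> borel_measurable borel" using phase_measurable by measurable
  have n: "cmod (- phase z) \<le> 1" for z using norm_phase_le by simp
  note adj = L2_adjoint_pullback[OF lborel_iso_reflect punctured_borel punctured_borel reflect_punctured]
  show ?thesis
  proof (rule weak_solution_map[OF G G adj[OF phase_measurable norm_phase_le] adj[OF m n] adj[OF phase_measurable norm_phase_le] _ _ u])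
    fix \<phi> assume p: "\<phi> \<in> test_functions punctured"
    show "(\<lambda>z. phase z * \<phi> (reflect z), \<lambda>z. - phase z * AB_D1 \<phi> (reflect z), \<lambda>z. phase z * AB_D2 \<phi> (reflect z)) \<in> AB_closure punctured"
      using phase_reflect_test[OF p, of 1] by simp
    show "(\<lambda>z. cnj (phase (reflect z)) * \<phi> (reflect z), \<lambda>z. cnj (- phase (reflect z)) * AB_D1 \<phi> (reflect z),
      \<lambda>z. cnj (phase (reflect z)) * AB_D2 \<phi> (reflect z)) \<in> AB_closure punctured"
      using phase_reflect_test[OF p, of "-1"] by (simp add: phase_reflect)
  qed
qed

lemma symmetrize_upper:
  assumes "z \<in> upper"
  shows "symmetrize coeff0 u z = cnj (half_phase z) * u z + half_phase z * u (mirror z)"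
  using assms half_phase_mirror[of "fst z" "snd z"]
  by (simp add: coeff0_def upper_def mirror_def)

text \<open>The first condition says that the even part of q^-1 u vanishes. At the reflected point
  the half phase is \<i> times the conjugate of q, and the phase is minus the square of that
  conjugate; with these values the second condition becomes \<i> times the same statement for the
  odd part.\<close>

lemma symmetrize_both_zero:
  assumes z: "z \<in> upper" and 1: "symmetrize coeff0 u z = 0"
    and 2: "symmetrize coeff0 (\<lambda>z. phase z * u (reflect z)) (reflect z) = 0"
  shows "u z = 0 \<and> u (mirror z) = 0"
proof -
  define q where "q = half_phase z"
  have sp: "z \<in> slit_plane" "reflect z \<in> slit_plane" using z by (auto simp: upper_def slit_plane_def reflect_def)
  have rz: "reflect z \<in> upper" using z reflect[of z] by (auto simp: upper_def reflect_def)
  have q: "q * cnj q = 1" unfolding q_def by (rule half_phase_mult_cnj(1)[OF sp(1)])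
  have rq: "half_phase (reflect z) = \<i> * cnj q"
    using half_phase_reflect[of "snd z" "fst z"] z by (simp add: q_def reflect_def upper_def)
  have ph: "phase (reflect z) = - (cnj q * cnj q)"
    using half_phase_square[OF sp(2)] by (simp add: rq mult_ac power_mult_distrib flip: power2_eq_square)
  have phm: "phase (mirror (reflect z)) = cnj (phase (reflect z))"
    by (simp add: phase_def mirror_def reflect_def norm_Pair complex_eq_iff)
  have e1: "cnj q * u z + q * u (mirror z) = 0" using 1 symmetrize_upper[OF z] by (simp add: q_def)
  have rm: "reflect (mirror (reflect z)) = mirror z" by (simp add: reflect_def mirror_def)
  have "cnj (half_phase (reflect z)) * (phase (reflect z) * u z) +
      half_phase (reflect z) * (phase (mirror (reflect z)) * u (mirror z)) = 0"
    using 2 symmetrize_upper[OF rz, of "\<lambda>z. phase z * u (reflect z)"] by (simp add: rm)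
  then have "- \<i> * q * (- (cnj q * cnj q) * u z) + \<i> * cnj q * (- (q * q) * u (mirror z)) = 0"
    unfolding phm ph rq by simp
  then have "\<i> * ((q * cnj q) * (cnj q * u z) - (q * cnj q) * (q * u (mirror z))) = 0"
    by (simp add: algebra_simps)
  then have e2: "cnj q * u z - q * u (mirror z) = 0" by (simp add: q)
  from e1 e2 have "2 * (cnj q * u z) = 0" "2 * (q * u (mirror z)) = 0" by (simp_all add: algebra_simps)
  moreover have "q \<noteq> 0" using q by auto
  ultimately show ?thesis by simp
qed

theorem weak_eigenvalues_upper:
  "weak_eigenvalues upper (mixed_functions upper ray) (dirderiv (1, 0)) (dirderiv (0, 1)) =
    weak_eigenvalues punctured (test_functions punctured) AB_D1 AB_D2" (is "?DN = ?AB")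
proof (intro subset_antisym subsetI)
  note GU = L2_graph_mixed[OF upper_open upper_bounded, of ray]
  note GA = L2_graph_AB[OF punctured_open punctured_bounded punctured_0]
  fix \<mu>
  {
    assume "\<mu> \<in> ?DN"
    then obtain w g1 g2 where
      w: "weak_solution upper (mixed_functions upper ray) (dirderiv (1, 0)) (dirderiv (0, 1)) \<mu> w g1 g2"
      and nz: "\<not> (AE z in lborel. z \<in> upper \<longrightarrow> w z = 0)"
      unfolding weak_eigenvalues_def by blast
    have "weak_solution punctured (test_functions punctured) AB_D1 AB_D2 \<mu> (extend coeff0 w) (extend coeff1 g1) (extend coeff2 g2)"
      by (rule weak_solution_map[OF GU GA fold_adjoint0 fold_adjoint1 fold_adjoint2 extend_closure symmetrize_closure w])
    moreover have "\<not> (AE z in lborel. z \<in> punctured \<longrightarrow> extend coeff0 w z = 0)"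
    proof
      assume "AE z in lborel. z \<in> punctured \<longrightarrow> extend coeff0 w z = 0"
      then have "AE z in lborel. z \<in> upper \<longrightarrow> w z = 0"
      proof eventually_elim
        case (elim z)
        show ?case
        proof
          assume z: "z \<in> upper"
          then have "z \<in> punctured" "upfold z = z" "coeff0 z = half_phase z"
            by (auto simp: upper_def punctured_def upfold_def coeff0_def)
          moreover have "half_phase z \<noteq> 0" using norm_half_phase[OF upper_slit_plane(1)[OF z]] by auto
          ultimately show "w z = 0" using elim by simp
        qed
      qed
      with nz show False by simp
    qed
    ultimately show "\<mu> \<in> ?AB" unfolding weak_eigenvalues_def by blast
  next
    assume "\<mu> \<in> ?AB"
    then obtain u g1 g2 where
      u: "weak_solution punctured (test_functions punctured) AB_D1 AB_D2 \<mu> u g1 g2"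
      and nz: "\<not> (AE z in lborel. z \<in> punctured \<longrightarrow> u z = 0)"
      unfolding weak_eigenvalues_def by blast
    \<comment> \<open>Used twice, for u and for its image under the symmetry; if \<mu> were missing,
      both symmetrizations would vanish.\<close>
    have sol: "\<mu> \<in> ?DN" if v: "weak_solution punctured (test_functions punctured) AB_D1 AB_D2 \<mu> v h1 h2"
      and nv: "\<not> (AE z in lborel. z \<in> upper \<longrightarrow> symmetrize coeff0 v z = 0)" for v h1 h2
    proof -
      have "weak_solution upper (mixed_functions upper ray) (dirderiv (1, 0)) (dirderiv (0, 1)) \<mu>
        (symmetrize coeff0 v) (symmetrize coeff1 h1) (symmetrize coeff2 h2)"
        by (rule weak_solution_map[OF GA GU fold_adjoint0[THEN L2_adjoint_sym] fold_adjoint1[THEN L2_adjoint_sym]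
              fold_adjoint2[THEN L2_adjoint_sym] symmetrize_closure extend_closure v])
      with nv show ?thesis unfolding weak_eigenvalues_def by blast
    qed
    show "\<mu> \<in> ?DN"
    proof (rule ccontr)
      assume no: "\<mu> \<notin> ?DN"
      have 1: "AE z in lborel. z \<in> upper \<longrightarrow> symmetrize coeff0 u z = 0" using sol[OF u] no by blast
      have "AE z in lborel. z \<in> upper \<longrightarrow> symmetrize coeff0 (\<lambda>z. phase z * u (reflect z)) z = 0"
        using sol[OF weak_solution_phase_reflect[OF u]] no by blast
      from AE_lborel_iso[OF lborel_iso_reflect this]
      have 2: "AE z in lborel. reflect z \<in> upper \<longrightarrow> symmetrize coeff0 (\<lambda>z. phase z * u (reflect z)) (reflect z) = 0" .
      have 3: "AE z in lborel. z \<in> upper \<longrightarrow> u z = 0 \<and> u (mirror z) = 0"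
        using 1 2
      proof eventually_elim
        case (elim z)
        show ?case
        proof
          assume z: "z \<in> upper"
          then have "reflect z \<in> upper" using reflect[of z] by (auto simp: upper_def reflect_def)
          with elim z show "u z = 0 \<and> u (mirror z) = 0" by (intro symmetrize_both_zero) blast+
        qed
      qed
      \<comment> \<open>Off the axis, which is a null set, either the point or its mirror image lies
        in the upper half.\<close>
      have "AE z in lborel. z \<in> punctured \<longrightarrow> u z = 0"
        using 3 AE_lborel_iso[OF lborel_iso_mirror 3] AE_off_axis
      proof eventually_elim
        case (elim z)
        show ?case
        proof
          assume "z \<in> punctured"
          then have "z \<in> \<Omega>" "mirror z \<in> \<Omega>" using mirror by (auto simp: punctured_def)
          then have "z \<in> upper \<or> mirror z \<in> upper" using elim(3) by (auto simp: upper_def mirror_def)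
          then show "u z = 0" using elim(1,2) by auto
        qed
      qed
      with nz show False by simp
    qed
  }
qed

end

theorem proposition5p7:
  fixes \<Omega> \<Omega>dot \<Omega>uh \<Omega>lh \<Omega>leh \<Omega>rih :: "(real \<times> real) set" and a b :: real
  assumes "bounded \<Omega>" and "convex \<Omega>" and "open \<Omega>"
    and "piecewise_smooth_boundary \<Omega>"
    and "(0, 0) \<in> \<Omega>"
    and "\<Omega>dot = \<Omega> - {(0, 0)}"
    and "(\<lambda>(x, y). (- x, y)) ` \<Omega>dot = \<Omega>dot"
    and "(\<lambda>(x, y). (x, - y)) ` \<Omega>dot = \<Omega>dot"
    and "\<Omega> \<inter> {(x, y). y = 0} = {- a / 2<..<a / 2} \<times> {0}"
    and "\<Omega> \<inter> {(x, y). x = 0} = {0} \<times> {- b / 2<..<b / 2}"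
    and "\<Omega>uh = \<Omega> \<inter> {(x, y). y > 0}"
    and "\<Omega>lh = \<Omega> \<inter> {(x, y). y < 0}"
    and "\<Omega>leh = \<Omega> \<inter> {(x, y). x < 0}"
    and "\<Omega>rih = \<Omega> \<inter> {(x, y). x > 0}"
  shows "eigenvalues \<Omega>uh (DN_Laplacian \<Omega>uh ({0<..a / 2} \<times> {0})) = eigenvalues \<Omega>dot (AB_Dirichlet \<Omega>dot) \<and>
    eigenvalues \<Omega>leh (DN_Laplacian \<Omega>leh ({0} \<times> {0<..b / 2})) = eigenvalues \<Omega>dot (AB_Dirichlet \<Omega>dot) \<and>
    eigenvalues \<Omega>lh (DN_Laplacian \<Omega>lh ({0<..a / 2} \<times> {0})) = eigenvalues \<Omega>dot (AB_Dirichlet \<Omega>dot) \<and>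
    eigenvalues \<Omega>rih (DN_Laplacian \<Omega>rih ({0} \<times> {0<..b / 2})) = eigenvalues \<Omega>dot (AB_Dirichlet \<Omega>dot)"
proof -
  have dot: "\<Omega>dot = \<Omega> - {0}" using assms(6) by (simp add: zero_prod_def)
  have refl: "reflect z \<in> \<Omega>" if "z \<in> \<Omega>" for z
  proof (cases "z = 0")
    case False
    then have "(\<lambda>(x, y). (- x, y)) z \<in> \<Omega>dot" using that assms(7) dot by blast
    then show ?thesis by (simp add: reflect_def dot case_prod_unfold)
  qed (use that in \<open>simp add: reflect_def zero_prod_def\<close>)
  have mirr: "mirror z \<in> \<Omega>" if "z \<in> \<Omega>" for z
  proof (cases "z = 0")
    case False
    then have "(\<lambda>(x, y). (x, - y)) z \<in> \<Omega>dot" using that assms(8) dot by blast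
    then show ?thesis by (simp add: mirror_def dot case_prod_unfold)
  qed (use that in \<open>simp add: mirror_def zero_prod_def\<close>)
  have axa: "(x, 0) \<in> \<Omega> \<longleftrightarrow> - a / 2 < x \<and> x < a / 2" for x
    using assms(9) by (auto simp: set_eq_iff)
  have axb: "(0, y) \<in> \<Omega> \<longleftrightarrow> - b / 2 < y \<and> y < b / 2" for y
    using assms(10) by (auto simp: set_eq_iff)
  interpret A: doubly_symmetric_domain \<Omega> a
    using assms(1-3,5) mirr refl axa by unfold_locales (auto simp: zero_prod_def)
  \<comment> \<open>In the turned domain the left half becomes the upper half and the two axes
    change places, so the result for the upper half applies with b.\<close>
  define \<Omega>' where "\<Omega>' = rot ` \<Omega>"
  have \<Omega>': "z \<in> \<Omega>' \<longleftrightarrow> rot' z \<in> \<Omega>" for z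
  proof
    assume "rot' z \<in> \<Omega>"
    then have "rot (rot' z) \<in> \<Omega>'" unfolding \<Omega>'_def by (rule imageI)
    then show "z \<in> \<Omega>'" by simp
  qed (auto simp: \<Omega>'_def)
  have open': "open \<Omega>'"
  proof -
    have "\<Omega>' = rot' -` \<Omega>" using \<Omega>' by auto
    then show ?thesis
      using assms(3) continuous_open_vimage[of \<Omega> rot'] linear_continuous_on[OF bounded_linear_rot(2), of UNIV]
      by (simp add: open_vimage)
  qed
  interpret B: doubly_symmetric_domain \<Omega>' b
  proof
    show "bounded \<Omega>'" unfolding \<Omega>'_def by (rule bounded_linear_image[OF assms(1) bounded_linear_rot(1)])
    show "convex \<Omega>'" unfolding \<Omega>'_def
      by (rule convex_linear_image[OF bounded_linear.linear[OF bounded_linear_rot(1)] assms(2)])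
    show "open \<Omega>'" by (rule open')
    show "0 \<in> \<Omega>'" using assms(5) by (simp add: \<Omega>' rot'_def zero_prod_def)
    show "mirror z \<in> \<Omega>'" if "z \<in> \<Omega>'" for z
      using refl[of "rot' z"] that by (simp add: \<Omega>' rot'_def reflect_def mirror_def)
    show "reflect z \<in> \<Omega>'" if "z \<in> \<Omega>'" for z
      using mirr[of "rot' z"] that by (simp add: \<Omega>' rot'_def reflect_def mirror_def)
    show "(x, 0) \<in> \<Omega>' \<longleftrightarrow> - b / 2 < x \<and> x < b / 2" for x
      using axb[of x] by (simp add: \<Omega>' rot'_def)
  qed
  have uh: "\<Omega>uh = A.upper" using assms(11) by (auto simp: A.upper_def)
  have dotA: "\<Omega>dot = A.punctured" by (simp add: dot A.punctured_def)
  have ob: "open \<Omega>lh" "bounded \<Omega>lh" "open \<Omega>leh" "bounded \<Omega>leh" "open \<Omega>rih" "bounded \<Omega>rih"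
  proof -
    have e: "\<Omega>lh = \<Omega> \<inter> {z. snd z < 0}" "\<Omega>leh = \<Omega> \<inter> {z. fst z < 0}" "\<Omega>rih = \<Omega> \<inter> {z. fst z > 0}"
      using assms(12-14) by auto
    show "open \<Omega>lh" "open \<Omega>leh" "open \<Omega>rih"
      unfolding e by (intro open_Int assms(3) open_Collect_less continuous_intros)+
    show "bounded \<Omega>lh" "bounded \<Omega>leh" "bounded \<Omega>rih"
      unfolding e using assms(1) by (auto intro: bounded_subset)
  qed
  note DN = eigenvalues_DN_Laplacian
  have AB: "eigenvalues \<Omega>dot (AB_Dirichlet \<Omega>dot) = weak_eigenvalues A.punctured (test_functions A.punctured) AB_D1 AB_D2"
    unfolding dotA by (rule eigenvalues_AB_Dirichlet[OF A.punctured_open A.punctured_bounded A.punctured_0])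
  have rayA: "{0<..a / 2} \<times> {0} = A.ray" by (simp add: A.ray_def)
  have 1: "eigenvalues \<Omega>uh (DN_Laplacian \<Omega>uh ({0<..a / 2} \<times> {0})) = eigenvalues \<Omega>dot (AB_Dirichlet \<Omega>dot)"
    unfolding AB uh rayA DN[OF A.upper_open A.upper_bounded] by (rule A.weak_eigenvalues_upper)
  have 2: "eigenvalues \<Omega>lh (DN_Laplacian \<Omega>lh ({0<..a / 2} \<times> {0})) = eigenvalues \<Omega>uh (DN_Laplacian \<Omega>uh ({0<..a / 2} \<times> {0}))"
    unfolding uh DN[OF A.upper_open A.upper_bounded] DN[OF ob(1,2)]
  proof (rule weak_eigenvalues_mixed_involution[OF A.upper_open A.upper_bounded ob(1,2)
        lborel_iso_mirror bounded_linear_mirror mirror_mirror, where ?s1.0=1 and ?s2.0="-1"])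
    show "z \<in> \<Omega>lh \<longleftrightarrow> mirror z \<in> A.upper" for z
      using mirr[of z] mirr[of "mirror z"] by (cases z) (auto simp: assms(12) A.upper_def mirror_def)
    show "z \<in> {0<..a / 2} \<times> {0} \<longleftrightarrow> mirror z \<in> {0<..a / 2} \<times> {0}" for z
      by (cases z) (auto simp: mirror_def)
  qed (simp_all add: mirror_def)
  have 3: "eigenvalues \<Omega>leh (DN_Laplacian \<Omega>leh ({0} \<times> {0<..b / 2})) =
      weak_eigenvalues B.upper (mixed_functions B.upper B.ray) (dirderiv (1, 0)) (dirderiv (0, 1))"
    unfolding DN[OF ob(3,4)]
  proof (rule weak_eigenvalues_mixed_rot[OF B.upper_open B.upper_bounded ob(3,4)])
    show "z \<in> \<Omega>leh \<longleftrightarrow> rot z \<in> B.upper" for z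
      by (cases z) (auto simp: assms(13) B.upper_def \<Omega>' rot_def rot'_def)
    show "z \<in> {0} \<times> {0<..b / 2} \<longleftrightarrow> rot z \<in> B.ray" for z
      by (cases z) (auto simp: B.ray_def rot_def)
  qed
  have 4: "eigenvalues \<Omega>rih (DN_Laplacian \<Omega>rih ({0} \<times> {0<..b / 2})) = eigenvalues \<Omega>leh (DN_Laplacian \<Omega>leh ({0} \<times> {0<..b / 2}))"
    unfolding DN[OF ob(3,4)] DN[OF ob(5,6)]
  proof (rule weak_eigenvalues_mixed_involution[OF ob(3-6)
        lborel_iso_reflect bounded_linear_reflect reflect_reflect, where ?s1.0="-1" and ?s2.0=1])
    show "z \<in> \<Omega>rih \<longleftrightarrow> reflect z \<in> \<Omega>leh" for z
      using refl[of z] refl[of "reflect z"] by (cases z) (auto simp: assms(13,14) reflect_def)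
    show "z \<in> {0} \<times> {0<..b / 2} \<longleftrightarrow> reflect z \<in> {0} \<times> {0<..b / 2}" for z
      by (cases z) (auto simp: reflect_def)
  qed (simp_all add: reflect_def)
  \<comment> \<open>The second instance concerns the Aharonov-Bohm operator of the turned domain;
    invariance of the potential under the turn leads back to the original one.\<close>
  have 5: "weak_eigenvalues A.punctured (test_functions A.punctured) AB_D1 AB_D2 =
      weak_eigenvalues B.punctured (test_functions B.punctured) AB_D1 AB_D2"
  proof (rule weak_eigenvalues_AB_rot[OF B.punctured_open B.punctured_bounded B.punctured_0
        A.punctured_open A.punctured_bounded A.punctured_0])
    show "z \<in> A.punctured \<longleftrightarrow> rot z \<in> B.punctured" for z
      by (cases z) (auto simp: A.punctured_def B.punctured_def \<Omega>' rot_def rot'_def zero_prod_def)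
  qed
  show ?thesis using 1 2 3 4 5 AB B.weak_eigenvalues_upper by simp
qed

end
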